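(* Let $p\in C^{0,\alpha}(\overline\Omega)$ with $p^->1$ and $\alpha\in(0,1]$, let $z\in H^{\gamma,p'(\cdot)}(\Omega)$ with $\gamma\in(0,1]$, with (minimal) Hajłasz gradient $|\nabla^\gamma z|:=\operatorname{argmin}_{g\in\mathrm{Gr}(z)}\|g\|_{p'(\cdot),\Omega}\in L^{p'(\cdot)}(\Omega)$, and let $\mathbf A\in L^{p(\cdot)}(\Omega;\mathbb R^{d\times d})$. Then, for every $m>0$ and $T\in\mathcal T_h$, it holds that $$\rho_{(\varphi_{|\mathbf A^{\rm sym}|})^*,T}(z-\Pi_h^Qz)\le c\,\big(h_T^m+\rho_{(\varphi_{|\mathbf A^{\rm sym}|})^*,\omega_T}(h_T^\gamma|\nabla^\gamma z|)\big)+c\,\|\mathbf F(\cdot,\mathbf A)-\mathbf F(\cdot,\langle\mathbf A\rangle_{\omega_T})\|_{2,\omega_T}^2,$$ where $c>0$ depends only on $d,k,\ell,m,p^-,p^+,[p]_{\alpha,\Omega},\delta,\omega_0,\|\mathbf A\|_{p(\cdot),\Omega}$, and $\|z\|_{\gamma,p'(\cdot),\Omega}$. In particular, it holds that $$\rho_{(\varphi_{|\mathbf A^{\rm sym}|})^*,\Omega}(z-\Pi_h^Qz)\le c\,\big(h^m+\rho_{(\varphi_{|\mathbf A^{\rm sym}|})^*,\Omega}(h^\gamma|\nabla^\gamma z|)\big)+c\sum_{T\in\mathcal T_h}\|\mathbf F(\cdot,\mathbf A)-\mathbf F(\cdot,\langle\mathbf A\rangle_{\omega_T})\|_{2,\o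mega_T}^2.$$
   Context: $\Omega\subseteq\mathbb R^d$, $d\in\{2,3\}$, is a bounded simplicial (polygonal/polyhedral) Lipschitz domain. $\{\mathcal T_h\}_{h\in(0,1]}$ is a family of conforming triangulations of $\Omega$ into $d$-simplices; $h_T:=\mathrm{diam}(T)$, $h=\max_{T\in\mathcal T_h}h_T$, $\rho_T$ is the supremum of diameters of balls inscribed in $T$, and $\omega_0$ (chunkiness) is the smallest constant, independent of $h$, with $\max_Th_T\rho_T^{-1}\le\omega_0$. $\omega_T:=\bigcup\{T'\in\mathcal T_h:T'\cap T\neq\emptyset\}$. $\langle f\rangle_M$ is the integral mean of $f$ over $M$. $f\lesssim g$ means $f\le c\,g$ with a constant $c>0$. For an exponent $p$: $p^-=\operatorname{ess\,inf}p$, $p^+=\operatorname{ess\,sup}p$, $p'=p/(p-1)$, $\|v\|_{p(\cdot),M}=\inf\{\lambda>0:\int_M|v/\lambda|^{p(x)}dx\le1\}$ is the norm of $L^{p(\cdot)}(M)$, and $[p]_{\alpha,\Omega}$ is the $\alpha$-Hölder seminorm of $p$. For $\gamma\in(0,1]$ and $v\in L^{p'(\cdot)}(\Omega)$, $\mathrm{Gr}(v)$ is the set of $g\in L^{p'(\cdot)}(\Omega;\mathbb R_{\ge0})$ with $|v(x)-v(y)|\le(g(x)+g(y))|x-y|^\gamma$ for a.e. $x,y\in\Omega$; $H^{\gamma,p'(\cdot)}(\Omega):=\{v\in L^{p'(\cdot)}(\Omega):\mathrm{Gr}(v)\ne\emptyset\}$ with norm $\|v\|_{\gamma,p'(\cdot),\Omega}:=\|v\|_{p'(\cdot),\Omega}+\inf_{g\in\mathrm{Gr}(v)}\|g\|_{p'(\cdot),\Omega}$;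 the minimizer defining $|\nabla^\gamma v|$ exists uniquely. $\delta\ge0$ is fixed; $\mathbf A^{\rm sym}=\frac12(\mathbf A+\mathbf A^\top)$; $\mathbf F(x,\mathbf A):=(\delta+|\mathbf A^{\rm sym}|)^{\frac{p(x)-2}{2}}\mathbf A^{\rm sym}$. $\varphi(x,t):=\int_0^t(\delta+\tau)^{p(x)-2}\tau\,d\tau$; for $a\ge0$, $\varphi_a(x,t):=\int_0^t\varphi'(x,a+\tau)\frac{\tau}{a+\tau}\,d\tau$ ($\varphi'=\partial_t\varphi$), $(\varphi_a)^*(x,t):=\sup_{\tau\ge0}\{\tau t-\varphi_a(x,\tau)\}$, and for measurable $a:\Omega\to\mathbb R_{\ge0}$, $\rho_{(\varphi_a)^*,M}(g):=\int_M(\varphi_{a(x)})^*(x,|g(x)|)\,dx$. $\mathbb P^\ell(\mathcal T_h)$ ($\ell\in\mathbb N_0$) is the space of elementwise polynomials of degree at most $\ell$; $Q:=L^{p'(\cdot)}(\Omega)$, $Q_h\subseteq\mathbb P^\ell(\mathcal T_h)$ is a finite element space with $\mathbb R\subseteq Q_h$, and $\Pi_h^Q:Q\to Q_h$ is a linear projection that is locally $L^1$-stable, i.e. $\langle|\Pi_h^Qz|\rangle_T\lesssim\langle|z|\rangle_{\omega_T}$ for all $z\in Q$, $T\in\mathcal T_h$, with a constant uniform in $h,T,z$, regarded as fixed ($c$ may depend on it). The integer $k\in\mathbb N$ is the polynomial degree of the (here irrelevant) velocity space.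
   Formalization: In the second ("in particular") inequality the constant c may additionally depend on the volume |Ω|; with only the listed dependencies it fails (long strips of N congruent cells with periodic p, A=0, δ=0). The first inequality's constant does not depend on Ω. *)

theory Defs
  imports "HOL-Analysis.Analysis" "HOL-Probability.Essential_Supremum"
begin

text \<open>
  Measurable functions on a set are represented by total functions, measured with
  \<open>lebesgue_on\<close>; values off the set, or on a null set, are irrelevant, so that identities
  between elements of Lebesgue spaces are stated almost everywhere. Elements of a mesh are closed
  simplices, hence patches may contain points of the (null) boundary of the domain.
\<close>

section \<open>Domains and meshes\<close>

text \<open>
  Near each boundary point, in a suitable direction \<open>e\<close>, the domain is the strict epigraph of a
  Lipschitz function on the hyperplane orthogonal to \<open>e\<close>.
\<close>

definition lipschitz_domain :: "'a::euclidean_space set \<Rightarrow> bool" where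
  "lipschitz_domain \<Omega> \<longleftrightarrow> open \<Omega> \<and> connected \<Omega> \<and> \<Omega> \<noteq> {} \<and>
     (\<forall>x0 \<in> frontier \<Omega>. \<exists>e r L \<zeta>. norm e = 1 \<and> 0 < r \<and> L-lipschitz_on {y. y \<bullet> e = 0} \<zeta> \<and>
        (\<forall>x \<in> ball x0 r. x \<in> \<Omega> \<longleftrightarrow> \<zeta> (x - (x \<bullet> e) *\<^sub>R e) < x \<bullet> e))"

definition simplicial_lipschitz_domain :: "'a::euclidean_space set \<Rightarrow> bool" where
  "simplicial_lipschitz_domain \<Omega> \<longleftrightarrow> bounded \<Omega> \<and> lipschitz_domain \<Omega> \<and>
     (\<exists>\<S>. finite \<S> \<and> (\<forall>S\<in>\<S>. int DIM('a) simplex S) \<and> closure \<Omega> = \<Union>\<S>)"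

text \<open>Conformity is part of \<^const>\<open>triangulation\<close>: two members meet in a common (possibly empty) face.\<close>

definition conforming_mesh :: "'a::euclidean_space set \<Rightarrow> 'a set set \<Rightarrow> bool" where
  "conforming_mesh \<Omega> \<T> \<longleftrightarrow>
     triangulation \<T> \<and> (\<forall>T\<in>\<T>. int DIM('a) simplex T) \<and> \<Union>\<T> = closure \<Omega>"

text \<open>
  The family is indexed by its own mesh sizes. The index set \<open>H\<close> is a subset of \<open>(0,1]\<close>, because
  a domain of diameter less than \<open>1\<close> has no mesh of size \<open>1\<close>.
\<close>

definition mesh_family :: "'a::euclidean_space set \<Rightarrow> real set \<Rightarrow> (real \<Rightarrow> 'a set set) \<Rightarrow> bool" where
  "mesh_family \<Omega> H \<T> \<longleftrightarrow> H \<subseteq> {0<..1} \<and>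
     (\<forall>h\<in>H. conforming_mesh \<Omega> (\<T> h) \<and> Max (diameter ` \<T> h) = h)"

definition inball_diameter :: "'a::euclidean_space set \<Rightarrow> real" where
  "inball_diameter T = Sup {diameter (ball x r) |x r. 0 < r \<and> ball x r \<subseteq> T}"

definition chunkiness_bound :: "real set \<Rightarrow> (real \<Rightarrow> 'a::euclidean_space set set) \<Rightarrow> real \<Rightarrow> bool" where
  "chunkiness_bound H \<T> \<omega> \<longleftrightarrow> (\<forall>h\<in>H. \<forall>T\<in>\<T> h. diameter T / inball_diameter T \<le> \<omega>)"

definition is_chunkiness :: "real set \<Rightarrow> (real \<Rightarrow> 'a::euclidean_space set set) \<Rightarrow> real \<Rightarrow> bool" where
  "is_chunkiness H \<T> \<omega> \<longleftrightarrow>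
     chunkiness_bound H \<T> \<omega> \<and> (\<forall>\<omega>'. chunkiness_bound H \<T> \<omega>' \<longrightarrow> \<omega> \<le> \<omega>')"

definition patch :: "'a set set \<Rightarrow> 'a set \<Rightarrow> 'a set" where
  "patch \<T> T = \<Union>{T'\<in>\<T>. T' \<inter> T \<noteq> {}}"

definition mean_on ::
  "'a::euclidean_space set \<Rightarrow> ('a \<Rightarrow> 'b::{banach, second_countable_topology}) \<Rightarrow> 'b" where
  "mean_on M f = (1 / measure lebesgue M) *\<^sub>R set_lebesgue_integral lebesgue M f"


section \<open>Variable exponents\<close>

definition essinf :: "'a measure \<Rightarrow> ('a \<Rightarrow> ereal) \<Rightarrow> ereal" where
  "essinf M f = - esssup M (\<lambda>x. - f x)"

definition dual_exponent :: "('a \<Rightarrow> real) \<Rightarrow> 'a \<Rightarrow> real" where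
  "dual_exponent p x = p x / (p x - 1)"

definition holder_on :: "real \<Rightarrow> 'a::metric_space set \<Rightarrow> ('a \<Rightarrow> real) \<Rightarrow> bool" where
  "holder_on \<alpha> S p \<longleftrightarrow> (\<exists>K. \<forall>x\<in>S. \<forall>y\<in>S. \<bar>p x - p y\<bar> \<le> K * dist x y powr \<alpha>)"

definition holder_seminorm :: "real \<Rightarrow> 'a::metric_space set \<Rightarrow> ('a \<Rightarrow> real) \<Rightarrow> real" where
  "holder_seminorm \<alpha> S p =
     Sup {\<bar>p x - p y\<bar> / dist x y powr \<alpha> |x y. x \<in> S \<and> y \<in> S \<and> x \<noteq> y}"

definition exp_modular ::
  "('a::euclidean_space \<Rightarrow> real) \<Rightarrow> 'a set \<Rightarrow> ('a \<Rightarrow> 'b::real_normed_vector) \<Rightarrow> ennreal" where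
  "exp_modular p M v = (\<integral>\<^sup>+x. ennreal (norm (v x) powr p x) \<partial>lebesgue_on M)"

definition Lvar ::
  "('a::euclidean_space \<Rightarrow> real) \<Rightarrow> 'a set \<Rightarrow> ('a \<Rightarrow> 'b::real_normed_vector) set" where
  "Lvar p M = {v. v \<in> borel_measurable (lebesgue_on M) \<and>
     (\<exists>s>0. exp_modular p M (\<lambda>x. v x /\<^sub>R s) < \<infinity>)}"

definition Lvar_norm ::
  "('a::euclidean_space \<Rightarrow> real) \<Rightarrow> 'a set \<Rightarrow> ('a \<Rightarrow> 'b::real_normed_vector) \<Rightarrow> real" where
  "Lvar_norm p M v = Inf {s. 0 < s \<and> exp_modular p M (\<lambda>x. v x /\<^sub>R s) \<le> 1}"

definition L2_norm_squared :: "'a::euclidean_space set \<Rightarrow> ('a \<Rightarrow> 'b::real_normed_vector) \<Rightarrow> ennreal" where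
  "L2_norm_squared M v = (\<integral>\<^sup>+x. ennreal ((norm (v x))\<^sup>2) \<partial>lebesgue_on M)"


section \<open>Hajlasz--Sobolev spaces\<close>

text \<open>In this section \<open>q\<close> is the integrability exponent (\<^term>\<open>dual_exponent p\<close> in the application).\<close>

definition hajlasz_gradients ::
  "real \<Rightarrow> ('a::euclidean_space \<Rightarrow> real) \<Rightarrow> 'a set \<Rightarrow> ('a \<Rightarrow> real) \<Rightarrow> ('a \<Rightarrow> real) set" where
  "hajlasz_gradients \<gamma> q \<Omega> v = {g \<in> Lvar q \<Omega>. (\<forall>x\<in>\<Omega>. 0 \<le> g x) \<and>
     (AE x in lebesgue_on \<Omega>. AE y in lebesgue_on \<Omega>. \<bar>v x - v y\<bar> \<le> (g x + g y) * dist x y powr \<gamma>)}"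

definition hajlasz_space ::
  "real \<Rightarrow> ('a::euclidean_space \<Rightarrow> real) \<Rightarrow> 'a set \<Rightarrow> ('a \<Rightarrow> real) set" where
  "hajlasz_space \<gamma> q \<Omega> = {v \<in> Lvar q \<Omega>. hajlasz_gradients \<gamma> q \<Omega> v \<noteq> {}}"

definition hajlasz_norm ::
  "real \<Rightarrow> ('a::euclidean_space \<Rightarrow> real) \<Rightarrow> 'a set \<Rightarrow> ('a \<Rightarrow> real) \<Rightarrow> real" where
  "hajlasz_norm \<gamma> q \<Omega> v =
     Lvar_norm q \<Omega> v + (INF g\<in>hajlasz_gradients \<gamma> q \<Omega> v. Lvar_norm q \<Omega> g)"

text \<open>
  The minimizer is unique only as an element of the Lebesgue space, so it is described by a
  predicate satisfied by all its representatives.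
\<close>

definition is_minimal_hajlasz_gradient ::
  "real \<Rightarrow> ('a::euclidean_space \<Rightarrow> real) \<Rightarrow> 'a set \<Rightarrow> ('a \<Rightarrow> real) \<Rightarrow> ('a \<Rightarrow> real) \<Rightarrow> bool" where
  "is_minimal_hajlasz_gradient \<gamma> q \<Omega> v g \<longleftrightarrow>
     is_arg_min (Lvar_norm q \<Omega>) (\<lambda>g. g \<in> hajlasz_gradients \<gamma> q \<Omega> v) g"


section \<open>The extra stress structure\<close>

definition sym_part :: "real^'n^'n \<Rightarrow> real^'n^'n" where
  "sym_part A = (1 / 2) *\<^sub>R (A + transpose A)"

definition F_map :: "real \<Rightarrow> ('a \<Rightarrow> real) \<Rightarrow> 'a \<Rightarrow> real^'n^'n \<Rightarrow> real^'n^'n" where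
  "F_map \<delta> p x A = ((\<delta> + norm (sym_part A)) powr ((p x - 2) / 2)) *\<^sub>R sym_part A"

definition phi :: "real \<Rightarrow> ('a \<Rightarrow> real) \<Rightarrow> 'a \<Rightarrow> real \<Rightarrow> real" where
  "phi \<delta> p x t = integral {0..t} (\<lambda>\<tau>. (\<delta> + \<tau>) powr (p x - 2) * \<tau>)"

definition phi_shift :: "real \<Rightarrow> ('a \<Rightarrow> real) \<Rightarrow> real \<Rightarrow> 'a \<Rightarrow> real \<Rightarrow> real" where
  "phi_shift \<delta> p a x t = integral {0..t} (\<lambda>\<tau>. deriv (phi \<delta> p x) (a + \<tau>) * (\<tau> / (a + \<tau>)))"

text \<open>The supremum is finite whenever \<open>p x > 1\<close>, and nonnegative for \<open>t \<ge> 0\<close> because of \<open>\<tau> = 0\<close>.\<close>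

definition phi_shift_conj :: "real \<Rightarrow> ('a \<Rightarrow> real) \<Rightarrow> real \<Rightarrow> 'a \<Rightarrow> real \<Rightarrow> real" where
  "phi_shift_conj \<delta> p a x t = (SUP \<tau>\<in>{0..}. \<tau> * t - phi_shift \<delta> p a x \<tau>)"

definition conj_modular ::
  "real \<Rightarrow> ('a::euclidean_space \<Rightarrow> real) \<Rightarrow> ('a \<Rightarrow> real) \<Rightarrow> 'a set \<Rightarrow> ('a \<Rightarrow> real) \<Rightarrow> ennreal" where
  "conj_modular \<delta> p a M g = (\<integral>\<^sup>+x. ennreal (phi_shift_conj \<delta> p (a x) x \<bar>g x\<bar>) \<partial>lebesgue_on M)"


section \<open>Discrete spaces and projections\<close>

definition poly_of_degree_le :: "nat \<Rightarrow> (real^'n \<Rightarrow> real) \<Rightarrow> bool" where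
  "poly_of_degree_le l q \<longleftrightarrow> (\<exists>c :: ('n \<Rightarrow> nat) \<Rightarrow> real. \<forall>x.
     q x = (\<Sum>\<beta> | sum \<beta> UNIV \<le> l. c \<beta> * (\<Prod>i\<in>UNIV. x $ i ^ \<beta> i)))"

lemma finite_multiindices: "finite {\<beta> :: 'n::finite \<Rightarrow> nat. sum \<beta> UNIV \<le> l}"
proof (rule finite_subset)
  show "{\<beta> :: 'n \<Rightarrow> nat. sum \<beta> UNIV \<le> l} \<subseteq> UNIV \<rightarrow>\<^sub>E {..l}"
  proof
    fix \<beta> :: "'n \<Rightarrow> nat"
    assume "\<beta> \<in> {\<beta>. sum \<beta> UNIV \<le> l}"
    then have "\<beta> i \<le> l" for i
      using member_le_sum[of i UNIV \<beta>] by simp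
    then show "\<beta> \<in> UNIV \<rightarrow>\<^sub>E {..l}"
      by (simp add: PiE_iff)
  qed
  show "finite ((UNIV :: 'n set) \<rightarrow>\<^sub>E {..l})"
    by (rule finite_PiE) simp_all
qed

definition piecewise_poly :: "nat \<Rightarrow> (real^'n) set set \<Rightarrow> (real^'n \<Rightarrow> real) set" where
  "piecewise_poly l \<T> = {f. \<forall>T\<in>\<T>. \<exists>q. poly_of_degree_le l q \<and> (AE x in lebesgue_on T. f x = q x)}"

definition fe_space :: "nat \<Rightarrow> (real^'n) set set \<Rightarrow> (real^'n \<Rightarrow> real) set \<Rightarrow> bool" where
  "fe_space l \<T> V \<longleftrightarrow> V \<subseteq> piecewise_poly l \<T> \<and>
     (\<forall>f\<in>V. \<forall>g\<in>V. \<forall>a b. (\<lambda>x. a * f x + b * g x) \<in> V) \<and> (\<forall>a. (\<lambda>x. a) \<in> V)"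

definition linear_projection ::
  "'a::euclidean_space set \<Rightarrow> ('a \<Rightarrow> real) set \<Rightarrow> ('a \<Rightarrow> real) set \<Rightarrow> (('a \<Rightarrow> real) \<Rightarrow> 'a \<Rightarrow> real) \<Rightarrow> bool"
where
  "linear_projection \<Omega> Q V P \<longleftrightarrow>
     (\<forall>z\<in>Q. P z \<in> V) \<and>
     (\<forall>z\<in>Q. \<forall>w\<in>Q. (AE x in lebesgue_on \<Omega>. z x = w x) \<longrightarrow> (AE x in lebesgue_on \<Omega>. P z x = P w x)) \<and>
     (\<forall>z\<in>Q. \<forall>w\<in>Q. \<forall>a b. AE x in lebesgue_on \<Omega>. P (\<lambda>y. a * z y + b * w y) x = a * P z x + b * P w x) \<and>
     (\<forall>v\<in>V. AE x in lebesgue_on \<Omega>. P v x = v x)"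

definition locally_L1_stable ::
  "real \<Rightarrow> 'a::euclidean_space set set \<Rightarrow> ('a \<Rightarrow> real) set \<Rightarrow> (('a \<Rightarrow> real) \<Rightarrow> 'a \<Rightarrow> real) \<Rightarrow> bool" where
  "locally_L1_stable K \<T> Q P \<longleftrightarrow>
     (\<forall>z\<in>Q. \<forall>T\<in>\<T>. mean_on T (\<lambda>x. \<bar>P z x\<bar>) \<le> K * mean_on (patch \<T> T) (\<lambda>x. \<bar>z x\<bar>))"

end

theory Submission
  imports Defs
begin

text \<open>
Write \<open>q = p / (p - 1)\<close>, \<open>b = \<delta> + |A\<^sup>s\<^sup>y\<^sup>m|\<close> and
\<open>M\<^sub>x(b, t) = (s + t)\<^sup>q (t / (s + t))\<^sup>2\<close> with \<open>s = b\<^sup>p\<^sup>-\<^sup>1\<close>, where \<open>p\<close> and \<open>q\<close> are taken at \<open>x\<close>.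
The conjugate of the shifted N-function is equivalent to \<open>M\<^sub>x(b, t)\<close> with constants that depend only on the
bounds of \<open>p\<close> (\<open>phi_shift_conj_equiv\<close>). This formula is visibly measurable, doubling and increasing in \<open>t\<close>,
and so is \<open>M\<^sub>x(b, t) / t\<close>; everything below is proved for it.

Let \<open>D\<close> be the patch of \<open>T\<close> intersected with the domain, \<open>h\<close> the diameter of \<open>T\<close>, \<open>g\<close> the Hajlasz
gradient, and \<open>\<langle>g\<rangle>\<close> its mean over \<open>D\<close>. Constants are reproduced by the projection, so
\<open>z - \<Pi>z = (z - c) - \<Pi>(z - c)\<close> where \<open>c\<close> is the mean of \<open>z\<close> over \<open>D\<close>. Averaging the inequality that defines
\<open>g\<close> bounds \<open>|z - c|\<close> by a multiple of \<open>h\<^sup>\<gamma> (g + \<langle>g\<rangle>)\<close>; a polynomial on a convex body is bounded by its mean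
(\<open>poly_sup_le_integral\<close>), so the local stability bounds \<open>|\<Pi>(z - c)|\<close> by a multiple of \<open>h\<^sup>\<gamma> \<langle>g\<rangle>\<close>.
Hence \<open>|z - \<Pi>z| \<le> C h\<^sup>\<gamma> (g + \<langle>g\<rangle>)\<close> almost everywhere on \<open>T\<close> (\<open>projection_error_le\<close>). The part with \<open>g\<close> is
on the right-hand side of the claim. For the part with the number \<open>u = h\<^sup>\<gamma> \<langle>g\<rangle>\<close> one needs a Jensen inequality
for \<open>M\<^sub>x\<close>, although both the shift and the exponent vary with \<open>x\<close>.

The shift is frozen first: replacing \<open>|A\<^sup>s\<^sup>y\<^sup>m|\<close> by its value for the mean of \<open>A\<close> costs at most
\<open>|F(A) - F(\<langle>A\<rangle>)|\<^sup>2\<close> (\<open>shift_change\<close>). The integrability of \<open>A\<close> and \<open>g\<close> bounds their means by a fixed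
power of \<open>1/h\<close>. If also \<open>u \<ge> h\<^sup>N\<close>, then Hoelder continuity of \<open>p\<close> makes \<open>M\<^sub>x(b, u)\<close> and \<open>M\<^sub>y(b, u)\<close>
comparable for all \<open>x, y\<close> in \<open>D\<close>, because \<open>h\<close> raised to a multiple of \<open>h\<^sup>\<alpha>\<close> stays bounded
(\<open>shifted_power_exponent_change\<close>). If \<open>u < h\<^sup>N\<close> with \<open>N\<close> large, the whole term is at most a multiple of
\<open>h\<^sup>m\<close> (\<open>shifted_power_tiny_argument\<close>). The exponents are compared only at the argument \<open>u\<close>, so the fact that
\<open>g\<close> itself is unbounded does no harm: monotonicity of \<open>M\<^sub>y(b, t) / t\<close> gives
\<open>M\<^sub>y(b, u) (t / u - 1/2) \<le> C M\<^sub>y(b, t)\<close> for all \<open>t \<ge> 0\<close>, and averaging this over \<open>y\<close> with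
\<open>t = h\<^sup>\<gamma> g(y)\<close>, whose mean is \<open>u\<close>, leaves half of \<open>M(b, u)\<close> on the left. This is
\<open>conj_modular_local_estimate\<close>.

The geometric input is that the elements of a patch have comparable diameters and bounded number. Two simplices
that share an edge are comparable, since an inscribed ball is not wider than any edge. Around a point of the closed
domain the simplices are linked by shared edges, because small punctured neighbourhoods in a Lipschitz domain are
connected (\<open>star_edge_connected\<close>), and disjoint inscribed balls bound the number of links. The local estimate
carries the factor \<open>|T|\<close> in front of \<open>h\<^sup>m\<close>; it can therefore be summed over the mesh, with the volume of the
domain as a factor, since the patches overlap boundedly.
\<close>

section \<open>The shifted power function\<close>

text \<open>
For \<open>s > 0\<close> this is the function \<open>(s + t)\<^sup>q\<^sup>-\<^sup>2 t\<^sup>2\<close>. In the form chosen here both factors increase with \<open>t\<close>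
for every \<open>q \<ge> 0\<close>, so that \<open>q < 2\<close> and \<open>q \<ge> 2\<close> need no separate treatment, and the value at \<open>s = t = 0\<close> is
\<open>0\<close> by the convention for division.
\<close>

definition shifted_power :: "real \<Rightarrow> real \<Rightarrow> real \<Rightarrow> real" where
  "shifted_power q s t = (s + t) powr q * (t / (s + t))\<^sup>2"

lemma shifted_power_nonneg [simp]: "0 \<le> shifted_power q s t"
  by (simp add: shifted_power_def)

lemma shifted_power_0 [simp]: "shifted_power q s 0 = 0"
  by (simp add: shifted_power_def)

lemma fraction_mono:
  fixes s t t' :: real
  assumes "0 \<le> s" "0 \<le> t" "t \<le> t'"
  shows "t / (s + t) \<le> t' / (s + t')"
proof (cases "t = 0")
  case False
  then have "0 < t" "0 < s + t" "0 < s + t'" using assms by auto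
  moreover have "t * (s + t') \<le> t' * (s + t)"
    using assms by (simp add: algebra_simps mult_left_mono)
  ultimately show ?thesis by (simp add: frac_le_eq divide_le_eq field_simps)
qed (use assms in auto)

lemma shifted_power_mono:
  assumes "0 \<le> q" "0 \<le> s" "0 \<le> t" "t \<le> t'"
  shows "shifted_power q s t \<le> shifted_power q s t'"
  unfolding shifted_power_def
  by (intro mult_mono powr_mono2 power_mono fraction_mono) (use assms in auto)

text \<open>
The function depends on the shift only through \<open>s + t\<close>, hence shifts that are comparable up to an error of
order \<open>t\<close> may be exchanged.
\<close>

lemma shifted_power_comparable:
  assumes "0 \<le> q" "0 \<le> s" "0 \<le> s'" "0 \<le> t" "1 \<le> C"
    and st: "s + t \<le> C * (s' + t)" and st': "s' + t \<le> C * (s + t)"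
  shows "shifted_power q s t \<le> C powr (q + 2) * shifted_power q s' t"
proof (cases "t = 0")
  case False
  then have t: "0 < t" using assms by simp
  have "(s + t) powr q \<le> (C * (s' + t)) powr q"
    using assms by (intro powr_mono2) auto
  also have "\<dots> = C powr q * (s' + t) powr q"
    using assms by (intro powr_mult)
  finally have 1: "(s + t) powr q \<le> C powr q * (s' + t) powr q" .
  have "t / (s + t) \<le> C * (t / (s' + t))"
  proof -
    have "t * (s' + t) \<le> t * (C * (s + t))"
      using st' t by (intro mult_left_mono) auto
    then show ?thesis using t assms by (simp add: field_simps)
  qed
  then have 2: "(t / (s + t))\<^sup>2 \<le> C\<^sup>2 * (t / (s' + t))\<^sup>2"
    using t assms by (metis divide_nonneg_nonneg add_nonneg_nonneg power_mono power_mult_distrib)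
  have C2: "C powr (q + 2) = C powr q * C\<^sup>2"
    using assms by (simp add: powr_add powr_numeral)
  then show ?thesis
    unfolding shifted_power_def C2
    using mult_mono[OF 1 2] assms by (simp add: ac_simps)
qed simp

lemma shifted_power_scale:
  assumes "0 \<le> q" "0 \<le> s" "0 \<le> t" "1 \<le> C"
  shows "shifted_power q s (C * t) \<le> C powr (q + 2) * shifted_power q s t"
proof (cases "t = 0")
  case False
  then have t: "0 < t" using assms by simp
  have tC: "t \<le> C * t" "s \<le> C * s" "0 < C * t" using t assms by (auto simp: mult_le_cancel_right1)
  have "(s + C * t) powr q \<le> (C * (s + t)) powr q"
    using assms t tC by (intro powr_mono2) (auto simp: algebra_simps)
  also have "\<dots> = C powr q * (s + t) powr q"
    using assms by (intro powr_mult)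
  finally have 1: "(s + C * t) powr q \<le> C powr q * (s + t) powr q" .
  have "C * t / (s + C * t) \<le> C * t / (s + t)"
    using t tC assms by (intro divide_left_mono mult_pos_pos add_nonneg_pos) auto
  then have "C * t / (s + C * t) \<le> C * (t / (s + t))" by simp
  then have 2: "(C * t / (s + C * t))\<^sup>2 \<le> C\<^sup>2 * (t / (s + t))\<^sup>2"
    using t tC assms power_mono[of "C * t / (s + C * t)" "C * (t / (s + t))" 2]
    by (simp only: power_mult_distrib) simp
  have C2: "C powr (q + 2) = C powr q * C\<^sup>2"
    using assms by (simp add: powr_add powr_numeral)
  then show ?thesis
    unfolding shifted_power_def C2
    using mult_mono[OF 1 2] assms by (simp add: ac_simps)
qed simp

lemma shifted_power_add:
  assumes "0 \<le> q" "0 \<le> s" "0 \<le> u" "0 \<le> v"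
  shows "shifted_power q s (u + v) \<le> 2 powr (q + 2) * (shifted_power q s u + shifted_power q s v)"
proof -
  have "shifted_power q s (u + v) \<le> shifted_power q s (2 * max u v)"
    using assms by (intro shifted_power_mono) auto
  also have "\<dots> \<le> 2 powr (q + 2) * shifted_power q s (max u v)"
    using assms by (intro shifted_power_scale) auto
  also have "\<dots> \<le> 2 powr (q + 2) * (shifted_power q s u + shifted_power q s v)"
    by (intro mult_left_mono) (auto simp: max_def)
  finally show ?thesis .
qed

lemma shifted_power_le:
  assumes "0 \<le> s" "0 \<le> t"
  shows "shifted_power q s t \<le> (s + t) powr q"
proof -
  have "t / (s + t) \<le> 1" using assms by (auto simp: divide_le_eq_1)
  then have "(t / (s + t))\<^sup>2 \<le> 1" using assms by (simp add: power_le_one)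
  then show ?thesis
    unfolding shifted_power_def by (simp add: mult_left_le)
qed

lemma shifted_power_ge:
  assumes "0 \<le> s" "s \<le> t" "0 \<le> q"
  shows "t powr q / 4 \<le> shifted_power q s t"
proof (cases "t = 0")
  case False
  then have t: "0 < t" using assms by auto
  then have "1 / 2 \<le> t / (s + t)" using assms by (simp add: field_simps)
  then have "(1 / 2)\<^sup>2 \<le> (t / (s + t))\<^sup>2" by (rule power_mono) simp
  moreover have "t powr q \<le> (s + t) powr q" using assms t by (intro powr_mono2) auto
  ultimately show ?thesis
    unfolding shifted_power_def using mult_mono[of "t powr q" "(s + t) powr q" "(1 / 2)\<^sup>2" "(t / (s + t))\<^sup>2"]
    by (simp add: power_divide)
qed simp

text \<open>
Dividing by \<open>t\<close> leaves a product of two factors that are nondecreasing once \<open>q \<ge> 1\<close>; this is the source of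
the convexity-like behaviour used below.
\<close>

lemma shifted_power_factor:
  assumes "0 \<le> s" "0 < t"
  shows "shifted_power q s t = (s + t) powr (q - 1) * (t / (s + t)) * t"
proof -
  have "(s + t) powr q = (s + t) powr (q - 1) * (s + t)"
    using assms by (simp add: powr_mult_base[symmetric] powr_diff)
  then show ?thesis
    using assms by (simp add: shifted_power_def power2_eq_square)
qed

lemma shifted_power_quotient_mono:
  assumes "1 \<le> q" "0 \<le> s" "0 < t" "t \<le> t'"
  shows "shifted_power q s t * t' \<le> shifted_power q s t' * t"
proof -
  have "(s + t) powr (q - 1) * (t / (s + t)) \<le> (s + t') powr (q - 1) * (t' / (s + t'))"
    by (intro mult_mono powr_mono2 fraction_mono) (use assms in auto)
  then have "(s + t) powr (q - 1) * (t / (s + t)) * (t * t') \<le> (s + t') powr (q - 1) * (t' / (s + t')) * (t * t')"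
    using assms by (intro mult_right_mono) auto
  then show ?thesis
    using assms by (simp add: shifted_power_factor ac_simps)
qed

lemma shifted_power_le_linear:
  assumes "1 \<le> q" "0 \<le> s" "0 \<le> t"
  shows "shifted_power q s t \<le> (s + t) powr (q - 1) * t"
proof (cases "t = 0")
  case False
  then have t: "0 < t" using assms by simp
  have "(s + t) powr (q - 1) * (t / (s + t)) * t \<le> (s + t) powr (q - 1) * 1 * t"
    using assms t by (intro mult_mono) (auto simp: divide_le_eq_1)
  then show ?thesis using shifted_power_factor[of s t q] assms t by simp
qed simp

text \<open>
Monotonicity of the quotient is applied from \<open>u/2\<close>, not from \<open>u\<close>, so that all \<open>t \<ge> u/2\<close> are covered;
doubling pays for the difference.
\<close>

lemma shifted_power_superlinear:
  assumes "1 \<le> q" "0 \<le> s" "0 < u" "u / 2 \<le> t"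
  shows "shifted_power q s u * (t / u) \<le> 2 powr (q + 2) * shifted_power q s t"
proof -
  have "shifted_power q s u \<le> 2 powr (q + 2) * shifted_power q s (u / 2)"
    using shifted_power_scale[of q s "u / 2" 2] assms by simp
  then have "shifted_power q s u * (t / u) \<le> 2 powr (q + 2) * shifted_power q s (u / 2) * (t / u)"
    using assms by (intro mult_right_mono) auto
  also have "\<dots> = 2 powr (q + 2) / u * (shifted_power q s (u / 2) * t)" by simp
  also have "\<dots> \<le> 2 powr (q + 2) / u * (shifted_power q s t * (u / 2))"
    using assms shifted_power_quotient_mono[of q s "u / 2" t] by (intro mult_left_mono) auto
  also have "\<dots> = 2 powr (q + 2) * shifted_power q s t / 2" using assms by simp
  also have "\<dots> \<le> 2 powr (q + 2) * shifted_power q s t" by simp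
  finally show ?thesis .
qed

text \<open>
This pointwise inequality replaces Jensen's inequality: if \<open>t\<close> is a function with mean \<open>u\<close>, then
integration turns the bracket into \<open>1/2\<close>. Where \<open>t \<ge> u/2\<close> it is the quasi-monotonicity of
\<open>shifted_power q s t / t\<close>; elsewhere the left-hand side is not positive.
\<close>

lemma shifted_power_weak_jensen:
  assumes "1 \<le> q" "0 \<le> s" "0 < u" "0 \<le> t"
  shows "shifted_power q s u * (t / u - 1 / 2) \<le> 2 powr (q + 2) * shifted_power q s t"
proof (cases "u / 2 \<le> t")
  case True
  have "shifted_power q s u * (t / u - 1 / 2) \<le> shifted_power q s u * (t / u)"
    by (intro mult_left_mono) auto
  then show ?thesis using shifted_power_superlinear[OF assms(1-3) True] by linarith
next
  case False
  then have "t / u - 1 / 2 \<le> 0" using assms by (simp add: field_simps)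
  then have "shifted_power q s u * (t / u - 1 / 2) \<le> 0"
    by (simp add: mult_nonneg_nonpos)
  also have "\<dots> \<le> 2 powr (q + 2) * shifted_power q s t" by simp
  finally show ?thesis .
qed

section \<open>The conjugate of the shifted N-function\<close>

text \<open>
The derivative of \<open>phi\<close> with \<open>\<delta>\<close> replaced by \<open>b\<close>.
\<close>

definition phi_density :: "real \<Rightarrow> real \<Rightarrow> real \<Rightarrow> real" where
  "phi_density b P t = (b + t) powr (P - 2) * t"

text \<open>
Like \<open>shifted_power\<close>, a product of two increasing factors, valid also at \<open>b = t = 0\<close>.
\<close>

lemma phi_density_eq:
  assumes "0 \<le> b" "0 \<le> t"
  shows "phi_density b P t = (b + t) powr (P - 1) * (t / (b + t))"
proof (cases "t = 0")
  case False
  then have "0 < b + t" using assms by simp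
  moreover have "(b + t) powr (P - 1) = (b + t) powr (P - 2 + 1)" by simp
  ultimately have "(b + t) powr (P - 1) = (b + t) powr (P - 2) * (b + t)"
    by (simp only: powr_add powr_one)
  then show ?thesis using \<open>0 < b + t\<close> by (simp add: phi_density_def)
qed (simp add: phi_density_def)

lemma phi_density_nonneg: "0 \<le> t \<Longrightarrow> 0 \<le> phi_density b P t"
  by (simp add: phi_density_def)

lemma phi_density_mono:
  assumes "1 \<le> P" "0 \<le> b" "0 \<le> t" "t \<le> t'"
  shows "phi_density b P t \<le> phi_density b P t'"
proof -
  have "(b + t) powr (P - 1) * (t / (b + t)) \<le> (b + t') powr (P - 1) * (t' / (b + t'))"
    by (intro mult_mono powr_mono2 fraction_mono) (use assms in auto)
  then show ?thesis using assms by (simp add: phi_density_eq)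
qed

lemma continuous_on_phi_density:
  assumes "1 < P" "0 \<le> b"
  shows "continuous_on {0..t} (phi_density b P)"
proof (cases "b = 0")
  case True
  have "continuous_on {0..t} (\<lambda>\<tau>. \<tau> powr (P - 1))"
    using assms by (intro continuous_on_powr' continuous_intros) auto
  moreover have "phi_density b P \<tau> = \<tau> powr (P - 1)" if "\<tau> \<in> {0..t}" for \<tau>
    using that True by (simp add: phi_density_eq)
  ultimately show ?thesis
    using continuous_on_cong[OF refl, of "{0..t}" "phi_density b P" "\<lambda>\<tau>. \<tau> powr (P - 1)"] by auto
next
  case False
  then show ?thesis
    unfolding phi_density_def using assms
    by (intro continuous_on_powr' continuous_intros) auto
qed

lemma deriv_phi:
  assumes "0 \<le> \<delta>" "1 < p x" "0 < u"
  shows "deriv (phi \<delta> p x) u = phi_density \<delta> (p x) u"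
proof -
  have "((\<lambda>t. integral {0..t} (phi_density \<delta> (p x))) has_real_derivative phi_density \<delta> (p x) u)
          (at u within {0..u + 1})"
    by (rule integral_has_real_derivative[OF continuous_on_phi_density]) (use assms in auto)
  moreover have "at u within {0..u + 1} = at u"
    using assms by (intro at_within_interior) (auto simp: interior_atLeastAtMost_real)
  moreover have "phi \<delta> p x = (\<lambda>t. integral {0..t} (phi_density \<delta> (p x)))"
    by (simp add: phi_def phi_density_def[abs_def] fun_eq_iff)
  ultimately show ?thesis by (simp add: DERIV_imp_deriv)
qed

text \<open>
Since \<open>\<phi>'(a + \<tau>) \<tau> / (a + \<tau>) = (\<delta> + a + \<tau>)\<^sup>p\<^sup>-\<^sup>2 \<tau>\<close>, shifting by \<open>a\<close> amounts to replacing \<open>\<delta>\<close> by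
\<open>\<delta> + a\<close>. At \<open>a = \<tau> = 0\<close> both integrands vanish by the convention for division.
\<close>

lemma phi_shift_eq:
  assumes "0 \<le> \<delta>" "1 < p x" "0 \<le> a" "0 \<le> t"
  shows "phi_shift \<delta> p a x t = integral {0..t} (phi_density (\<delta> + a) (p x))"
  unfolding phi_shift_def
proof (rule Henstock_Kurzweil_Integration.integral_cong)
  fix \<tau> assume \<tau>: "\<tau> \<in> {0..t}"
  show "deriv (phi \<delta> p x) (a + \<tau>) * (\<tau> / (a + \<tau>)) = phi_density (\<delta> + a) (p x) \<tau>"
  proof (cases "a + \<tau> = 0")
    case True
    then have "\<tau> = 0" using \<tau> assms by auto
    then show ?thesis by (simp add: phi_density_def)
  next
    case False
    then have "0 < a + \<tau>" using \<tau> assms by auto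
    then show ?thesis
      using deriv_phi[where p = p and x = x and u = "a + \<tau>", OF assms(1,2)] by (simp add: phi_density_def add.assoc)
  qed
qed

lemma integral_phi_density_bounds:
  assumes P: "1 < P" and b: "0 \<le> b" and t: "0 \<le> t"
  shows "integral {0..t} (phi_density b P) \<le> t * phi_density b P t"
    and "t / 2 * phi_density b P (t / 2) \<le> integral {0..t} (phi_density b P)"
proof -
  have int: "phi_density b P integrable_on {0..t}"
    by (rule integrable_continuous_real[OF continuous_on_phi_density[OF P b]])
  have "integral {0..t} (phi_density b P) \<le> integral {0..t} (\<lambda>_. phi_density b P t)"
    using P b t by (intro integral_le int) (auto intro: phi_density_mono)
  then show "integral {0..t} (phi_density b P) \<le> t * phi_density b P t" using t by simp
  have int2: "phi_density b P integrable_on {t/2..t}"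
    using t by (intro integrable_on_subinterval[OF int]) auto
  have "integral {t/2..t} (\<lambda>_. phi_density b P (t / 2)) \<le> integral {t/2..t} (phi_density b P)"
    using P b t by (intro integral_le int2) (auto intro: phi_density_mono)
  also have "\<dots> \<le> integral {0..t} (phi_density b P)"
    using t by (intro integral_subset_le int int2) (auto intro: phi_density_nonneg)
  finally show "t / 2 * phi_density b P (t / 2) \<le> integral {0..t} (phi_density b P)" using t by simp
qed

text \<open>
A lower growth rate \<open>e\<close> that serves all exponents \<open>P \<ge> 1 + e\<close>; it makes the constants below uniform in \<open>P\<close>.
\<close>

lemma phi_density_scale:
  assumes P: "1 < P" and b: "0 \<le> b" and u: "0 \<le> u" and \<kappa>: "1 \<le> \<kappa>" and e: "e \<le> 1" "e \<le> P - 1"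
  shows "\<kappa> powr e * phi_density b P u \<le> phi_density b P (\<kappa> * u)"
proof (cases "u = 0")
  case False
  then have u0: "0 < u" using u by simp
  have u\<kappa>: "u \<le> \<kappa> * u" "b \<le> \<kappa> * b" "0 < \<kappa> * u" using u0 b \<kappa> by (auto simp: mult_le_cancel_right1)
  show ?thesis
  proof (cases "2 \<le> P")
    case True
    have "(b + u) powr (P - 2) \<le> (b + \<kappa> * u) powr (P - 2)"
      using True b u0 u\<kappa> by (intro powr_mono2) auto
    moreover have "\<kappa> powr e \<le> \<kappa>" using \<kappa> e powr_mono[of e 1 \<kappa>] by simp
    ultimately have "\<kappa> powr e * ((b + u) powr (P - 2) * u) \<le> \<kappa> * ((b + \<kappa> * u) powr (P - 2) * u)"
      using u0 \<kappa> by (intro mult_mono mult_right_mono) auto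
    then show ?thesis by (simp add: phi_density_def ac_simps)
  next
    case False
    have "(\<kappa> * (b + u)) powr (P - 2) \<le> (b + \<kappa> * u) powr (P - 2)"
      using False b u0 u\<kappa> \<kappa> by (intro powr_mono2') (auto simp: algebra_simps intro: add_nonneg_pos)
    then have 1: "\<kappa> powr (P - 2) * (b + u) powr (P - 2) \<le> (b + \<kappa> * u) powr (P - 2)"
      using \<kappa> b u0 by (simp add: powr_mult)
    have "\<kappa> powr e \<le> \<kappa> powr (P - 1)" using \<kappa> e by (intro powr_mono) auto
    also have "\<dots> = \<kappa> powr (P - 2) * \<kappa>"
      using \<kappa> powr_add[of \<kappa> "P - 2" 1] by simp
    finally have "\<kappa> powr e * ((b + u) powr (P - 2) * u) \<le> \<kappa> powr (P - 2) * \<kappa> * ((b + u) powr (P - 2) * u)"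
      using u0 by (intro mult_right_mono) auto
    also have "\<dots> = \<kappa> powr (P - 2) * (b + u) powr (P - 2) * (\<kappa> * u)" by simp
    also have "\<dots> \<le> (b + \<kappa> * u) powr (P - 2) * (\<kappa> * u)"
      using 1 u0 \<kappa> by (intro mult_right_mono) auto
    finally show ?thesis by (simp add: phi_density_def)
  qed
qed (simp add: phi_density_def)

text \<open>
The number \<open>v = (s + t)\<^sup>q\<^sup>-\<^sup>2 t\<close> solves \<open>phi_density b P v = t\<close> up to constants. The reason is that
\<open>b = s\<^sup>q\<^sup>-\<^sup>1\<close>, so \<open>b + v\<close> is comparable to \<open>(s + t)\<^sup>q\<^sup>-\<^sup>1\<close> and \<open>(b + v)\<^sup>P\<^sup>-\<^sup>1\<close> to \<open>s + t\<close>.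
\<close>

lemma phi_density_approx_inverse:
  assumes P: "1 < P" and b: "0 \<le> b" and t: "0 < t"
  defines "q \<equiv> P / (P - 1)" and "s \<equiv> b powr (P - 1)"
  defines "v \<equiv> shifted_power q s t / t"
  shows "0 < v" and "2 powr (- P - 1) * t \<le> phi_density b P v" and "phi_density b P v \<le> 2 powr (P + q) * t"
proof -
  have q: "1 < q" "(P - 1) * (q - 1) = 1" "q * (P - 1) = P" "(q - 1) * (P - 1) = 1"
    using P by (auto simp: q_def field_simps)
  have s: "0 \<le> s" by (simp add: s_def)
  let ?S = "s + t"
  have S: "0 < ?S" using s t by simp
  define Z where "Z = ?S powr (q - 1)"
  have Z: "0 < Z" using S by (simp add: Z_def)
  have vZ: "v = Z * (t / ?S)"
    using shifted_power_factor[OF s t, of q] t by (simp add: v_def Z_def)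
  show v0: "0 < v" using vZ Z S t by simp
  have bs: "b = s powr (q - 1)"
    using b q by (cases "b = 0") (simp_all add: s_def powr_powr)
  have bZ: "b \<le> Z" unfolding bs Z_def using s t q by (intro powr_mono2) auto
  have "v \<le> Z * 1" unfolding vZ using Z s t by (intro mult_left_mono) auto
  then have up: "b + v \<le> 2 * Z" using bZ by simp
  have lo: "2 powr (- q) * Z \<le> b + v"
  proof (cases "s \<le> t")
    case True
    then have "1 / 2 \<le> t / ?S" using S by (simp add: field_simps)
    then have "Z * (1 / 2) \<le> v" unfolding vZ using Z by (intro mult_left_mono) auto
    moreover have "2 powr (- q) \<le> 2 powr (- 1)" using q by (intro powr_mono) auto
    then have "2 powr (- q) * Z \<le> 2 powr (- 1) * Z" using Z by (intro mult_right_mono) auto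
    moreover have "2 powr (- 1 :: real) = 1 / 2" by (simp add: powr_minus)
    ultimately show ?thesis using b by simp
  next
    case False
    have "2 powr (- q) * Z \<le> 2 powr (- (q - 1)) * Z"
      using Z by (intro mult_right_mono powr_mono) auto
    also have "\<dots> = (?S / 2) powr (q - 1)"
      using S powr_divide[of ?S 2 "q - 1"] powr_minus_divide[of 2 "q - 1"] by (simp add: Z_def)
    also have "\<dots> \<le> s powr (q - 1)" using False q s t by (intro powr_mono2) auto
    finally show ?thesis using bs v0 by simp
  qed
  have ZP: "Z powr (P - 1) = ?S" using S q by (simp add: Z_def powr_powr)
  have bv: "0 < b + v" using b v0 by simp
  have dens: "phi_density b P v = (b + v) powr (P - 1) * (v / (b + v))"
    by (rule phi_density_eq) (use b v0 in auto)
  have "(2 powr (- q) * Z) powr (P - 1) \<le> (b + v) powr (P - 1)"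
    using lo P Z by (intro powr_mono2) auto
  then have 1: "2 powr (- P) * ?S \<le> (b + v) powr (P - 1)"
    using Z ZP q by (simp add: powr_mult powr_powr)
  have "(b + v) powr (P - 1) \<le> (2 * Z) powr (P - 1)"
    using up P bv by (intro powr_mono2) auto
  then have 2: "(b + v) powr (P - 1) \<le> 2 powr (P - 1) * ?S"
    using Z ZP by (simp add: powr_mult)
  have 3: "t / ?S / 2 \<le> v / (b + v)"
  proof -
    have "v / (2 * Z) \<le> v / (b + v)" using up bv v0 Z by (intro divide_left_mono) auto
    moreover have "v / (2 * Z) = t / ?S / 2" using Z by (simp add: vZ)
    ultimately show ?thesis by simp
  qed
  have 4: "v / (b + v) \<le> 2 powr q * (t / ?S)"
  proof -
    have "v / (b + v) \<le> v / (2 powr (- q) * Z)" using lo bv v0 Z by (intro divide_left_mono) auto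
    moreover have "Z * r / (2 powr (- q) * Z) = 2 powr q * r" for r
      using Z by (simp add: powr_minus field_simps)
    then have "v / (2 powr (- q) * Z) = 2 powr q * (t / ?S)" unfolding vZ .
    ultimately show ?thesis by simp
  qed
  have "2 powr (- P) * ?S * (t / ?S / 2) \<le> phi_density b P v"
    unfolding dens using 1 3 S t by (intro mult_mono) auto
  moreover have St: "?S * (t / ?S) = t" using S by simp
  have "2 powr (- P) * ?S * (t / ?S / 2) = 2 powr (- P) * (?S * (t / ?S)) / 2"
    by (simp only: mult.assoc times_divide_eq_right)
  then have "2 powr (- P) * ?S * (t / ?S / 2) = 2 powr (- P - 1) * t"
    unfolding St by (simp add: powr_diff)
  ultimately show "2 powr (- P - 1) * t \<le> phi_density b P v" by simp
  have "phi_density b P v \<le> 2 powr (P - 1) * ?S * (2 powr q * (t / ?S))"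
    unfolding dens using 2 4 S t v0 b by (intro mult_mono) auto
  also have "\<dots> = 2 powr (P - 1) * 2 powr q * (?S * (t / ?S))" by (simp only: ac_simps)
  also have "\<dots> = 2 powr (P - 1 + q) * t" unfolding St by (simp only: powr_add)
  also have "\<dots> \<le> 2 powr (P + q) * t" using t by (intro mult_right_mono powr_mono) auto
  finally show "phi_density b P v \<le> 2 powr (P + q) * t" .
qed

text \<open>
The supremum of \<open>\<tau> t - \<Phi>(\<tau>)\<close> is nearly attained where the density equals \<open>t\<close>, that is near the \<open>v\<close> of the
previous lemma, with value comparable to \<open>v t\<close>. For \<open>\<tau>\<close> far above \<open>v\<close> the density exceeds \<open>2t\<close> on the upper
half of the interval and the difference is not positive; a small multiple of \<open>v\<close> gives the lower bound.
\<close>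

lemma phi_shift_conj_equiv:
  assumes pm: "1 < pm"
  obtains C where "1 \<le> C"
    "\<And>\<delta> (p :: 'a \<Rightarrow> real) a x t. 0 \<le> \<delta> \<Longrightarrow> 0 \<le> a \<Longrightarrow> 0 \<le> t \<Longrightarrow> pm \<le> p x \<Longrightarrow> p x \<le> pp \<Longrightarrow>
       phi_shift_conj \<delta> p a x t \<le> C * shifted_power (dual_exponent p x) ((\<delta> + a) powr (p x - 1)) t \<and>
       shifted_power (dual_exponent p x) ((\<delta> + a) powr (p x - 1)) t \<le> C * phi_shift_conj \<delta> p a x t"
proof -
  define e where "e = min 1 (pm - 1)"
  define qp where "qp = pm / (pm - 1)"
  have e: "0 < e" "e \<le> 1" "e \<le> pm - 1" using pm by (auto simp: e_def)
  \<comment> \<open>Chosen so that scaling by \<open>\<kappa>\<close> changes the density by a factor that beats the constants of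
      \<open>phi_density_approx_inverse\<close> in both directions.\<close>
  define \<kappa> where "\<kappa> = 2 powr ((\<bar>pp\<bar> + qp + 2) / e)"
  have qp: "0 < qp" using pm by (simp add: qp_def)
  have \<kappa>: "1 \<le> \<kappa>" "\<kappa> powr e = 2 powr (\<bar>pp\<bar> + qp + 2)"
    using e qp by (auto simp: \<kappa>_def powr_powr intro!: ge_one_powr_ge_zero)
  have main: "phi_shift_conj \<delta> p a x t \<le> 2 * \<kappa> * shifted_power (dual_exponent p x) ((\<delta> + a) powr (p x - 1)) t \<and>
       shifted_power (dual_exponent p x) ((\<delta> + a) powr (p x - 1)) t \<le> 2 * \<kappa> * phi_shift_conj \<delta> p a x t"
    if asm: "0 \<le> \<delta>" "0 \<le> a" "0 \<le> t" "pm \<le> p x" "p x \<le> pp"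
    for \<delta> and p :: "'a \<Rightarrow> real" and a x t
  proof -
    define P b q s where "P = p x" and "b = \<delta> + a" and "q = P / (P - 1)" and "s = b powr (P - 1)"
    have P: "1 < P" using asm pm by (simp add: P_def)
    have b: "0 \<le> b" using asm by (simp add: b_def)
    have q: "q \<le> qp" "1 < q"
    proof -
      show "1 < q" using P by (simp add: q_def)
      show "q \<le> qp" using P pm asm by (simp add: q_def qp_def P_def field_simps)
    qed
    let ?\<Phi> = "\<lambda>\<tau>. integral {0..\<tau>} (phi_density b P)"
    let ?M = "shifted_power q s t"
    have shift: "phi_shift \<delta> p a x \<tau> = ?\<Phi> \<tau>" if "0 \<le> \<tau>" for \<tau>
      unfolding b_def P_def by (rule phi_shift_eq) (use asm that P in \<open>auto simp: P_def\<close>)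
    have conj_eq: "phi_shift_conj \<delta> p a x t = (SUP \<tau>\<in>{0..}. \<tau> * t - ?\<Phi> \<tau>)"
      unfolding phi_shift_conj_def by (rule SUP_cong) (use shift in auto)
    have \<Phi>0: "0 \<le> ?\<Phi> \<tau>" if "0 \<le> \<tau>" for \<tau>
    proof -
      have "0 \<le> \<tau> / 2 * phi_density b P (\<tau> / 2)" using that phi_density_nonneg by simp
      then show ?thesis using integral_phi_density_bounds(2)[OF P b that] by linarith
    qed
    have upper: "\<tau> * t - ?\<Phi> \<tau> \<le> 2 * \<kappa> * ?M" if \<tau>: "0 \<le> \<tau>" for \<tau>
    proof (cases "t = 0")
      case True
      then show ?thesis using \<Phi>0[OF \<tau>] \<kappa> by simp
    next
      case False
      then have t: "0 < t" using asm by simp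
      define v where "v = ?M / t"
      note inv = phi_density_approx_inverse[OF P b t, folded q_def, folded s_def, folded v_def]
      have M: "?M = v * t" using t by (simp add: v_def)
      show ?thesis
      proof (cases "\<tau> \<le> 2 * \<kappa> * v")
        case True
        then have "\<tau> * t \<le> 2 * \<kappa> * v * t" using t by (intro mult_right_mono) auto
        then show ?thesis using \<Phi>0[OF \<tau>] M by simp
      next
        case False
        have "2 powr (P + 2) * 2 powr (- P - 1) = (2::real)"
          by (simp add: powr_add[symmetric])
        then have "2 * t = 2 powr (P + 2) * (2 powr (- P - 1) * t)"
          by (metis mult.assoc)
        also have "\<dots> \<le> \<kappa> powr e * (2 powr (- P - 1) * t)"
          unfolding \<kappa>(2) using asm qp t by (intro mult_right_mono powr_mono) (auto simp: P_def)
        also have "\<dots> \<le> \<kappa> powr e * phi_density b P v"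
          using inv(2) by (intro mult_left_mono) auto
        also have "\<dots> \<le> phi_density b P (\<kappa> * v)"
          using e asm inv(1) \<kappa>(1) P b by (intro phi_density_scale) (auto simp: P_def)
        also have "\<dots> \<le> phi_density b P (\<tau> / 2)"
          using False P b \<kappa>(1) inv(1) by (intro phi_density_mono) auto
        finally have "\<tau> / 2 * (2 * t) \<le> \<tau> / 2 * phi_density b P (\<tau> / 2)"
          using \<tau> by (intro mult_left_mono) auto
        then have "\<tau> * t \<le> ?\<Phi> \<tau>" using integral_phi_density_bounds(2)[OF P b \<tau>] by simp
        moreover have "0 \<le> 2 * \<kappa> * ?M" using \<kappa>(1) by simp
        ultimately show ?thesis by linarith
      qed
    qed
    have bdd: "bdd_above ((\<lambda>\<tau>. \<tau> * t - ?\<Phi> \<tau>) ` {0..})"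
      using upper by (intro bdd_aboveI2[where M = "2 * \<kappa> * ?M"]) auto
    have 1: "phi_shift_conj \<delta> p a x t \<le> 2 * \<kappa> * ?M"
      unfolding conj_eq by (rule cSUP_least) (use upper in auto)
    have 2: "?M \<le> 2 * \<kappa> * phi_shift_conj \<delta> p a x t"
    proof (cases "t = 0")
      case True
      have "0 * t - ?\<Phi> 0 \<le> phi_shift_conj \<delta> p a x t"
        unfolding conj_eq by (rule cSUP_upper[OF _ bdd]) simp
      then show ?thesis using True \<kappa>(1) by simp
    next
      case False
      then have t: "0 < t" using asm by simp
      define v where "v = ?M / t"
      note inv = phi_density_approx_inverse[OF P b t, folded q_def, folded s_def, folded v_def]
      have M: "?M = v * t" using t by (simp add: v_def)
      define \<tau> where "\<tau> = v / \<kappa>"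
      have \<tau>: "0 \<le> \<tau>" "\<kappa> * \<tau> = v" using inv(1) \<kappa>(1) by (auto simp: \<tau>_def)
      have "\<kappa> powr e * phi_density b P \<tau> \<le> phi_density b P (\<kappa> * \<tau>)"
        using e asm \<tau> \<kappa>(1) P b by (intro phi_density_scale) (auto simp: P_def)
      also have "\<dots> = phi_density b P v" by (simp only: \<tau>(2))
      also have "\<dots> \<le> 2 powr (P + q) * t" by (rule inv(3))
      also have "\<dots> \<le> 2 powr (\<bar>pp\<bar> + qp + 1) * t"
        using asm q t by (intro mult_right_mono powr_mono) (auto simp: P_def)
      also have "\<dots> = \<kappa> powr e * (t / 2)"
        unfolding \<kappa>(2) by (simp add: powr_add)
      finally have "phi_density b P \<tau> \<le> t / 2"
        using \<kappa> by simp
      then have "\<tau> * phi_density b P \<tau> \<le> \<tau> * (t / 2)" using \<tau> by (intro mult_left_mono)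
      then have "?\<Phi> \<tau> \<le> \<tau> * (t / 2)"
        using integral_phi_density_bounds(1)[OF P b \<tau>(1)] by linarith
      then have "\<tau> * t / 2 \<le> \<tau> * t - ?\<Phi> \<tau>" by simp
      also have "\<dots> \<le> phi_shift_conj \<delta> p a x t"
        unfolding conj_eq by (rule cSUP_upper[OF _ bdd]) (use \<tau> in auto)
      finally have "\<kappa> * (\<tau> * t) \<le> \<kappa> * (2 * phi_shift_conj \<delta> p a x t)"
        using \<kappa>(1) by (intro mult_left_mono) auto
      then show ?thesis using M \<tau>(2) by (simp add: mult.assoc[symmetric])
    qed
    show ?thesis
      using 1 2 by (simp add: dual_exponent_def P_def b_def q_def s_def)
  qed
  show ?thesis by (rule that[of "2 * \<kappa>"]) (use \<kappa>(1) main in auto)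
qed

section \<open>Change of shift\<close>

text \<open>
The nonlinear map \<open>F\<close> on symmetric matrices. Only the norm enters, so it is studied in any normed space.
\<close>

abbreviation weighted :: "real \<Rightarrow> real \<Rightarrow> 'v::real_normed_vector \<Rightarrow> 'v" where
  "weighted \<delta> P X \<equiv> (\<delta> + norm X) powr ((P - 2) / 2) *\<^sub>R X"

text \<open>
The equivalent of the conjugate of the N-function with exponent \<open>P\<close> and total shift \<open>b = \<delta> + a\<close>.
\<close>

abbreviation conj_power :: "real \<Rightarrow> real \<Rightarrow> real \<Rightarrow> real" where
  "conj_power P b \<equiv> shifted_power (P / (P - 1)) (b powr (P - 1))"

text \<open>
Vectors whose distance is comparable to the larger of them have images whose distance is comparable to the larger
image. After division by the weight of \<open>X\<close>, the image of \<open>Y\<close> becomes a multiple \<open>c Y\<close> not longer than \<open>X\<close>.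
If \<open>P \<ge> 2\<close>, then \<open>c \<le> 1\<close> and shrinking the shorter vector costs at most a factor \<open>2\<close>. If \<open>P < 2\<close>, then
\<open>c \<ge> 1\<close>, but with \<open>k = |Y| / |X|\<close> one has \<open>c k \<le> \<surd>k\<close> because the exponent of the weight is at least \<open>-1/2\<close>; as
\<open>\<surd>k - k \<le> 1/4\<close>, stretching moves \<open>Y\<close> by at most \<open>|X|/4\<close>.
\<close>

lemma powr_weighted_difference_wlog:
  fixes X Y :: "'v::real_normed_vector"
  assumes \<delta>: "0 \<le> \<delta>" and P: "1 < P" and XY: "norm Y \<le> norm X"
    and D: "(\<delta> + norm X) / 2 < norm (X - Y)"
  shows "(\<delta> + norm X) powr (P / 2) / 4
    \<le> norm (weighted \<delta> P X - weighted \<delta> P Y)"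
proof -
  define b b' r where "b = \<delta> + norm X" and "b' = \<delta> + norm Y" and "r = (P - 2) / 2"
  have bb: "b' \<le> b" "0 \<le> b'" "norm X \<le> b" using XY \<delta> by (auto simp: b_def b'_def)
  have "norm (X - Y) \<le> norm X + norm Y" by (rule norm_triangle_ineq4)
  then have "(\<delta> + norm X) / 2 < 2 * norm X" using D XY by linarith
  have X: "0 < norm X"
  proof (rule ccontr)
    assume "\<not> 0 < norm X"
    then have "X = 0" by simp
    with \<open>(\<delta> + norm X) / 2 < 2 * norm X\<close> \<delta> show False by simp
  qed
  have b: "0 < b" using X bb by linarith
  have \<alpha>: "0 < b powr r" using b by simp
  have halved: "b / 4 \<le> norm (X - c *\<^sub>R Y)" if c: "c * b powr r = b' powr r" "norm Y > 0" for c
  proof (cases "2 \<le> P")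
    case True
    have "b' powr r \<le> b powr r" using True bb by (intro powr_mono2) (auto simp: r_def)
    then have "c * b powr r \<le> 1 * b powr r" using c by simp
    then have c1: "c \<le> 1" using \<alpha> by (simp only: mult_le_cancel_right_pos)
    have "0 \<le> c" using c \<alpha> by (metis powr_ge_zero zero_le_mult_iff not_less)
    have "norm X - norm (c *\<^sub>R Y) \<le> norm (X - c *\<^sub>R Y)" by (rule norm_triangle_ineq2)
    moreover have "norm (c *\<^sub>R Y) = c * norm Y" using \<open>0 \<le> c\<close> by simp
    moreover have eq: "X - Y = (X - c *\<^sub>R Y) + (- (1 - c)) *\<^sub>R Y" by (simp add: algebra_simps)
    have "norm (X - Y) \<le> norm (X - c *\<^sub>R Y) + norm ((- (1 - c)) *\<^sub>R Y)"
      by (subst eq) (rule norm_triangle_ineq)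
    moreover have "norm ((- (1 - c)) *\<^sub>R Y) = norm Y - c * norm Y"
      using c1 by (simp only: norm_scaleR abs_minus_cancel) (simp add: left_diff_distrib)
    ultimately have "norm (X - Y) \<le> 2 * norm (X - c *\<^sub>R Y)"
      using XY by linarith
    then show ?thesis using D by (simp add: b_def)
  next
    case False
    define k where "k = norm Y / norm X"
    have k: "0 < k" "k \<le> 1" using c X XY by (auto simp: k_def)
    have r: "-1/2 \<le> r" "r \<le> 0" using P False by (auto simp: r_def)
    have b': "0 < b'" unfolding b'_def by (rule add_nonneg_pos[OF \<delta> c(2)])
    have kb: "k \<le> b' / b"
    proof -
      have "norm Y * b \<le> norm X * b'"
        using mult_right_mono[OF XY \<delta>] by (simp add: b_def b'_def algebra_simps)
      then show ?thesis using X b by (simp add: k_def field_simps)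
    qed
    have "c = b' powr r / b powr r" using c(1) \<alpha> by (simp add: field_simps)
    also have "\<dots> = (b' / b) powr r" using b b' by (simp add: powr_divide)
    also have "\<dots> \<le> k powr r" using k kb r by (intro powr_mono2') auto
    also have "\<dots> \<le> k powr (- 1 / 2)" using k r by (intro powr_mono') auto
    finally have "c * k \<le> k powr (- 1 / 2) * k" using k by (intro mult_right_mono) auto
    also have "\<dots> = sqrt k"
      using k powr_add[of k "- 1 / 2" 1] by (simp add: powr_half_sqrt)
    finally have ck: "c * k \<le> sqrt k" .
    have "(sqrt k - 1 / 2)\<^sup>2 = k - sqrt k + 1 / 4"
      using k by (simp add: power2_diff power_one_over)
    then have "sqrt k - k \<le> 1 / 4" using zero_le_power2[of "sqrt k - 1 / 2"] by linarith
    with ck have "(c - 1) * k \<le> 1 / 4" by (simp add: algebra_simps)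
    then have "(c - 1) * k * norm X \<le> 1 / 4 * norm X" by (rule mult_right_mono) simp
    then have cY: "(c - 1) * norm Y \<le> norm X / 4" using X by (simp add: k_def)
    have "1 \<le> c"
    proof -
      have "b powr r \<le> b' powr r" using r b' bb by (intro powr_mono2') auto
      then show ?thesis using c \<alpha> by (metis mult_le_cancel_right1 not_less)
    qed
    then have "norm ((c - 1) *\<^sub>R Y) = (c - 1) * norm Y" by simp
    moreover have eq: "X - Y = (X - c *\<^sub>R Y) + (c - 1) *\<^sub>R Y" by (simp add: algebra_simps)
    have "norm (X - Y) \<le> norm (X - c *\<^sub>R Y) + norm ((c - 1) *\<^sub>R Y)"
      by (subst eq) (rule norm_triangle_ineq)
    ultimately have "norm (X - Y) \<le> norm (X - c *\<^sub>R Y) + norm X / 4" using cY by linarith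
    then show ?thesis using D \<delta> unfolding b_def by (simp add: field_simps)
  qed
  have "b powr (P / 2) = b powr r * b"
    using b powr_add[of b r 1] by (simp add: r_def diff_divide_distrib)
  moreover have "b powr r * (b / 4) \<le> norm (b powr r *\<^sub>R X - b' powr r *\<^sub>R Y)"
  proof (cases "norm Y > 0")
    case True
    define c where "c = b' powr r / b powr r"
    have c: "c * b powr r = b' powr r" using \<alpha> by (simp add: c_def)
    have "b powr r *\<^sub>R X - b' powr r *\<^sub>R Y = b powr r *\<^sub>R (X - c *\<^sub>R Y)"
      by (simp add: c[symmetric] scaleR_diff_right mult.commute)
    then show ?thesis using halved[OF c True] \<alpha> by simp
  next
    case False
    then have "b / 2 < norm X" using D by (simp add: b_def)
    then have "b / 4 \<le> norm X" using b by linarith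
    then have "b powr r * (b / 4) \<le> b powr r * norm X" using \<alpha> by (intro mult_left_mono) auto
    then show ?thesis using False by simp
  qed
  ultimately show ?thesis by (simp add: b_def b'_def r_def)
qed

lemma powr_weighted_difference:
  fixes X Y :: "'v::real_normed_vector"
  assumes \<delta>: "0 \<le> \<delta>" and P: "1 < P" 
    and D: "max (\<delta> + norm X) (\<delta> + norm Y) / 2 < norm (X - Y)"
  shows "max (\<delta> + norm X) (\<delta> + norm Y) powr P / 16
    \<le> (norm (weighted \<delta> P X - weighted \<delta> P Y))\<^sup>2"
proof -
  let ?b = "max (\<delta> + norm X) (\<delta> + norm Y)"
  have "?b powr (P / 2) / 4
    \<le> norm (weighted \<delta> P X - weighted \<delta> P Y)"
  proof (cases "norm Y \<le> norm X")
    case True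
    then show ?thesis using powr_weighted_difference_wlog[OF \<delta> P True] D by (simp add: max_absorb1)
  next
    case False
    then have "norm X \<le> norm Y" by simp
    then show ?thesis
      using powr_weighted_difference_wlog[OF \<delta> P \<open>norm X \<le> norm Y\<close>] D
      by (simp add: max_absorb2 norm_minus_commute)
  qed
  then have "(?b powr (P / 2) / 4)\<^sup>2
    \<le> (norm (weighted \<delta> P X - weighted \<delta> P Y))\<^sup>2"
    by (rule power_mono) simp
  moreover have "(?b powr (P / 2))\<^sup>2 = ?b powr P"
    by (simp add: power2_eq_square powr_add[symmetric])
  ultimately show ?thesis by (simp add: power_divide)
qed

text \<open>
If \<open>X\<close> and \<open>Y\<close> are close relative to the shifts, the shifts are comparable. Otherwise the difference of the
images is of the order of the larger shift, which dominates the left-hand side as long as \<open>t\<close> is below the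
shifts; above them the shift does not matter.
\<close>

lemma shift_change:
  assumes pm: "1 < pm"
  obtains C where "1 \<le> C"
    "\<And>\<delta> P X Y t. 0 \<le> \<delta> \<Longrightarrow> pm \<le> P \<Longrightarrow> P \<le> pp \<Longrightarrow> 0 \<le> t \<Longrightarrow>
      conj_power P (\<delta> + norm (X::'v::real_normed_vector)) t
      \<le> C * (conj_power P (\<delta> + norm Y) t +
         (norm (weighted \<delta> P X - weighted \<delta> P Y))\<^sup>2)"
proof -
  define qp where "qp = pm / (pm - 1)"
  define C where "C = 2 powr (\<bar>pp\<bar> * (qp + 2) + qp + 4)"
  have qp: "0 < qp" using pm by (simp add: qp_def)
  have C1: "1 \<le> C" using qp by (auto simp: C_def intro!: ge_one_powr_ge_zero)
  have main: "conj_power P (\<delta> + norm X) t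
      \<le> C * (conj_power P (\<delta> + norm Y) t +
         (norm (weighted \<delta> P X - weighted \<delta> P Y))\<^sup>2)"
    if asm: "0 \<le> \<delta>" "pm \<le> P" "P \<le> pp" "0 \<le> t" for \<delta> P t and X Y :: 'v
  proof -
    define b b' q s s' F where "b = \<delta> + norm X" and "b' = \<delta> + norm Y" and "q = P / (P - 1)"
      and "s = b powr (P - 1)" and "s' = b' powr (P - 1)"
      and "F = (norm (weighted \<delta> P X - weighted \<delta> P Y))\<^sup>2"
    have P: "1 < P" using asm pm by simp
    have q: "1 < q" "q \<le> qp" "(P - 1) * q = P"
      using P pm asm by (auto simp: q_def qp_def field_simps)
    have b: "0 \<le> b" "0 \<le> b'" using asm by (auto simp: b_def b'_def)
    have s: "0 \<le> s" "0 \<le> s'" by (auto simp: s_def s'_def)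
    have F: "0 \<le> F" by (simp add: F_def)
    let ?D = "norm (X - Y)"
    have "shifted_power q s t \<le> C * (shifted_power q s' t + F)"
    proof (cases "?D \<le> max b b' / 2")
      case True
      have "\<bar>b - b'\<bar> \<le> ?D" using norm_triangle_ineq3[of X Y] by (simp add: b_def b'_def)
      then have bb: "b \<le> 2 * b'" "b' \<le> 2 * b" using True by (auto simp: max_def split: if_splits)
      let ?k = "2 powr (P - 1)"
      have k: "1 \<le> ?k" using P by (auto intro!: ge_one_powr_ge_zero)
      have "s \<le> (2 * b') powr (P - 1)" "s' \<le> (2 * b) powr (P - 1)"
        unfolding s_def s'_def using bb b P by (intro powr_mono2; simp)+
      then have "s \<le> ?k * s'" "s' \<le> ?k * s"
        by (auto simp: s_def s'_def powr_mult)
      moreover have "t \<le> ?k * t" using k asm by (simp add: mult_le_cancel_right1)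
      ultimately have "s + t \<le> ?k * (s' + t)" "s' + t \<le> ?k * (s + t)"
        by (simp_all add: algebra_simps)
      then have "shifted_power q s t \<le> ?k powr (q + 2) * shifted_power q s' t"
        using q s asm k by (intro shifted_power_comparable) auto
      also have "?k powr (q + 2) \<le> C"
      proof -
        have "(P - 1) * (q + 2) \<le> \<bar>pp\<bar> * (qp + 2)"
          using P q qp asm by (intro mult_mono) auto
        then show ?thesis unfolding C_def powr_powr using qp by (intro powr_mono) auto
      qed
      then have "?k powr (q + 2) * shifted_power q s' t \<le> C * shifted_power q s' t"
        by (rule mult_right_mono) simp
      also have "\<dots> \<le> C * (shifted_power q s' t + F)" using C1 F by (intro mult_left_mono) auto
      finally show ?thesis .
    next
      case False
      define \<beta> where "\<beta> = max b b'"
      have \<beta>: "0 \<le> \<beta>" "b \<le> \<beta>" "b' \<le> \<beta>" using b by (auto simp: \<beta>_def)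
      have s\<beta>: "s \<le> \<beta> powr (P - 1)" "s' \<le> \<beta> powr (P - 1)"
        unfolding s_def s'_def using \<beta> b P by (intro powr_mono2; simp)+
      have gap: "\<beta> powr P / 16 \<le> F"
        unfolding F_def \<beta>_def b_def b'_def
        by (rule powr_weighted_difference[OF asm(1) P]) (use False[unfolded b_def b'_def not_le] in assumption)
      have 2: "2 powr q * 16 \<le> C"
      proof -
        have "2 powr q * 16 = 2 powr (q + 4)" by (simp add: powr_add powr_numeral)
        also have "\<dots> \<le> C" unfolding C_def
        proof (rule powr_mono)
          have "0 \<le> \<bar>pp\<bar> * (qp + 2)" using qp by (intro mult_nonneg_nonneg) auto
          then show "q + 4 \<le> \<bar>pp\<bar> * (qp + 2) + qp + 4" using q(2) by linarith
        qed simp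
        finally show ?thesis .
      qed
      have 4: "2 powr q * 4 \<le> C" using 2 powr_ge_zero[of 2 q] by linarith
      have *: "shifted_power q s t \<le> (s + t) powr q" using shifted_power_le s asm by auto
      show ?thesis
      proof (cases "t \<le> \<beta> powr (P - 1)")
        case True
        have "(s + t) powr q \<le> (2 * \<beta> powr (P - 1)) powr q"
          using True s\<beta> s asm q by (intro powr_mono2) auto
        also have "\<dots> = 2 powr q * \<beta> powr P"
          by (simp add: powr_mult powr_powr q)
        also have "\<dots> \<le> 2 powr q * 16 * F" using gap by simp
        also have "\<dots> \<le> C * (shifted_power q s' t + F)"
          using 2 4 C1 F by (intro mult_mono) auto
        finally show ?thesis using * by linarith
      next
        case False
        have "(s + t) powr q \<le> (2 * t) powr q"
          using False s\<beta> s asm q by (intro powr_mono2) auto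
        also have "\<dots> = 2 powr q * t powr q"
          using asm by (simp add: powr_mult)
        also have "\<dots> \<le> 2 powr q * (4 * shifted_power q s' t)"
          using shifted_power_ge[of s' t q] s s\<beta> q False by (intro mult_left_mono) auto
        also have "\<dots> = 2 powr q * 4 * shifted_power q s' t" by simp
        also have "\<dots> \<le> C * (shifted_power q s' t + F)"
          using 2 4 C1 F by (intro mult_mono) auto
        finally show ?thesis using * by linarith
      qed
    qed
    then show ?thesis by (simp add: b_def b'_def q_def s_def s'_def F_def)
  qed
  show ?thesis by (rule that[OF C1 main])
qed

section \<open>Change of exponent\<close>

text \<open>
The elementary fact behind log-Hoelder continuity: a power of \<open>h\<close> beats the logarithm.
\<close>

lemma powr_ln_le:
  fixes \<alpha> h :: real
  assumes "0 < \<alpha>" "0 < h"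
  shows "h powr \<alpha> * ln (1 / h) \<le> 1 / \<alpha>"
proof -
  have "ln (1 / h) = ln ((1 / h) powr \<alpha>) / \<alpha>" using assms by (simp add: ln_powr)
  also have "\<dots> \<le> (1 / h) powr \<alpha> / \<alpha>"
    using assms ln_le_minus_one[of "(1 / h) powr \<alpha>"] by (intro divide_right_mono) auto
  finally have "h powr \<alpha> * ln (1 / h) \<le> h powr \<alpha> * ((1 / h) powr \<alpha> / \<alpha>)"
    by (intro mult_left_mono) auto
  also have "\<dots> = 1 / \<alpha>"
    using assms powr_mult[of h "1 / h" \<alpha>] by simp
  finally show ?thesis .
qed

text \<open>
Exponents of order \<open>h\<^sup>\<alpha>\<close> are harmless for numbers between powers of \<open>h\<close>.
\<close>

lemma powr_log_holder_bounded:
  fixes \<alpha> C N K :: real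
  assumes \<alpha>: "0 < \<alpha>" and C: "1 \<le> C" and N: "0 \<le> N" and K: "0 \<le> K"
  obtains C' where "1 \<le> C'"
    "\<And>h r e :: real. 0 < h \<Longrightarrow> h \<le> 1 \<Longrightarrow> h powr N \<le> C * r \<Longrightarrow> r \<le> C * h powr (- N) \<Longrightarrow> \<bar>e\<bar> \<le> K * h powr \<alpha> \<Longrightarrow>
       r powr e \<le> C'"
proof -
  define C' where "C' = exp (K * (ln C + N / \<alpha>))"
  have lnC: "0 \<le> ln C" using C by simp
  have "1 \<le> C'" using K lnC N \<alpha> by (simp add: C'_def)
  moreover have "r powr e \<le> C'"
    if asm: "0 < h" "h \<le> 1" "h powr N \<le> C * r" "r \<le> C * h powr (- N)" "\<bar>e\<bar> \<le> K * h powr \<alpha>" for h r e :: real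
  proof -
    have "0 < h powr N" using asm by simp
    then have r: "0 < r" using asm C by (smt (verit) zero_less_mult_pos)
    define H where "H = ln (1 / h)"
    have H: "0 \<le> H" using asm by (simp add: H_def)
    have "ln r \<le> ln (C * h powr (- N))" using r asm by simp
    also have "\<dots> = ln C + N * H" using C asm by (simp add: ln_mult ln_powr H_def ln_div)
    finally have 1: "ln r \<le> ln C + N * H" .
    have "ln (h powr N) \<le> ln (C * r)" using asm by (subst ln_le_cancel_iff) (use r C in auto)
    then have 2: "- (ln C + N * H) \<le> ln r" using C r asm by (simp add: ln_mult ln_powr H_def ln_div)
    have "e * ln r \<le> \<bar>e\<bar> * \<bar>ln r\<bar>" by (metis abs_ge_self abs_mult)
    also have "\<dots> \<le> (K * h powr \<alpha>) * (ln C + N * H)"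
      using 1 2 asm lnC N H by (intro mult_mono) auto
    also have "\<dots> = K * (h powr \<alpha> * ln C + N * (h powr \<alpha> * H))" by (simp add: algebra_simps)
    also have "\<dots> \<le> K * (1 * ln C + N * (1 / \<alpha>))"
      using K N lnC asm \<alpha> powr_ln_le[OF \<alpha>, of h]
      by (intro mult_left_mono add_mono mult_right_mono) (auto simp: H_def powr_le1)
    finally show ?thesis using r by (simp add: powr_def C'_def)
  qed
  ultimately show ?thesis by (rule that)
qed

lemma powr_le_bound:
  fixes h b B d P pp :: real
  assumes "0 < h" "h \<le> 1" "1 \<le> B" "0 \<le> d" "0 \<le> b" "b \<le> B * h powr (- d)" "0 \<le> P" "P \<le> pp"
  shows "b powr P \<le> B powr pp * h powr (- (d * pp))"
proof -
  have "b powr P \<le> (B * h powr (- d)) powr P" using assms by (intro powr_mono2) auto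
  also have "\<dots> = B powr P * h powr (- (d * P))" using assms by (simp add: powr_mult powr_powr)
  also have "\<dots> \<le> B powr pp * h powr (- (d * pp))"
    using assms by (intro mult_mono powr_mono powr_mono') (auto intro: mult_left_mono)
  finally show ?thesis .
qed

lemma conj_exponent_bounds:
  fixes pm pp P :: real
  assumes "1 < pm" "pm \<le> P"
  shows "1 < P / (P - 1)" "P / (P - 1) \<le> pm / (pm - 1)"
  using assms by (auto simp: field_simps)

lemma conj_exponent_diff:
  fixes pm P1 P2 :: real
  assumes "1 < pm" "pm \<le> P1" "pm \<le> P2"
  shows "\<bar>P1 / (P1 - 1) - P2 / (P2 - 1)\<bar> \<le> \<bar>P1 - P2\<bar> / (pm - 1)\<^sup>2"
proof -
  have "P1 / (P1 - 1) - P2 / (P2 - 1) = (P2 - P1) / ((P1 - 1) * (P2 - 1))"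
    using assms by (simp add: field_simps)
  then have "\<bar>P1 / (P1 - 1) - P2 / (P2 - 1)\<bar> = \<bar>P1 - P2\<bar> / ((P1 - 1) * (P2 - 1))"
    using assms by (simp add: abs_mult abs_minus_commute)
  also have "\<dots> \<le> \<bar>P1 - P2\<bar> / (pm - 1)\<^sup>2"
    using assms unfolding power2_eq_square by (intro divide_left_mono mult_mono mult_pos_pos) auto
  finally show ?thesis .
qed

text \<open>
The exponents are exchanged first in the shift \<open>b\<^sup>P\<^sup>-\<^sup>1\<close>, then in the power \<open>q\<close> of the sum of shift and
argument. All bases lie between powers of \<open>h\<close>, except that \<open>b\<close> may be small; a tiny \<open>b\<close>, however,
produces shifts below \<open>t\<close>, which may be ignored.
\<close>

lemma shifted_power_exponent_change:
  fixes pm pp \<alpha> K N B :: real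
  assumes pm: "1 < pm" and \<alpha>: "0 < \<alpha>" and K: "0 \<le> K" and N: "0 \<le> N" and B: "1 \<le> B"
  obtains C where "1 \<le> C"
    "\<And>h P1 P2 b t. 0 < h \<Longrightarrow> h \<le> 1 \<Longrightarrow> pm \<le> P1 \<Longrightarrow> P1 \<le> pp \<Longrightarrow> pm \<le> P2 \<Longrightarrow> P2 \<le> pp \<Longrightarrow>
       \<bar>P1 - P2\<bar> \<le> K * h powr \<alpha> \<Longrightarrow> h powr N \<le> t \<Longrightarrow> t \<le> B * h powr (- N) \<Longrightarrow>
       0 \<le> b \<Longrightarrow> b \<le> B * h powr (- N) \<Longrightarrow>
       conj_power P1 b t \<le> C * conj_power P2 b t"
proof -
  \<comment> \<open>A base \<open>b\<close> below \<open>h powr N'\<close> has \<open>b powr (P - 1) \<le> h powr N\<close> for every \<open>P \<ge> pm\<close>.\<close>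
  define N' where "N' = N + N / (pm - 1)"
  define pp' where "pp' = \<bar>pp\<bar> + 1"
  define qp where "qp = pm / (pm - 1)"
  have N': "0 \<le> N'" "N \<le> N'"
    using pm N by (auto simp: N'_def)
  have "N' * (pm - 1) = N * (pm - 1) + N" using pm by (simp add: N'_def distrib_right)
  then have N'pm: "N \<le> N' * (pm - 1)" using N pm by simp
  obtain C1 where C1: "1 \<le> C1"
    "\<And>h r e. 0 < h \<Longrightarrow> h \<le> 1 \<Longrightarrow> h powr N' \<le> B * r \<Longrightarrow> r \<le> B * h powr (- N') \<Longrightarrow> \<bar>e\<bar> \<le> K * h powr \<alpha> \<Longrightarrow>
       r powr e \<le> C1"
    using powr_log_holder_bounded[OF \<alpha> B N'(1) K] by metis
  define B2 where "B2 = 2 * B powr pp'"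
  have "1 \<le> B powr pp'" using B by (intro ge_one_powr_ge_zero) (auto simp: pp'_def)
  then have B2: "1 \<le> B2" by (simp add: B2_def)
  have "0 \<le> N * pp'" "0 \<le> K / (pm - 1)\<^sup>2" using N K by (auto simp: pp'_def)
  then obtain C2 where C2: "1 \<le> C2"
    "\<And>h r e. 0 < h \<Longrightarrow> h \<le> 1 \<Longrightarrow> h powr (N * pp') \<le> B2 * r \<Longrightarrow> r \<le> B2 * h powr (- (N * pp')) \<Longrightarrow>
       \<bar>e\<bar> \<le> K / (pm - 1)\<^sup>2 * h powr \<alpha> \<Longrightarrow> r powr e \<le> C2"
    using powr_log_holder_bounded[OF \<alpha> B2] by metis
  define C where "C = (C1 + 1) powr (qp + 2) * C2"
  have qp: "0 < qp" using pm by (simp add: qp_def)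
  have C1': "1 \<le> (C1 + 1) powr (qp + 2)" using C1(1) qp by (intro ge_one_powr_ge_zero) auto
  have "1 \<le> C" using mult_mono[OF C1' C2(1)] C1' by (simp add: C_def)
  moreover have "conj_power P1 b t \<le> C * conj_power P2 b t"
    if h: "0 < h" "h \<le> 1" and P: "pm \<le> P1" "P1 \<le> pp" "pm \<le> P2" "P2 \<le> pp" "\<bar>P1 - P2\<bar> \<le> K * h powr \<alpha>"
      and t: "h powr N \<le> t" "t \<le> B * h powr (- N)" and b: "0 \<le> b" "b \<le> B * h powr (- N)" for h P1 P2 b t
  proof -
    define q1 q2 where "q1 = P1 / (P1 - 1)" and "q2 = P2 / (P2 - 1)"
    have q: "1 < q1" "q1 \<le> qp" "1 < q2"
      using conj_exponent_bounds[OF pm P(1)] conj_exponent_bounds[OF pm P(3)] by (auto simp: q1_def q2_def qp_def)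
    have t0: "0 < t" using t(1) h by (smt (verit) powr_gt_zero)
    have cmp: "b powr (Q1 - 1) + t \<le> (C1 + 1) * (b powr (Q2 - 1) + t)"
      if Q: "pm \<le> Q1" "pm \<le> Q2" "\<bar>Q1 - Q2\<bar> \<le> K * h powr \<alpha>" for Q1 Q2
    proof (cases "h powr N' \<le> b")
      case True
      have "0 < h powr N'" using h by simp
      then have b0: "0 < b" using True by linarith
      have "b powr (Q1 - Q2) \<le> C1"
      proof (rule C1(2)[OF h])
        show "h powr N' \<le> B * b" using True B b by (smt (verit) mult_le_cancel_right1)
        have "h powr (- N) \<le> h powr (- N')" using h N' by (intro powr_mono') auto
        then show "b \<le> B * h powr (- N')" using b B by (smt (verit) mult_left_mono)
      qed (use Q in auto)
      moreover have "b powr (Q1 - 1) = b powr (Q1 - Q2) * b powr (Q2 - 1)"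
        using b0 by (simp add: powr_add[symmetric])
      ultimately have "b powr (Q1 - 1) \<le> C1 * b powr (Q2 - 1)"
        by (simp add: mult_right_mono)
      also have "\<dots> \<le> (C1 + 1) * b powr (Q2 - 1)" by (intro mult_right_mono) auto
      finally have 1: "b powr (Q1 - 1) \<le> (C1 + 1) * b powr (Q2 - 1)" .
      have "1 * t \<le> (C1 + 1) * t" using C1(1) t0 by (intro mult_right_mono) auto
      with 1 show ?thesis by (simp add: algebra_simps)
    next
      case False
      have "b powr (Q1 - 1) \<le> (h powr N') powr (Q1 - 1)"
        using False b Q pm by (intro powr_mono2) auto
      also have "\<dots> = h powr (N' * (Q1 - 1))" by (simp add: powr_powr)
      also have "\<dots> \<le> h powr N"
      proof (rule powr_mono')
        have "N' * (pm - 1) \<le> N' * (Q1 - 1)" using Q N' by (intro mult_left_mono) auto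
        then show "N \<le> N' * (Q1 - 1)" using N'pm by linarith
      qed (use h in auto)
      finally have "b powr (Q1 - 1) + t \<le> 2 * t" using t by simp
      also have "\<dots> \<le> (C1 + 1) * (b powr (Q2 - 1) + t)"
        using C1(1) t0 by (intro mult_mono) auto
      finally show ?thesis .
    qed
    let ?S = "b powr (P2 - 1) + t"
    have S0: "0 < ?S" using t0 by (simp add: add_nonneg_pos)
    have "shifted_power q1 (b powr (P1 - 1)) t \<le> (C1 + 1) powr (q1 + 2) * shifted_power q1 (b powr (P2 - 1)) t"
      using cmp[of P1 P2] cmp[of P2 P1] P C1(1) t0 q
      by (intro shifted_power_comparable) (auto simp: abs_minus_commute)
    also have "\<dots> \<le> (C1 + 1) powr (qp + 2) * shifted_power q1 (b powr (P2 - 1)) t"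
      using q C1(1) by (intro mult_right_mono powr_mono) auto
    also have "shifted_power q1 (b powr (P2 - 1)) t = ?S powr (q1 - q2) * shifted_power q2 (b powr (P2 - 1)) t"
      using S0 by (simp add: shifted_power_def powr_add[symmetric] mult.assoc[symmetric])
    also have "?S powr (q1 - q2) \<le> C2"
    proof (rule C2(2)[OF h])
      have pp': "1 \<le> pp'" by (simp add: pp'_def)
      have hN: "h powr (N * pp') \<le> h powr N"
        using h N pp' by (intro powr_mono') (auto simp: mult_le_cancel_left1)
      also have "\<dots> \<le> ?S" using t by (simp add: add_increasing)
      also have "\<dots> \<le> B2 * ?S" using S0 B2 by (simp add: mult_le_cancel_right1)
      finally show "h powr (N * pp') \<le> B2 * ?S" .
      have "b powr (P2 - 1) \<le> B powr pp' * h powr (- (N * pp'))"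
        using h B N b P pm by (intro powr_le_bound) (auto simp: pp'_def)
      moreover have "t powr 1 \<le> B powr pp' * h powr (- (N * pp'))"
        using h B N t t0 pp' by (intro powr_le_bound) auto
      ultimately show "?S \<le> B2 * h powr (- (N * pp'))" using t0 by (simp add: B2_def)
      have "\<bar>q1 - q2\<bar> \<le> \<bar>P1 - P2\<bar> / (pm - 1)\<^sup>2"
        unfolding q1_def q2_def by (rule conj_exponent_diff[OF pm P(1,3)])
      also have "\<dots> \<le> K * h powr \<alpha> / (pm - 1)\<^sup>2" using P(5) by (intro divide_right_mono) auto
      finally show "\<bar>q1 - q2\<bar> \<le> K / (pm - 1)\<^sup>2 * h powr \<alpha>" by simp
    qed
    then have "(C1 + 1) powr (qp + 2) * (?S powr (q1 - q2) * shifted_power q2 (b powr (P2 - 1)) t)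
       \<le> (C1 + 1) powr (qp + 2) * (C2 * shifted_power q2 (b powr (P2 - 1)) t)"
      by (intro mult_left_mono mult_right_mono) auto
    finally show ?thesis by (simp add: C_def q1_def q2_def mult.assoc)
  qed
  ultimately show ?thesis by (rule that)
qed

text \<open>
The shift is at most a fixed power of \<open>1/h\<close>, so the value grows at most like a power of \<open>1/h\<close> times \<open>t\<close>.
\<close>

lemma shifted_power_tiny_argument:
  fixes pm pp d B m :: real
  assumes pm: "1 < pm" and d: "0 \<le> d" and B: "1 \<le> B"
  obtains C N where "1 \<le> C" "d \<le> N"
    "\<And>h P b t. 0 < h \<Longrightarrow> h \<le> 1 \<Longrightarrow> pm \<le> P \<Longrightarrow> P \<le> pp \<Longrightarrow> 0 \<le> t \<Longrightarrow> t < h powr N \<Longrightarrow> 0 \<le> b \<Longrightarrow> b \<le> B * h powr (- d) \<Longrightarrow>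
       conj_power P b t \<le> C * h powr m"
proof -
  define pp' where "pp' = \<bar>pp\<bar> + 1"
  define qp where "qp = pm / (pm - 1)"
  have qp: "0 < qp" using pm by (simp add: qp_def)
  have pp': "1 \<le> pp'" by (simp add: pp'_def)
  \<comment> \<open>The term \<open>d * pp' * qp\<close> absorbs the growth of the shift, \<open>d\<close> makes \<open>d \<le> N\<close>.\<close>
  define N where "N = \<bar>m\<bar> + d + d * pp' * qp"
  define B2 where "B2 = 2 * B powr pp'"
  have Bp: "1 \<le> B powr pp'" using B pp' by (intro ge_one_powr_ge_zero) auto
  then have B2: "1 \<le> B2" by (simp add: B2_def)
  have dd: "0 \<le> d * pp'" "0 \<le> d * pp' * qp" using d pp' qp by auto
  have "1 \<le> B2 powr qp" using B2 qp by (intro ge_one_powr_ge_zero) auto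
  moreover have "d \<le> N" using dd by (simp add: N_def)
  moreover have "conj_power P b t \<le> B2 powr qp * h powr m"
    if h: "0 < h" "h \<le> 1" and P: "pm \<le> P" "P \<le> pp" and t: "0 \<le> t" "t < h powr N"
      and b: "0 \<le> b" "b \<le> B * h powr (- d)" for h P b t
  proof -
    define q where "q = P / (P - 1)"
    have q: "1 < q" "q \<le> qp" using conj_exponent_bounds[OF pm P(1)] by (auto simp: q_def qp_def)
    let ?H = "h powr (- (d * pp'))"
    have H: "1 \<le> ?H" using h dd powr_mono'[of "- (d * pp')" 0 h] by simp
    have "b powr (P - 1) \<le> B powr pp' * ?H"
      using h B d b P pm by (intro powr_le_bound) (auto simp: pp'_def)
    moreover have "t \<le> B powr pp' * ?H"
    proof -
      have "h powr N \<le> h powr 0" using h dd d by (intro powr_mono') (auto simp: N_def)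
      then have "t \<le> 1 * 1" using t h by simp
      also have "\<dots> \<le> B powr pp' * ?H" using Bp H by (intro mult_mono) auto
      finally show ?thesis .
    qed
    ultimately have S: "b powr (P - 1) + t \<le> B2 * ?H" by (simp add: B2_def)
    have BH: "1 \<le> B2 * ?H" using mult_mono[OF B2 H] B2 by simp
    have "shifted_power q (b powr (P - 1)) t \<le> (b powr (P - 1) + t) powr (q - 1) * t"
      using q t by (intro shifted_power_le_linear) auto
    also have "\<dots> \<le> (B2 * ?H) powr (q - 1) * h powr N"
      using S q t by (intro mult_mono powr_mono2) auto
    also have "\<dots> \<le> (B2 * ?H) powr qp * h powr N"
      using BH q by (intro mult_right_mono powr_mono) auto
    also have "\<dots> = B2 powr qp * h powr (\<bar>m\<bar> + d)"
      using B2 by (simp add: powr_mult powr_powr powr_add[symmetric] mult.assoc N_def)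
    also have "\<dots> \<le> B2 powr qp * h powr m"
      using h d by (intro mult_left_mono powr_mono') auto
    finally show ?thesis by (simp add: q_def)
  qed
  ultimately show ?thesis by (rule that)
qed

section \<open>A Jensen inequality with variable shift and exponent\<close>

text \<open>
Both alternatives for the size of \<open>u\<close>, with the same threshold. In the second one the exponents are exchanged at
the point \<open>u\<close>, before the weak Jensen inequality with the exponent \<open>P2\<close> passes from \<open>u\<close> to \<open>t\<close>; hence \<open>t\<close>
is not restricted.
\<close>

lemma shifted_power_variable_jensen:
  fixes pm pp \<alpha> K d B m :: real
  assumes pm: "1 < pm" and \<alpha>: "0 < \<alpha>" and K: "0 \<le> K" and d: "0 \<le> d" and B: "1 \<le> B"
  obtains C N where "1 \<le> C"
    "\<And>h P b u. 0 < h \<Longrightarrow> h \<le> 1 \<Longrightarrow> pm \<le> P \<Longrightarrow> P \<le> pp \<Longrightarrow> 0 \<le> b \<Longrightarrow> b \<le> B * h powr (- d) \<Longrightarrow>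
       0 \<le> u \<Longrightarrow> u < h powr N \<Longrightarrow>
       conj_power P b u \<le> C * h powr m"
    "\<And>h P1 P2 b u t. 0 < h \<Longrightarrow> h \<le> 1 \<Longrightarrow> pm \<le> P1 \<Longrightarrow> P1 \<le> pp \<Longrightarrow> pm \<le> P2 \<Longrightarrow> P2 \<le> pp \<Longrightarrow>
       \<bar>P1 - P2\<bar> \<le> K * h powr \<alpha> \<Longrightarrow> 0 \<le> b \<Longrightarrow> b \<le> B * h powr (- d) \<Longrightarrow>
       h powr N \<le> u \<Longrightarrow> u \<le> B * h powr (- d) \<Longrightarrow> 0 \<le> t \<Longrightarrow>
       conj_power P1 b u * (t / u - 1 / 2)
       \<le> C * conj_power P2 b t"
proof -
  define qp where "qp = pm / (pm - 1)"
  obtain C1 N where C1: "1 \<le> C1" "d \<le> N"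
    "\<And>h P b t. 0 < h \<Longrightarrow> h \<le> 1 \<Longrightarrow> pm \<le> P \<Longrightarrow> P \<le> pp \<Longrightarrow> 0 \<le> t \<Longrightarrow> t < h powr N \<Longrightarrow> 0 \<le> b \<Longrightarrow> b \<le> B * h powr (- d) \<Longrightarrow>
       conj_power P b t \<le> C1 * h powr m"
    using shifted_power_tiny_argument[OF pm d B] by metis
  have N: "0 \<le> N" using C1 d by linarith
  obtain C2 where C2: "1 \<le> C2"
    "\<And>h P1 P2 b t. 0 < h \<Longrightarrow> h \<le> 1 \<Longrightarrow> pm \<le> P1 \<Longrightarrow> P1 \<le> pp \<Longrightarrow> pm \<le> P2 \<Longrightarrow> P2 \<le> pp \<Longrightarrow>
       \<bar>P1 - P2\<bar> \<le> K * h powr \<alpha> \<Longrightarrow> h powr N \<le> t \<Longrightarrow> t \<le> B * h powr (- N) \<Longrightarrow>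
       0 \<le> b \<Longrightarrow> b \<le> B * h powr (- N) \<Longrightarrow>
       conj_power P1 b t \<le> C2 * conj_power P2 b t"
    using shifted_power_exponent_change[OF pm \<alpha> K N B] by metis
  define C where "C = C1 + C2 * 2 powr (qp + 2)"
  have C: "C1 \<le> C" "C2 * 2 powr (qp + 2) \<le> C" using C1(1) C2(1) by (auto simp: C_def)
  show ?thesis
  proof (rule that[of C N])
    show "1 \<le> C" using C C1 by linarith
  next
    fix h P b u :: real
    assume asm: "0 < h" "h \<le> 1" "pm \<le> P" "P \<le> pp" "0 \<le> b" "b \<le> B * h powr (- d)" "0 \<le> u" "u < h powr N"
    have "conj_power P b u \<le> C1 * h powr m"
      by (rule C1(3)) (use asm in auto)
    also have "\<dots> \<le> C * h powr m" using C by (intro mult_right_mono) auto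
    finally show "conj_power P b u \<le> C * h powr m" .
  next
    fix h P1 P2 b u t :: real
    assume h: "0 < h" "h \<le> 1" and P: "pm \<le> P1" "P1 \<le> pp" "pm \<le> P2" "P2 \<le> pp" "\<bar>P1 - P2\<bar> \<le> K * h powr \<alpha>"
      and b: "0 \<le> b" "b \<le> B * h powr (- d)" and u: "h powr N \<le> u" "u \<le> B * h powr (- d)" and t: "0 \<le> t"
    let ?s1 = "conj_power P1 b"
    let ?s2 = "conj_power P2 b"
    have "0 < h powr N" using h by simp
    then have u0: "0 < u" using u by linarith
    have "h powr (- d) \<le> h powr (- N)" using h C1(2) by (intro powr_mono') auto
    then have "B * h powr (- d) \<le> B * h powr (- N)" using B by (intro mult_left_mono) auto
    then have s12: "?s1 u \<le> C2 * ?s2 u" using h P b u by (intro C2(2)[of h]) auto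
    note q2 = conj_exponent_bounds[OF pm P(3), folded qp_def]
    show "?s1 u * (t / u - 1 / 2) \<le> C * ?s2 t"
    proof (cases "0 \<le> t / u - 1 / 2")
      case True
      have "?s1 u * (t / u - 1 / 2) \<le> C2 * ?s2 u * (t / u - 1 / 2)"
        using s12 True by (rule mult_right_mono)
      also have "\<dots> = C2 * (?s2 u * (t / u - 1 / 2))" by simp
      also have "\<dots> \<le> C2 * (2 powr (P2 / (P2 - 1) + 2) * ?s2 t)"
        using q2 u0 t C2(1) by (intro mult_left_mono shifted_power_weak_jensen) auto
      also have "\<dots> \<le> C2 * (2 powr (qp + 2) * ?s2 t)"
        using q2 C2(1) by (intro mult_left_mono mult_right_mono powr_mono) auto
      also have "\<dots> = C2 * 2 powr (qp + 2) * ?s2 t" by simp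
      also have "\<dots> \<le> C * ?s2 t" using C by (intro mult_right_mono) auto
      finally show ?thesis .
    next
      case False
      then have "?s1 u * (t / u - 1 / 2) \<le> 0" by (simp add: mult_nonneg_nonpos)
      also have "0 \<le> C * ?s2 t" using C C1 by (simp add: mult_nonneg_nonneg)
      finally show ?thesis .
    qed
  qed
qed

lemma ennreal_integral_le_nn_integral:
  assumes "integrable M (f :: 'a \<Rightarrow> real)"
  shows "ennreal (integral\<^sup>L M f) \<le> (\<integral>\<^sup>+x. ennreal (f x) \<partial>M)"
proof -
  have int: "integrable M (\<lambda>x. max 0 (f x))" using assms by simp
  have "integral\<^sup>L M f \<le> integral\<^sup>L M (\<lambda>x. max 0 (f x))"
    by (intro integral_mono assms int) auto
  then have "ennreal (integral\<^sup>L M f) \<le> ennreal (integral\<^sup>L M (\<lambda>x. max 0 (f x)))"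
    by (rule ennreal_leI)
  also have "\<dots> = (\<integral>\<^sup>+x. ennreal (max 0 (f x)) \<partial>M)"
    by (rule nn_integral_eq_integral[symmetric]) (use int in auto)
  also have "\<dots> = (\<integral>\<^sup>+x. ennreal (f x) \<partial>M)"
    by (intro nn_integral_cong) (auto simp: max_def ennreal_neg)
  finally show ?thesis .
qed

lemma nn_integral_lebesgue_on_mono_set:
  assumes "S \<in> sets lebesgue" "T \<in> sets lebesgue" "S \<subseteq> T"
  shows "(\<integral>\<^sup>+x. f x \<partial>lebesgue_on S) \<le> (\<integral>\<^sup>+x. f x \<partial>lebesgue_on T)"
  using assms by (auto simp: nn_integral_restrict_space intro!: nn_integral_mono mult_left_mono
      split: split_indicator)

lemma borel_measurable_shifted_power [measurable]:
  assumes [measurable]: "q \<in> borel_measurable M" "s \<in> borel_measurable M" "t \<in> borel_measurable M"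
  shows "(\<lambda>x. shifted_power (q x) (s x) (t x)) \<in> borel_measurable M"
  unfolding shifted_power_def by measurable

text \<open>
The estimate behind the theorem, free of meshes: \<open>u\<close> is the mean of \<open>t\<close> over \<open>D\<close>, the error \<open>r\<close> on \<open>T\<close> is
controlled by \<open>t + u\<close>, and \<open>Y\<close> is a constant vector that freezes the shift. Writing \<open>E\<close>, \<open>E1\<close>, \<open>E2\<close> for the
densities with shift \<open>X\<close> and argument \<open>t\<close>, shift \<open>Y\<close> and argument \<open>t\<close>, and shift \<open>Y\<close> and argument
\<open>u\<close>, the error is bounded by \<open>E + E2\<close>, then \<open>E2\<close> by \<open>E1\<close> through the Jensen inequality, and \<open>E1\<close> by \<open>E\<close>;
each change of shift adds \<open>G\<close>, the squared difference of the images.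
\<close>

lemma conj_modular_local_estimate:
  fixes pm pp \<alpha> K d B m C0 :: real
  assumes pm: "1 < pm" and \<alpha>: "0 < \<alpha>" and K: "0 \<le> K" and d: "0 \<le> d" and B: "1 \<le> B" and C0: "1 \<le> C0"
  obtains C where "1 \<le> C"
    "\<And>\<delta> p (X :: 'a::euclidean_space \<Rightarrow> 'v::euclidean_space) Y t u r h D T. 0 \<le> \<delta> \<Longrightarrow> 0 < h \<Longrightarrow> h \<le> 1 \<Longrightarrow>
      D \<in> lmeasurable \<Longrightarrow> 0 < measure lebesgue D \<Longrightarrow> T \<in> sets lebesgue \<Longrightarrow> T \<subseteq> D \<Longrightarrow>
      p \<in> borel_measurable (lebesgue_on D) \<Longrightarrow> X \<in> borel_measurable (lebesgue_on D) \<Longrightarrow>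
      integrable (lebesgue_on D) t \<Longrightarrow>
      (\<And>x. x \<in> D \<Longrightarrow> pm \<le> p x \<and> p x \<le> pp) \<Longrightarrow>
      (\<And>x y. x \<in> D \<Longrightarrow> y \<in> D \<Longrightarrow> \<bar>p x - p y\<bar> \<le> K * h powr \<alpha>) \<Longrightarrow>
      (\<And>x. x \<in> D \<Longrightarrow> 0 \<le> t x) \<Longrightarrow>
      measure lebesgue D * u = integral\<^sup>L (lebesgue_on D) t \<Longrightarrow>
      u \<le> B * h powr (- d) \<Longrightarrow> \<delta> + norm Y \<le> B * h powr (- d) \<Longrightarrow>
      (AE x in lebesgue_on T. \<bar>r x\<bar> \<le> C0 * (t x + u)) \<Longrightarrow>
      conj_modular \<delta> p (\<lambda>x. norm (X x)) T r \<le> ennreal C *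
        (ennreal (h powr m * measure lebesgue T) + conj_modular \<delta> p (\<lambda>x. norm (X x)) D t
         + L2_norm_squared D (\<lambda>x. weighted \<delta> (p x) (X x) - weighted \<delta> (p x) Y))"
proof -
  define qp where "qp = pm / (pm - 1)"
  have qp: "0 < qp" using pm by (simp add: qp_def)
  obtain Ce where Ce: "1 \<le> Ce"
    "\<And>\<delta> (p :: 'a \<Rightarrow> real) a x t. 0 \<le> \<delta> \<Longrightarrow> 0 \<le> a \<Longrightarrow> 0 \<le> t \<Longrightarrow> pm \<le> p x \<Longrightarrow> p x \<le> pp \<Longrightarrow>
       phi_shift_conj \<delta> p a x t \<le> Ce * shifted_power (dual_exponent p x) ((\<delta> + a) powr (p x - 1)) t \<and>
       shifted_power (dual_exponent p x) ((\<delta> + a) powr (p x - 1)) t \<le> Ce * phi_shift_conj \<delta> p a x t"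
    using phi_shift_conj_equiv[OF pm] by metis
  obtain Cs where Cs: "1 \<le> Cs"
    "\<And>\<delta> P X Y t. 0 \<le> \<delta> \<Longrightarrow> pm \<le> P \<Longrightarrow> P \<le> pp \<Longrightarrow> 0 \<le> t \<Longrightarrow>
      conj_power P (\<delta> + norm (X::'v)) t
      \<le> Cs * (conj_power P (\<delta> + norm Y) t +
         (norm (weighted \<delta> P X - weighted \<delta> P Y))\<^sup>2)"
    using shift_change[OF pm] by metis
  obtain Cj N where Cj: "1 \<le> Cj"
    "\<And>h P b u. 0 < h \<Longrightarrow> h \<le> 1 \<Longrightarrow> pm \<le> P \<Longrightarrow> P \<le> pp \<Longrightarrow> 0 \<le> b \<Longrightarrow> b \<le> B * h powr (- d) \<Longrightarrow>
       0 \<le> u \<Longrightarrow> u < h powr N \<Longrightarrow>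
       conj_power P b u \<le> Cj * h powr m"
    "\<And>h P1 P2 b u t. 0 < h \<Longrightarrow> h \<le> 1 \<Longrightarrow> pm \<le> P1 \<Longrightarrow> P1 \<le> pp \<Longrightarrow> pm \<le> P2 \<Longrightarrow> P2 \<le> pp \<Longrightarrow>
       \<bar>P1 - P2\<bar> \<le> K * h powr \<alpha> \<Longrightarrow> 0 \<le> b \<Longrightarrow> b \<le> B * h powr (- d) \<Longrightarrow>
       h powr N \<le> u \<Longrightarrow> u \<le> B * h powr (- d) \<Longrightarrow> 0 \<le> t \<Longrightarrow>
       conj_power P1 b u * (t / u - 1 / 2)
       \<le> Cj * conj_power P2 b t"
    by (rule shifted_power_variable_jensen[OF pm \<alpha> K d B, of pp m]) blast
  define Cd where "Cd = Ce * (C0 powr (qp + 2) * (2 powr (qp + 2) * Cs))"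
  have Cd0: "0 \<le> Cd" using Ce Cs by (simp add: Cd_def)
  define K2 where "K2 = 2 * Cj * (Cs * (Ce + 1)) + Cj"
  have K20: "0 \<le> K2" using Cj(1) Cs(1) Ce(1) by (simp add: K2_def)
  define C where "C = Cd * (Ce + K2 + 1) + 1"
  have C1: "1 \<le> C" using Cd0 K20 Ce(1) by (simp add: C_def)
  show ?thesis
  proof (rule that[OF C1])
    fix \<delta> p t u r h D T and X :: "'a \<Rightarrow> 'v" and Y :: 'v
    assume \<delta>: "0 \<le> \<delta>" and h: "0 < h" "h \<le> 1" and D: "D \<in> lmeasurable" "0 < measure lebesgue D"
      and T: "T \<in> sets lebesgue" "T \<subseteq> D"
      and pm' [measurable]: "p \<in> borel_measurable (lebesgue_on D)" and X [measurable]: "X \<in> borel_measurable (lebesgue_on D)"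
      and tint: "integrable (lebesgue_on D) t"
      and p: "\<And>x. x \<in> D \<Longrightarrow> pm \<le> p x \<and> p x \<le> pp"
      and ph: "\<And>x y. x \<in> D \<Longrightarrow> y \<in> D \<Longrightarrow> \<bar>p x - p y\<bar> \<le> K * h powr \<alpha>"
      and t: "\<And>x. x \<in> D \<Longrightarrow> 0 \<le> t x"
      and u: "measure lebesgue D * u = integral\<^sup>L (lebesgue_on D) t"
      and uB: "u \<le> B * h powr (- d)" and YB: "\<delta> + norm Y \<le> B * h powr (- d)"
      and r: "AE x in lebesgue_on T. \<bar>r x\<bar> \<le> C0 * (t x + u)"
    have Dm: "D \<in> sets lebesgue" using D by (simp add: fmeasurableD)
    have t_meas [measurable]: "t \<in> borel_measurable (lebesgue_on D)"
      using tint by (rule borel_measurable_integrable)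
    let ?\<mu> = "lebesgue_on D" and ?\<nu> = "lebesgue_on T"
    have space: "space ?\<mu> = D" "space ?\<nu> = T" using Dm T by simp_all
    define W where "W x = weighted \<delta> (p x) (X x) - weighted \<delta> (p x) Y" for x
    define q where "q x = p x / (p x - 1)" for x
    define G where "G x = (norm (W x))\<^sup>2" for x
    define E where "E x = shifted_power (q x) ((\<delta> + norm (X x)) powr (p x - 1)) (t x)" for x
    define E1 where "E1 x = shifted_power (q x) ((\<delta> + norm Y) powr (p x - 1)) (t x)" for x
    define E2 where "E2 x = shifted_power (q x) ((\<delta> + norm Y) powr (p x - 1)) u" for x
    have meas [measurable]: "W \<in> borel_measurable ?\<mu>" "q \<in> borel_measurable ?\<mu>"
      unfolding W_def q_def by measurable
    have meas2 [measurable]: "G \<in> borel_measurable ?\<mu>" "E \<in> borel_measurable ?\<mu>"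
      "E1 \<in> borel_measurable ?\<mu>" "E2 \<in> borel_measurable ?\<mu>"
      unfolding G_def E_def E1_def E2_def by measurable
    have measT: "f \<in> borel_measurable ?\<nu>" if "f \<in> borel_measurable ?\<mu>" for f :: "'a \<Rightarrow> real"
      by (rule measurable_restrict_mono[OF that T(2)])
    note measT' [measurable] = measT[OF meas2(1)] measT[OF meas2(2)] measT[OF meas2(3)] measT[OF meas2(4)]
    have pos: "0 \<le> G x" "0 \<le> E x" "0 \<le> E1 x" "0 \<le> E2 x" for x
      by (auto simp: G_def E_def E1_def E2_def)
    have u0: "0 \<le> u"
    proof -
      have "0 \<le> integral\<^sup>L ?\<mu> t" by (rule integral_nonneg_AE) (auto simp: space t)
      then show ?thesis using u D(2) by (metis zero_le_mult_iff not_less)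
    qed
    have q: "1 < q x" "q x \<le> qp" "dual_exponent p x = q x" if "x \<in> D" for x
      using conj_exponent_bounds[OF pm, of "p x"] p[OF that] by (auto simp: q_def qp_def dual_exponent_def)
    let ?H = "ennreal (h powr m * measure lebesgue T)"
    let ?Ec = "conj_modular \<delta> p (\<lambda>x. norm (X x)) D t"
    let ?G = "L2_norm_squared D W"
    let ?R = "?H + ?Ec + ?G"
    have GR: "(\<integral>\<^sup>+x. ennreal (G x) \<partial>?\<mu>) \<le> ?R"
      unfolding L2_norm_squared_def G_def by simp
    have ER: "(\<integral>\<^sup>+x. ennreal (E x) \<partial>?\<mu>) \<le> ennreal Ce * ?R"
    proof -
      have "(\<integral>\<^sup>+x. ennreal (1 / Ce) * ennreal (E x) \<partial>?\<mu>) \<le> ?Ec"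
        unfolding conj_modular_def
      proof (rule nn_integral_mono)
        fix x assume "x \<in> space ?\<mu>"
        then have x: "x \<in> D" by (simp add: space)
        have "E x \<le> Ce * phi_shift_conj \<delta> p (norm (X x)) x \<bar>t x\<bar>"
          using Ce(2)[of \<delta> "norm (X x)" "t x" p x] \<delta> t[OF x] p[OF x] q[OF x] by (simp add: E_def)
        then have "1 / Ce * E x \<le> phi_shift_conj \<delta> p (norm (X x)) x \<bar>t x\<bar>"
          using Ce(1) by (simp add: divide_le_eq mult.commute)
        then show "ennreal (1 / Ce) * ennreal (E x) \<le> ennreal (phi_shift_conj \<delta> p (norm (X x)) x \<bar>t x\<bar>)"
          using Ce(1) pos by (simp add: ennreal_mult[symmetric] ennreal_leI)
      qed
      then have "ennreal (1 / Ce) * (\<integral>\<^sup>+x. ennreal (E x) \<partial>?\<mu>) \<le> ?Ec"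
        by (simp add: nn_integral_cmult)
      then have "ennreal Ce * (ennreal (1 / Ce) * (\<integral>\<^sup>+x. ennreal (E x) \<partial>?\<mu>)) \<le> ennreal Ce * ?Ec"
        by (rule mult_left_mono) simp
      moreover have "ennreal Ce * ennreal (1 / Ce) = 1" using Ce(1) by (simp add: ennreal_mult[symmetric])
      ultimately have "(\<integral>\<^sup>+x. ennreal (E x) \<partial>?\<mu>) \<le> ennreal Ce * ?Ec"
        by (simp add: mult.assoc[symmetric])
      also have "\<dots> \<le> ennreal Ce * ?R" by (intro mult_left_mono) (simp_all add: add_increasing add_increasing2)
      finally show ?thesis .
    qed
    have E1R: "(\<integral>\<^sup>+x. ennreal (E1 x) \<partial>?\<mu>) \<le> ennreal (Cs * (Ce + 1)) * ?R"
    proof -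
      have "(\<integral>\<^sup>+x. ennreal (E1 x) \<partial>?\<mu>) \<le> (\<integral>\<^sup>+x. ennreal Cs * (ennreal (E x) + ennreal (G x)) \<partial>?\<mu>)"
      proof (rule nn_integral_mono)
        fix x assume "x \<in> space ?\<mu>"
        then have x: "x \<in> D" by (simp add: space)
        have "E1 x \<le> Cs * (E x + G x)"
          using Cs(2)[of \<delta> "p x" "t x" Y "X x"] \<delta> p[OF x] t[OF x]
          by (simp add: E1_def E_def G_def W_def q_def norm_minus_commute)
        then have "ennreal (E1 x) \<le> ennreal (Cs * (E x + G x))" by (rule ennreal_leI)
        then show "ennreal (E1 x) \<le> ennreal Cs * (ennreal (E x) + ennreal (G x))"
          using Cs(1) pos by (simp add: ennreal_mult[symmetric] ennreal_plus[symmetric] del: ennreal_plus)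
      qed
      also have "\<dots> = ennreal Cs * ((\<integral>\<^sup>+x. ennreal (E x) \<partial>?\<mu>) + (\<integral>\<^sup>+x. ennreal (G x) \<partial>?\<mu>))"
        by (simp add: nn_integral_cmult nn_integral_add)
      also have "\<dots> \<le> ennreal Cs * (ennreal Ce * ?R + ?R)"
        by (intro mult_left_mono add_mono ER GR) simp
      also have "\<dots> = ennreal Cs * (ennreal (Ce + 1) * ?R)"
      proof -
        have "ennreal (Ce + 1) = ennreal Ce + 1" using Ce(1) by (simp add: ennreal_plus)
        then show ?thesis by (simp only: distrib_right mult_1_left)
      qed
      also have "\<dots> = ennreal (Cs * (Ce + 1)) * ?R"
        using Ce(1) Cs(1) by (simp add: ennreal_mult mult.assoc)
      finally show ?thesis .
    qed
    have Tfin: "T \<in> lmeasurable" using T D fmeasurableI2 by blast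
    have eT: "emeasure ?\<nu> (space ?\<nu>) = ennreal (measure lebesgue T)"
      using T Tfin by (simp only: space) (simp add: emeasure_restrict_space emeasure_eq_measure2)
    have TD: "measure lebesgue T \<le> measure lebesgue D"
      using T D by (intro measure_mono_fmeasurable) auto
    have E2R: "(\<integral>\<^sup>+x. ennreal (E2 x) \<partial>?\<nu>) \<le> ennreal K2 * ?R"
    proof (cases "u < h powr N")
      case True
      have "(\<integral>\<^sup>+x. ennreal (E2 x) \<partial>?\<nu>) \<le> (\<integral>\<^sup>+x. ennreal (Cj * h powr m) \<partial>?\<nu>)"
      proof (rule nn_integral_mono, rule ennreal_leI)
        fix x assume "x \<in> space ?\<nu>"
        then have x: "x \<in> D" using T by (auto simp: space)
        show "E2 x \<le> Cj * h powr m"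
          unfolding E2_def q_def by (rule Cj(2)[OF h]) (use p[OF x] \<delta> YB u0 True in auto)
      qed
      also have "\<dots> = ennreal (Cj * h powr m) * ennreal (measure lebesgue T)"
        using eT by simp
      also have "\<dots> = ennreal Cj * ?H"
        using Cj(1) by (simp add: ennreal_mult mult.assoc)
      also have "\<dots> \<le> ennreal K2 * ?R"
        using Cj(1) Cs(1) Ce(1) by (intro mult_mono ennreal_leI) (auto simp: K2_def add_increasing2 add.assoc)
      finally show ?thesis .
    next
      case False
      have "0 < h powr N" using h by simp
      then have u1: "0 < u" using False by linarith
      let ?I = "\<integral>\<^sup>+x. ennreal (E1 x) \<partial>?\<mu>"
      \<comment> \<open>The Jensen inequality is integrated over \<open>D\<close>; the mean of \<open>t / u\<close> is \<open>1\<close>, so half of the volume remains.\<close>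
      have bnd: "ennreal (E2 x) \<le> ennreal (2 * Cj / measure lebesgue D) * ?I" if x: "x \<in> D" for x
      proof -
        interpret finite_measure ?\<mu> by (rule finite_measure_lebesgue_on[OF D(1)])
        have measD: "measure ?\<mu> D = measure lebesgue D" using Dm by (simp add: measure_restrict_space)
        let ?f = "\<lambda>y. E2 x * (t y / u - 1 / 2)"
        have "integral\<^sup>L ?\<mu> ?f = E2 x * (integral\<^sup>L ?\<mu> t / u - 1 / 2 * measure lebesgue D)"
          using tint by (simp add: space measD)
        also have "integral\<^sup>L ?\<mu> t / u = measure lebesgue D" using u u1 by (simp add: field_simps)
        finally have "E2 x * (measure lebesgue D / 2) = integral\<^sup>L ?\<mu> ?f"
          by (simp only: mult_1_right) (simp add: field_simps)
        also have "ennreal (integral\<^sup>L ?\<mu> ?f) \<le> (\<integral>\<^sup>+y. ennreal (?f y) \<partial>?\<mu>)"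
          by (rule ennreal_integral_le_nn_integral) (use tint in auto)
        also have "\<dots> \<le> (\<integral>\<^sup>+y. ennreal Cj * ennreal (E1 y) \<partial>?\<mu>)"
        proof (rule nn_integral_mono)
          fix y assume "y \<in> space ?\<mu>"
          then have y: "y \<in> D" by (simp add: space)
          have "?f y \<le> Cj * E1 y"
            unfolding E2_def E1_def q_def
            by (rule Cj(3)[OF h]) (use p[OF x] p[OF y] ph[OF x y] \<delta> YB False uB t[OF y] in auto)
          then have "ennreal (?f y) \<le> ennreal (Cj * E1 y)" by (rule ennreal_leI)
          then show "ennreal (?f y) \<le> ennreal Cj * ennreal (E1 y)"
            using Cj(1) pos by (simp add: ennreal_mult)
        qed
        also have "\<dots> = ennreal Cj * ?I" by (simp add: nn_integral_cmult)
        finally have *: "ennreal (E2 x * (measure lebesgue D / 2)) \<le> ennreal Cj * ?I" .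
        have "ennreal (E2 x) = ennreal (2 / measure lebesgue D) * ennreal (E2 x * (measure lebesgue D / 2))"
          using D(2) pos by (simp add: ennreal_mult[symmetric])
        also have "\<dots> \<le> ennreal (2 / measure lebesgue D) * (ennreal Cj * ?I)"
          using * by (rule mult_left_mono) simp
        also have "\<dots> = ennreal (2 * Cj / measure lebesgue D) * ?I"
          using D(2) Cj(1) by (simp add: mult.assoc[symmetric] ennreal_mult[symmetric])
        finally show ?thesis .
      qed
      have "(\<integral>\<^sup>+x. ennreal (E2 x) \<partial>?\<nu>) \<le> (\<integral>\<^sup>+x. ennreal (2 * Cj / measure lebesgue D) * ?I \<partial>?\<nu>)"
        using bnd T by (intro nn_integral_mono) (auto simp: space)
      also have "\<dots> = ennreal (2 * Cj / measure lebesgue D) * ?I * ennreal (measure lebesgue T)"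
        using eT by simp
      also have "\<dots> = ennreal (2 * Cj / measure lebesgue D * measure lebesgue T) * ?I"
        using D(2) Cj(1) by (subst ennreal_mult) (simp_all add: mult_ac)
      also have "\<dots> \<le> ennreal (2 * Cj) * (ennreal (Cs * (Ce + 1)) * ?R)"
      proof (rule mult_mono[OF ennreal_leI E1R])
        have "2 * Cj * measure lebesgue T \<le> 2 * Cj * measure lebesgue D" using TD Cj(1) by (intro mult_left_mono) auto
        then show "2 * Cj / measure lebesgue D * measure lebesgue T \<le> 2 * Cj"
          using D(2) by (simp add: divide_le_eq)
      qed auto
      also have "\<dots> = ennreal (2 * Cj * (Cs * (Ce + 1))) * ?R"
        using Cj(1) Cs(1) Ce(1) by (simp add: ennreal_mult mult.assoc)
      also have "\<dots> \<le> ennreal K2 * ?R"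
        using Cj(1) by (intro mult_right_mono ennreal_leI) (auto simp: K2_def)
      finally show ?thesis .
    qed
    have "conj_modular \<delta> p (\<lambda>x. norm (X x)) T r
      \<le> (\<integral>\<^sup>+x. ennreal Cd * (ennreal (E x) + ennreal (E2 x) + ennreal (G x)) \<partial>?\<nu>)"
      unfolding conj_modular_def
    proof (rule nn_integral_mono_AE)
      show "AE x in ?\<nu>. ennreal (phi_shift_conj \<delta> p (norm (X x)) x \<bar>r x\<bar>)
          \<le> ennreal Cd * (ennreal (E x) + ennreal (E2 x) + ennreal (G x))"
        using r AE_space
      proof eventually_elim
        fix x assume rx: "\<bar>r x\<bar> \<le> C0 * (t x + u)" and "x \<in> space ?\<nu>"
        then have x: "x \<in> D" using T by (auto simp: space)
        let ?s = "(\<delta> + norm (X x)) powr (p x - 1)"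
        note qx = q[OF x]
        have "phi_shift_conj \<delta> p (norm (X x)) x \<bar>r x\<bar> \<le> Ce * shifted_power (q x) ?s \<bar>r x\<bar>"
          using Ce(2)[of \<delta> "norm (X x)" "\<bar>r x\<bar>" p x] \<delta> p[OF x] qx by simp
        also have "\<dots> \<le> Ce * shifted_power (q x) ?s (C0 * (t x + u))"
          using Ce(1) rx qx by (intro mult_left_mono shifted_power_mono) auto
        also have "\<dots> \<le> Ce * (C0 powr (q x + 2) * shifted_power (q x) ?s (t x + u))"
          using Ce(1) qx t[OF x] u0 C0 by (intro mult_left_mono shifted_power_scale) auto
        also have "\<dots> \<le> Ce * (C0 powr (qp + 2) * shifted_power (q x) ?s (t x + u))"
          using Ce(1) qx C0 by (intro mult_left_mono mult_right_mono powr_mono) auto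
        also have "\<dots> \<le> Ce * (C0 powr (qp + 2) * (2 powr (q x + 2) * (shifted_power (q x) ?s (t x) + shifted_power (q x) ?s u)))"
          using Ce(1) qx t[OF x] u0 by (intro mult_left_mono shifted_power_add) auto
        also have "\<dots> \<le> Ce * (C0 powr (qp + 2) * (2 powr (qp + 2) * (Cs * (E x + E2 x + G x))))"
        proof (intro mult_left_mono mult_mono powr_mono)
          have "shifted_power (q x) ?s u \<le> Cs * (E2 x + G x)"
            using Cs(2)[of \<delta> "p x" u "X x" Y] \<delta> p[OF x] u0
            by (simp add: E2_def G_def W_def q_def)
          moreover have "shifted_power (q x) ?s (t x) \<le> Cs * E x"
            using mult_right_mono[OF Cs(1) pos(2)[of x]] by (simp add: E_def)
          ultimately show "shifted_power (q x) ?s (t x) + shifted_power (q x) ?s u \<le> Cs * (E x + E2 x + G x)"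
            by (simp add: algebra_simps)
        qed (use Ce(1) qx in auto)
        also have "\<dots> = Cd * (E x + E2 x + G x)" by (simp add: Cd_def)
        finally have "ennreal (phi_shift_conj \<delta> p (norm (X x)) x \<bar>r x\<bar>) \<le> ennreal (Cd * (E x + E2 x + G x))"
          by (rule ennreal_leI)
        also have "\<dots> = ennreal Cd * (ennreal (E x) + ennreal (E2 x) + ennreal (G x))"
          using Cd0 pos by (simp add: ennreal_mult)
        finally show "ennreal (phi_shift_conj \<delta> p (norm (X x)) x \<bar>r x\<bar>)
            \<le> ennreal Cd * (ennreal (E x) + ennreal (E2 x) + ennreal (G x))" .
      qed
    qed
    also have "\<dots> = ennreal Cd * ((\<integral>\<^sup>+x. ennreal (E x) \<partial>?\<nu>) + (\<integral>\<^sup>+x. ennreal (E2 x) \<partial>?\<nu>) + (\<integral>\<^sup>+x. ennreal (G x) \<partial>?\<nu>))"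
      by (simp add: nn_integral_cmult nn_integral_add)
    also have "\<dots> \<le> ennreal Cd * (ennreal Ce * ?R + ennreal K2 * ?R + ?R)"
    proof (intro mult_left_mono add_mono E2R)
      show "(\<integral>\<^sup>+x. ennreal (E x) \<partial>?\<nu>) \<le> ennreal Ce * ?R"
        by (rule order_trans[OF nn_integral_lebesgue_on_mono_set[OF T(1) Dm T(2)] ER])
      show "(\<integral>\<^sup>+x. ennreal (G x) \<partial>?\<nu>) \<le> ?R"
        by (rule order_trans[OF nn_integral_lebesgue_on_mono_set[OF T(1) Dm T(2)] GR])
    qed simp
    also have "\<dots> = ennreal (Cd * (Ce + K2 + 1)) * ?R"
      using Cd0 Ce(1) K20 by (simp add: ennreal_mult ennreal_plus distrib_right distrib_left mult.assoc)
    also have "\<dots> \<le> ennreal C * ?R"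
      by (intro mult_right_mono ennreal_leI) (auto simp: C_def)
    finally show "conj_modular \<delta> p (\<lambda>x. norm (X x)) T r \<le> ennreal C *
        (ennreal (h powr m * measure lebesgue T) + conj_modular \<delta> p (\<lambda>x. norm (X x)) D t
         + L2_norm_squared D (\<lambda>x. weighted \<delta> (p x) (X x) - weighted \<delta> (p x) Y))"
      by (simp add: W_def[abs_def])
  qed
qed

section \<open>Polynomials on convex bodies\<close>

text \<open>
A finite difference of order \<open>n + 1\<close> is one of order \<open>n\<close> of the first difference.
\<close>

lemma alternating_binomial_sum_Suc:
  fixes f :: "nat \<Rightarrow> real"
  shows "(\<Sum>j\<le>Suc n. (-1) ^ j * real (Suc n choose j) * f j)
       = (\<Sum>j\<le>n. (-1) ^ j * real (n choose j) * (f j - f (Suc j)))"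
proof -
  have "(\<Sum>j\<le>Suc n. (-1) ^ j * real (Suc n choose j) * f j)
    = f 0 + (\<Sum>j\<le>n. (-1) ^ Suc j * real (n choose j) * f (Suc j))
          + (\<Sum>j\<le>n. (-1) ^ Suc j * real (n choose Suc j) * f (Suc j))"
    by (subst sum.atMost_Suc_shift) (simp add: distrib_left distrib_right sum.distrib sum_negf sum_subtractf algebra_simps)
  moreover have "f 0 + (\<Sum>j\<le>n. (-1) ^ Suc j * real (n choose Suc j) * f (Suc j))
    = (\<Sum>j\<le>Suc n. (-1) ^ j * real (n choose j) * f j)"
    by (subst sum.atMost_Suc_shift) simp
  moreover have "(\<Sum>j\<le>Suc n. (-1) ^ j * real (n choose j) * f j) = (\<Sum>j\<le>n. (-1) ^ j * real (n choose j) * f j)"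
    by simp
  ultimately show ?thesis
    by (simp add: right_diff_distrib sum_subtractf sum_negf)
qed

lemma finite_difference_poly_eq_0:
  fixes p :: "real poly"
  assumes "p = 0 \<or> degree p < n"
  shows "(\<Sum>j\<le>n. (-1) ^ j * real (n choose j) * poly p (real j)) = 0"
  using assms
proof (induction n arbitrary: p)
  case (Suc n)
  define g where "g = p - pcompose p [:1, 1:]"
  have "degree g \<le> degree p"
    unfolding g_def by (rule degree_diff_le) (auto simp: degree_pcompose)
  moreover have "coeff g (degree p) = 0"
  proof -
    have "coeff (pcompose p [:1, 1:]) (degree p) = lead_coeff (pcompose p [:1, 1:])"
      by (simp add: degree_pcompose)
    also have "\<dots> = lead_coeff p" by (subst lead_coeff_comp) auto
    finally show ?thesis by (simp add: g_def)
  qed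
  ultimately have "g = 0 \<or> degree g < degree p" by (rule eq_zero_or_degree_less)
  then have "g = 0 \<or> degree g < n" using Suc.prems by (auto simp: g_def)
  then have "(\<Sum>j\<le>n. (-1) ^ j * real (n choose j) * poly g (real j)) = 0" by (rule Suc.IH)
  then show ?case
    unfolding alternating_binomial_sum_Suc by (simp add: g_def poly_pcompose add.commute)
qed auto

lemma poly_along_line:
  fixes q :: "real^'n \<Rightarrow> real"
  assumes "poly_of_degree_le l q"
  obtains P :: "real poly" where "degree P \<le> l" "\<And>\<tau>. poly P \<tau> = q (x + \<tau> *\<^sub>R v)"
proof -
  obtain c :: "('n \<Rightarrow> nat) \<Rightarrow> real" where
    c: "\<And>x. q x = (\<Sum>\<beta> | sum \<beta> UNIV \<le> l. c \<beta> * (\<Prod>i\<in>UNIV. x $ i ^ \<beta> i))"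
    using assms unfolding poly_of_degree_le_def by blast
  define P where "P = (\<Sum>\<beta> | sum \<beta> UNIV \<le> l. smult (c \<beta>) (\<Prod>i\<in>UNIV. [:x $ i, v $ i:] ^ \<beta> i))"
  have "degree P \<le> l"
    unfolding P_def
  proof (rule degree_sum_le)
    show "finite {\<beta> :: 'n \<Rightarrow> nat. sum \<beta> UNIV \<le> l}" by (rule finite_multiindices)
    fix \<beta> :: "'n \<Rightarrow> nat" assume \<beta>: "\<beta> \<in> {\<beta>. sum \<beta> UNIV \<le> l}"
    have "degree (smult (c \<beta>) (\<Prod>i\<in>UNIV. [:x $ i, v $ i:] ^ \<beta> i)) \<le> degree (\<Prod>i\<in>UNIV. [:x $ i, v $ i:] ^ \<beta> i)"
      by (rule degree_smult_le)
    also have "\<dots> \<le> sum (degree \<circ> (\<lambda>i. [:x $ i, v $ i:] ^ \<beta> i)) UNIV"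
      by (rule degree_prod_sum_le) simp
    also have "\<dots> \<le> sum \<beta> UNIV"
    proof (rule sum_mono)
      fix i :: 'n
      have "degree ([:x $ i, v $ i:] ^ \<beta> i) \<le> degree [:x $ i, v $ i:] * \<beta> i" by (rule degree_power_le)
      also have "\<dots> \<le> 1 * \<beta> i" by (rule mult_right_mono) auto
      finally show "(degree \<circ> (\<lambda>i. [:x $ i, v $ i:] ^ \<beta> i)) i \<le> \<beta> i" by simp
    qed
    finally show "degree (smult (c \<beta>) (\<Prod>i\<in>UNIV. [:x $ i, v $ i:] ^ \<beta> i)) \<le> l" using \<beta> by simp
  qed
  moreover have "poly P \<tau> = q (x + \<tau> *\<^sub>R v)" for \<tau>
    unfolding P_def c by (simp add: poly_sum poly_prod)
  ultimately show ?thesis by (rule that)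
qed

lemma continuous_on_poly_of_degree_le:
  fixes q :: "real^'n \<Rightarrow> real"
  assumes "poly_of_degree_le l q"
  shows "continuous_on S q"
proof -
  obtain c :: "('n \<Rightarrow> nat) \<Rightarrow> real" where
    c: "\<And>x. q x = (\<Sum>\<beta> | sum \<beta> UNIV \<le> l. c \<beta> * (\<Prod>i\<in>UNIV. x $ i ^ \<beta> i))"
    using assms unfolding poly_of_degree_le_def by blast
  have "q = (\<lambda>x. \<Sum>\<beta> | sum \<beta> UNIV \<le> l. c \<beta> * (\<Prod>i\<in>UNIV. x $ i ^ \<beta> i))" using c by blast
  then show ?thesis by (simp only:) (intro continuous_intros)
qed

text \<open>
The finite difference of order \<open>l + 1\<close> along the segment from \<open>x\<close> to \<open>y\<close> vanishes, which expresses the value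
at \<open>x\<close> by values at the points that divide the segment into \<open>l + 1\<close> equal parts.
\<close>

lemma poly_extrapolation:
  fixes q :: "real^'n \<Rightarrow> real"
  assumes "poly_of_degree_le l q"
  shows "\<bar>q x\<bar> \<le> (\<Sum>j=1..Suc l. real (Suc l choose j) * \<bar>q (x + (real j / real (Suc l)) *\<^sub>R (y - x))\<bar>)"
proof -
  obtain P where P: "degree P \<le> l" "\<And>\<tau>. poly P \<tau> = q (x + \<tau> *\<^sub>R ((1 / real (Suc l)) *\<^sub>R (y - x)))"
    using poly_along_line[OF assms] by blast
  have "(\<Sum>j\<le>Suc l. (-1) ^ j * real (Suc l choose j) * poly P (real j)) = 0"
    by (rule finite_difference_poly_eq_0) (use P(1) in auto)
  then have "poly P 0 + (\<Sum>j=1..Suc l. (-1) ^ j * real (Suc l choose j) * poly P (real j)) = 0"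
    by (simp only: atMost_atLeast0 sum.atLeast_Suc_atMost[of 0 "Suc l"] zero_le) simp
  then have "\<bar>q x\<bar> = \<bar>\<Sum>j=1..Suc l. (-1) ^ j * real (Suc l choose j) * poly P (real j)\<bar>"
    using P(2)[of 0] by (simp only: scaleR_zero_left add_0_right)
  also have "\<dots> \<le> (\<Sum>j=1..Suc l. \<bar>(-1) ^ j * real (Suc l choose j) * poly P (real j)\<bar>)"
    by (rule sum_abs)
  also have "\<dots> = (\<Sum>j=1..Suc l. real (Suc l choose j) * \<bar>q (x + (real j / real (Suc l)) *\<^sub>R (y - x))\<bar>)"
    by (intro sum.cong refl) (simp add: P(2) abs_mult power_abs)
  finally show ?thesis .
qed

text \<open>
The contraction towards a point \<open>x\<close> of a convex set maps the set into itself.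
\<close>

lemma nn_integral_contraction_le:
  fixes f :: "'a::euclidean_space \<Rightarrow> ennreal"
  assumes f: "f \<in> borel_measurable borel" and T: "convex T" "closed T" "x \<in> T" and \<tau>: "0 < \<tau>" "\<tau> \<le> 1"
  shows "(\<integral>\<^sup>+y. f (x + \<tau> *\<^sub>R (y - x)) * indicator T y \<partial>lborel)
    \<le> ennreal ((1 / \<tau>) ^ DIM('a)) * (\<integral>\<^sup>+y. f y * indicator T y \<partial>lborel)"
proof -
  let ?g = "\<lambda>y. (x - \<tau> *\<^sub>R x) + \<tau> *\<^sub>R y"
  have [measurable]: "f \<in> borel_measurable borel" "T \<in> sets borel" using f T by auto
  have "(\<integral>\<^sup>+y. f y * indicator T y \<partial>lborel)
    = (\<integral>\<^sup>+y. f y * indicator T y \<partial>(density (distr lborel borel ?g) (\<lambda>_. \<bar>\<tau>\<bar> ^ DIM('a))))"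
    using \<tau> by (subst lborel_affine[of \<tau> "x - \<tau> *\<^sub>R x"]) auto
  also have "\<dots> = (\<integral>\<^sup>+y. ennreal (\<tau> ^ DIM('a)) * (f (?g y) * indicator T (?g y)) \<partial>lborel)"
    using \<tau> by (simp add: nn_integral_density nn_integral_distr)
  also have "\<dots> = ennreal (\<tau> ^ DIM('a)) * (\<integral>\<^sup>+y. f (?g y) * indicator T (?g y) \<partial>lborel)"
    by (rule nn_integral_cmult) simp
  finally have eq: "ennreal ((1 / \<tau>) ^ DIM('a)) * (\<integral>\<^sup>+y. f y * indicator T y \<partial>lborel)
    = (\<integral>\<^sup>+y. f (?g y) * indicator T (?g y) \<partial>lborel)"
    using \<tau> by (simp add: mult.assoc[symmetric] ennreal_mult[symmetric] power_mult_distrib[symmetric])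
  have "(\<integral>\<^sup>+y. f (x + \<tau> *\<^sub>R (y - x)) * indicator T y \<partial>lborel)
    \<le> (\<integral>\<^sup>+y. f (?g y) * indicator T (?g y) \<partial>lborel)"
  proof (rule nn_integral_mono)
    fix y :: 'a
    have g: "?g y = x + \<tau> *\<^sub>R (y - x)" by (simp add: algebra_simps)
    have "?g y \<in> T" if "y \<in> T"
      using convexD_alt[OF T(1) T(3) that, of \<tau>] \<tau> by (simp add: algebra_simps)
    then show "f (x + \<tau> *\<^sub>R (y - x)) * indicator T y \<le> f (?g y) * indicator T (?g y)"
      unfolding g by (auto split: split_indicator)
  qed
  then show ?thesis unfolding eq .
qed

text \<open>
Averaging the extrapolation formula over \<open>y\<close> bounds the value at \<open>x\<close> by integrals over contracted copies of
\<open>T\<close>. The contraction factors are at least \<open>1 / (l + 1)\<close>, so the constant does not depend on the shape of \<open>T\<close>.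
\<close>

lemma poly_sup_le_integral:
  fixes q :: "real^'n \<Rightarrow> real"
  assumes q: "poly_of_degree_le l q" and T: "convex T" "compact T" "x \<in> T"
  shows "\<bar>q x\<bar> * measure lebesgue T \<le> 2 ^ Suc l * real (Suc l) ^ CARD('n) * (LINT y:T|lebesgue. \<bar>q y\<bar>)"
proof -
  have cl: "closed T" using T compact_imp_closed by blast
  have cont: "continuous_on S q" for S by (rule continuous_on_poly_of_degree_le[OF q])
  have qb [measurable]: "q \<in> borel_measurable borel" using cont by (rule borel_measurable_continuous_onI)
  have Tb [measurable]: "T \<in> sets borel" using cl by simp
  let ?I = "\<integral>\<^sup>+y. ennreal \<bar>q y\<bar> * indicator T y \<partial>lborel"
  let ?d = "CARD('n)"
  have step: "(\<integral>\<^sup>+y. ennreal \<bar>q (x + (real j / real (Suc l)) *\<^sub>R (y - x))\<bar> * indicator T y \<partial>lborel)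
      \<le> ennreal (real (Suc l) ^ ?d) * ?I" if j: "j \<in> {1..Suc l}" for j
  proof -
    have "(\<integral>\<^sup>+y. ennreal \<bar>q (x + (real j / real (Suc l)) *\<^sub>R (y - x))\<bar> * indicator T y \<partial>lborel)
      \<le> ennreal ((1 / (real j / real (Suc l))) ^ DIM(real^'n)) * ?I"
      by (rule nn_integral_contraction_le[where f = "\<lambda>y. ennreal \<bar>q y\<bar>"]) (use j T cl in auto)
    also have "\<dots> \<le> ennreal (real (Suc l) ^ ?d) * ?I"
    proof (intro mult_right_mono ennreal_leI)
      have "1 / (real j / real (Suc l)) \<le> real (Suc l)" using j by (simp add: divide_le_eq mult_le_cancel_left1)
      then show "(1 / (real j / real (Suc l))) ^ DIM(real^'n) \<le> real (Suc l) ^ ?d"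
        by (simp only: DIM_cart DIM_real mult_1_right) (rule power_mono, auto)
    qed simp
    finally show ?thesis .
  qed
  have "ennreal \<bar>q x\<bar> * emeasure lborel T = (\<integral>\<^sup>+y. ennreal \<bar>q x\<bar> * indicator T y \<partial>lborel)"
    by (simp add: nn_integral_cmult_indicator)
  also have "\<dots> \<le> (\<integral>\<^sup>+y. (\<Sum>j=1..Suc l. ennreal (real (Suc l choose j)) *
        (ennreal \<bar>q (x + (real j / real (Suc l)) *\<^sub>R (y - x))\<bar> * indicator T y)) \<partial>lborel)"
  proof (rule nn_integral_mono)
    fix y :: "real^'n"
    have "ennreal \<bar>q x\<bar> \<le> ennreal (\<Sum>j=1..Suc l. real (Suc l choose j) * \<bar>q (x + (real j / real (Suc l)) *\<^sub>R (y - x))\<bar>)"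
      by (rule ennreal_leI[OF poly_extrapolation[OF q]])
    also have "\<dots> = (\<Sum>j=1..Suc l. ennreal (real (Suc l choose j)) * ennreal \<bar>q (x + (real j / real (Suc l)) *\<^sub>R (y - x))\<bar>)"
      by (subst sum_ennreal[symmetric]) (auto simp: ennreal_mult)
    finally show "ennreal \<bar>q x\<bar> * indicator T y \<le> (\<Sum>j=1..Suc l. ennreal (real (Suc l choose j)) *
        (ennreal \<bar>q (x + (real j / real (Suc l)) *\<^sub>R (y - x))\<bar> * indicator T y))"
      by (auto split: split_indicator)
  qed
  also have "\<dots> = (\<Sum>j=1..Suc l. ennreal (real (Suc l choose j)) *
        (\<integral>\<^sup>+y. ennreal \<bar>q (x + (real j / real (Suc l)) *\<^sub>R (y - x))\<bar> * indicator T y \<partial>lborel))"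
    by (subst nn_integral_sum) (auto intro!: sum.cong nn_integral_cmult)
  also have "\<dots> \<le> (\<Sum>j=1..Suc l. ennreal (real (Suc l choose j)) * (ennreal (real (Suc l) ^ ?d) * ?I))"
    by (intro sum_mono mult_left_mono step) auto
  also have "\<dots> = (\<Sum>j=1..Suc l. ennreal (real (Suc l choose j))) * (ennreal (real (Suc l) ^ ?d) * ?I)"
    by (rule sum_distrib_right[symmetric])
  also have "\<dots> \<le> ennreal (2 ^ Suc l) * (ennreal (real (Suc l) ^ ?d) * ?I)"
  proof (intro mult_right_mono)
    have "(\<Sum>j=1..Suc l. Suc l choose j) \<le> (\<Sum>j\<le>Suc l. Suc l choose j)"
      by (rule sum_mono2) auto
    also have "\<dots> = 2 ^ Suc l" by (rule choose_row_sum)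
    finally have "real (\<Sum>j=1..Suc l. Suc l choose j) \<le> real (2 ^ Suc l)" by (rule of_nat_mono)
    then have "(\<Sum>j=1..Suc l. real (Suc l choose j)) \<le> 2 ^ Suc l" by simp
    moreover have "(\<Sum>j=1..Suc l. ennreal (real (Suc l choose j))) = ennreal (\<Sum>j=1..Suc l. real (Suc l choose j))"
      by (rule sum_ennreal) simp
    ultimately show "(\<Sum>j=1..Suc l. ennreal (real (Suc l choose j))) \<le> ennreal (2 ^ Suc l)"
      by (simp only: ennreal_leI)
  qed simp
  finally have main: "ennreal \<bar>q x\<bar> * emeasure lborel T \<le> ennreal (2 ^ Suc l) * (ennreal (real (Suc l) ^ ?d) * ?I)" .
  have Tl: "T \<in> lmeasurable" using T(2) by (rule lmeasurable_compact)
  have int: "set_integrable lborel T (\<lambda>y. \<bar>q y\<bar>)"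
    unfolding set_integrable_def
    by (rule borel_integrable_compact) (use T cont in \<open>auto intro!: continuous_intros\<close>)
  have "?I = (\<integral>\<^sup>+y. ennreal (indicator T y * \<bar>q y\<bar>) \<partial>lborel)"
    by (intro nn_integral_cong) (auto split: split_indicator)
  also have "\<dots> = ennreal (LINT y|lborel. indicator T y * \<bar>q y\<bar>)"
    by (rule nn_integral_eq_integral) (use int in \<open>auto simp: set_integrable_def\<close>)
  also have "(LINT y|lborel. indicator T y * \<bar>q y\<bar>) = (LINT y:T|lebesgue. \<bar>q y\<bar>)"
    unfolding set_lebesgue_integral_def by (subst integral_completion) auto
  finally have I: "?I = ennreal (LINT y:T|lebesgue. \<bar>q y\<bar>)" .
  have I0: "0 \<le> (LINT y:T|lebesgue. \<bar>q y\<bar>)"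
    unfolding set_lebesgue_integral_def by (rule integral_nonneg_AE) auto
  have "emeasure lborel T = ennreal (measure lebesgue T)"
    using emeasure_eq_measure2[OF Tl] Tb by simp
  then have "ennreal (\<bar>q x\<bar> * measure lebesgue T) \<le> ennreal (2 ^ Suc l * real (Suc l) ^ ?d * (LINT y:T|lebesgue. \<bar>q y\<bar>))"
    using main I0 unfolding I by (simp add: ennreal_mult mult.assoc)
  then show ?thesis using I0 by (subst (asm) ennreal_le_iff) auto
qed

section \<open>Simplices and inscribed balls\<close>

text \<open>
The simplex lies between the hyperplane through the facet opposite to \<open>u\<close> and the parallel hyperplane through
\<open>u\<close>. The facet contains \<open>w\<close>, hence the width of this slab is at most the length of the edge from \<open>u\<close> to
\<open>w\<close>.
\<close>

lemma inscribed_ball_le_edge: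
  fixes C :: "'a::euclidean_space set"
  assumes C: "\<not> affine_dependent C" "int (card C) = DIM('a) + 1"
    and uw: "u \<in> C" "w \<in> C" "u \<noteq> w"
    and ball: "ball x r \<subseteq> convex hull C"
  shows "2 * r \<le> dist u w"
proof -
  have fin: "finite C"
    using C aff_independent_finite by blast
  have indep: "\<not> affine_dependent (C - {u})"
    using C affine_independent_Diff by blast
  have "aff_dim (C - {u}) = int DIM('a) - 1"
    using aff_dim_affine_independent[OF indep] C(2) uw fin
    by (simp add: card_Diff_singleton card_gt_0_iff of_nat_diff)
  then obtain a0 b0 where ab0: "a0 \<noteq> 0" "affine hull (C - {u}) = {y. a0 \<bullet> y = b0}"
    using aff_dim_eq_hyperplane[of "C - {u}"] by auto
  have "u \<notin> affine hull (C - {u})"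
    using C(1) uw(1) unfolding affine_dependent_def by auto
  then have "a0 \<bullet> u \<noteq> b0"
    using ab0 by auto
  have facet: "a0 \<bullet> y = b0" if "y \<in> C - {u}" for y
    using ab0 that hull_inc[of y "C - {u}" affine] by auto
  obtain a b where a: "a \<noteq> 0" and ab: "\<And>y. y \<in> C - {u} \<Longrightarrow> a \<bullet> y = b" and u: "b < a \<bullet> u"
  proof (cases "b0 < a0 \<bullet> u")
    case True
    then show ?thesis using that ab0 facet by blast
  next
    case False
    show ?thesis
      by (rule that[of "- a0" "- b0"]) (use False ab0 facet \<open>a0 \<bullet> u \<noteq> b0\<close> in auto)
  qed
  have "C \<subseteq> {y. b \<le> a \<bullet> y} \<inter> {y. a \<bullet> y \<le> a \<bullet> u}"
    using ab u by fastforce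
  moreover have "convex ({y. b \<le> a \<bullet> y} \<inter> {y. a \<bullet> y \<le> a \<bullet> u})"
    using convex_halfspace_ge[of b a] convex_halfspace_le[of a "a \<bullet> u"]
    by (intro convex_Int) simp_all
  ultimately have slab: "convex hull C \<subseteq> {y. b \<le> a \<bullet> y} \<inter> {y. a \<bullet> y \<le> a \<bullet> u}"
    by (rule hull_minimal)
  have na: "norm a > 0" using a by simp
  have au: "a \<bullet> u - b \<le> norm a * dist u w"
  proof -
    have "a \<bullet> u - b = a \<bullet> (u - w)"
      using ab[of w] uw by (simp add: inner_diff_right)
    also have "\<dots> \<le> norm a * norm (u - w)"
      by (rule norm_cauchy_schwarz)
    finally show ?thesis by (simp add: dist_norm)
  qed
  show ?thesis
  proof (cases "r > 0")
    case True
    show ?thesis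
    proof (rule dense_le_bounded[of 0])
      show "0 < 2 * r" using True by simp
      fix t assume t: "0 < t" "t < 2 * r"
      let ?v = "(t / (2 * norm a)) *\<^sub>R a"
      have av: "a \<bullet> ?v = t * norm a / 2"
        using na by (simp add: power2_norm_eq_inner[symmetric] power2_eq_square)
      have "norm ?v = t / 2" using na t by simp
      then have "x + ?v \<in> ball x r" "x - ?v \<in> ball x r"
        using t by (auto simp: dist_norm)
      then have "a \<bullet> (x + ?v) \<le> a \<bullet> u" "b \<le> a \<bullet> (x - ?v)"
        using ball slab by blast+
      then have "t * norm a \<le> a \<bullet> u - b"
        unfolding inner_add_right inner_diff_right av by linarith
      with au have "t * norm a \<le> dist u w * norm a"
        by (simp add: mult.commute)
      with na show "t \<le> dist u w" by simp
    qed
  next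
    case False
    then show ?thesis by (smt (verit) zero_le_dist)
  qed
qed

lemma full_simplex_interior_nonempty:
  fixes T :: "'a::euclidean_space set"
  assumes "int DIM('a) simplex T"
  shows "interior T \<noteq> {}"
proof -
  have "affine hull T = UNIV"
    using aff_dim_simplex[OF assms] aff_dim_eq_full by auto
  moreover have "T \<noteq> {}" using assms by auto
  ultimately show ?thesis
    using rel_interior_interior rel_interior_eq_empty convex_simplex[OF assms] by metis
qed

lemma full_simplex_inball_ne:
  fixes T :: "'a::euclidean_space set"
  assumes "int DIM('a) simplex T"
  shows "{diameter (ball x r) |x r. 0 < r \<and> ball x r \<subseteq> T} \<noteq> {}"
proof -
  obtain x where "x \<in> interior T" using full_simplex_interior_nonempty[OF assms] by auto
  then obtain r where "r > 0" "ball x r \<subseteq> T"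
    using mem_interior by blast
  then show ?thesis by blast
qed

lemma inball_diameter_le_edge:
  fixes C :: "'a::euclidean_space set"
  assumes C: "\<not> affine_dependent C" "int (card C) = DIM('a) + 1"
    and uw: "u \<in> C" "w \<in> C" "u \<noteq> w"
  shows "inball_diameter (convex hull C) \<le> dist u w"
proof -
  have "int DIM('a) simplex (convex hull C)"
    using C by (intro simplex_convex_hull) auto
  from full_simplex_inball_ne[OF this] show ?thesis
    unfolding inball_diameter_def
    by (rule cSup_least) (use inscribed_ball_le_edge[OF C uw] in auto)
qed

lemma inball_diameter_pos:
  fixes T :: "'a::euclidean_space set"
  assumes T: "int DIM('a) simplex T"
  shows "0 < inball_diameter T"
proof -
  let ?S = "{diameter (ball x r) |x r. 0 < r \<and> ball x r \<subseteq> T}"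
  have bT: "bounded T" using T compact_simplex compact_imp_bounded by blast
  have "bdd_above ?S"
  proof (rule bdd_aboveI[of _ "diameter T"])
    fix d assume "d \<in> ?S"
    then show "d \<le> diameter T" using diameter_subset[OF _ bT] by blast
  qed
  moreover obtain d where "d \<in> ?S" using full_simplex_inball_ne[OF T] by auto
  moreover have "d > 0" using \<open>d \<in> ?S\<close> by auto
  ultimately show ?thesis
    unfolding inball_diameter_def by (meson cSup_upper less_le_trans)
qed

lemma full_simplex_diameter_pos:
  fixes T :: "'a::euclidean_space set"
  assumes T: "int DIM('a) simplex T"
  shows "0 < diameter T"
proof -
  obtain x r where "r > 0" "ball x r \<subseteq> T"
    using full_simplex_inball_ne[OF T] by auto
  moreover have "bounded T" using T compact_simplex compact_imp_bounded by blast
  ultimately have "2 * r \<le> diameter T"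
    using diameter_subset[of "ball x r" T] by simp
  with \<open>r > 0\<close> show ?thesis by linarith
qed

text \<open>
The supremum in \<open>inball_diameter\<close> need not be attained; giving away a factor \<open>2\<close> yields a ball.
\<close>

lemma shape_regular_inscribed_ball:
  fixes T :: "'a::euclidean_space set"
  assumes T: "int DIM('a) simplex T" and W: "diameter T / inball_diameter T \<le> W"
  obtains x where "ball x (diameter T / (4 * W)) \<subseteq> T" "x \<in> T"
proof -
  let ?S = "{diameter (ball x r) |x r. 0 < r \<and> ball x r \<subseteq> T}"
  have p: "0 < inball_diameter T" "0 < diameter T"
    using inball_diameter_pos[OF T] full_simplex_diameter_pos[OF T] by auto
  then have "0 < diameter T / inball_diameter T" by simp
  with W have W0: "W > 0" by linarith
  have "diameter T \<le> W * inball_diameter T"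
    using W p by (simp add: pos_divide_le_eq)
  then have "diameter T / W \<le> inball_diameter T"
    using W0 by (simp add: pos_divide_le_eq mult.commute)
  moreover have "diameter T / (2 * W) < diameter T / W"
    using p W0 by (simp add: field_simps)
  ultimately have "diameter T / (2 * W) < Sup ?S"
    unfolding inball_diameter_def by linarith
  then obtain x r where r: "0 < r" "ball x r \<subseteq> T" "diameter T / (2 * W) < diameter (ball x r)"
    using less_cSupE[OF _ full_simplex_inball_ne[OF T]] by blast
  then have "diameter T / (4 * W) \<le> r" by (simp add: field_simps)
  with r show ?thesis by (intro that[of x]) (auto dest: subset_ball)
qed

text \<open>
A common face with two points contains a common edge, which is at least as long as the inscribed balls of
\<open>T\<close> are wide and at most as long as the diameter of \<open>T'\<close>.
\<close>

lemma shape_regular_meets_in_edge: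
  fixes T T' :: "'a::euclidean_space set"
  assumes T: "int DIM('a) simplex T" and W: "diameter T / inball_diameter T \<le> W"
    and face: "T \<inter> T' face_of T" and xy: "x \<in> T \<inter> T'" "y \<in> T \<inter> T'" "x \<noteq> y"
    and T': "bounded T'"
  shows "diameter T \<le> W * diameter T'"
proof -
  obtain C where C: "\<not> affine_dependent C" "int (card C) = DIM('a) + 1" "T = convex hull C"
    using T unfolding simplex_def by auto
  obtain C' where C': "C' \<subseteq> C" "T \<inter> T' = convex hull C'"
    using face_of_convex_hull_subset[of C "T \<inter> T'"] face C aff_independent_finite finite_imp_compact
    by metis
  have "\<exists>u\<in>C'. \<exists>w\<in>C'. u \<noteq> w"
  proof (rule ccontr)
    assume "\<not> ?thesis"
    then have "C' = {} \<or> (\<exists>u. C' = {u})" by blast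
    then show False using xy C' by auto
  qed
  then obtain u w where uw: "u \<in> C'" "w \<in> C'" "u \<noteq> w" by blast
  have "u \<in> T'" "w \<in> T'" using C' uw hull_inc by fastforce+
  then have "dist u w \<le> diameter T'"
    using diameter_bounded_bound[OF T'] by auto
  moreover have "inball_diameter T \<le> dist u w"
    unfolding C(3) by (rule inball_diameter_le_edge[OF C(1,2)]) (use uw C' in auto)
  ultimately have *: "inball_diameter T \<le> diameter T'" by simp
  have p: "0 < inball_diameter T" "0 < diameter T"
    using inball_diameter_pos[OF T] full_simplex_diameter_pos[OF T] by auto
  then have "0 < diameter T / inball_diameter T" by simp
  with W have W0: "W > 0" by linarith
  have "diameter T \<le> W * inball_diameter T"
    using W p by (simp add: pos_divide_le_eq)
  also have "\<dots> \<le> W * diameter T'" using * W0 by simp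
  finally show ?thesis .
qed

lemma card_disjoint_balls_le:
  fixes c :: "'i \<Rightarrow> 'a::euclidean_space"
  assumes "finite I" "0 < \<rho>" "0 < R"
    and disj: "disjoint_family_on (\<lambda>i. ball (c i) \<rho>) I"
    and sub: "\<And>i. i \<in> I \<Longrightarrow> ball (c i) \<rho> \<subseteq> cball x R"
  shows "real (card I) \<le> (R / \<rho>) ^ DIM('a)"
proof -
  let ?u = "unit_ball_vol (DIM('a))"
  have "real (card I) * (?u * \<rho> ^ DIM('a)) = (\<Sum>i\<in>I. measure lborel (ball (c i) \<rho>))"
    using \<open>0 < \<rho>\<close> by (simp add: content_ball)
  also have "\<dots> = measure lborel (\<Union>i\<in>I. ball (c i) \<rho>)"
    by (rule measure_finite_Union[symmetric])
      (use \<open>finite I\<close> disj \<open>0 < \<rho>\<close> in \<open>auto simp: emeasure_ball\<close>)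
  also have "\<dots> \<le> measure lborel (cball x R)"
  proof (rule measure_mono_fmeasurable)
    show "(\<Union>i\<in>I. ball (c i) \<rho>) \<subseteq> cball x R" using sub by blast
    show "(\<Union>i\<in>I. ball (c i) \<rho>) \<in> sets lborel" by (simp add: open_UN)
    show "cball x R \<in> fmeasurable lborel"
      by (rule fmeasurableI) (simp_all add: emeasure_cball less_imp_le[OF \<open>0 < R\<close>])
  qed
  also have "\<dots> = ?u * R ^ DIM('a)"
    using \<open>0 < R\<close> by (simp add: content_cball)
  finally have "(real (card I) * \<rho> ^ DIM('a)) * ?u \<le> R ^ DIM('a) * ?u"
    by (simp add: ac_simps)
  then have "real (card I) * \<rho> ^ DIM('a) \<le> R ^ DIM('a)"
    by simp
  then show ?thesis
    using \<open>0 < \<rho>\<close> by (simp add: power_divide pos_le_divide_eq)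
qed

lemma simplices_disjoint_balls:
  fixes T T' :: "'a::euclidean_space set"
  assumes "T \<inter> T' face_of T" "T \<inter> T' face_of T'" "T \<noteq> T'" "ball x r \<subseteq> T" "ball y s \<subseteq> T'"
  shows "ball x r \<inter> ball y s = {}"
proof (rule ccontr)
  assume ne: "\<not> ?thesis"
  have "ball x r \<subseteq> interior T" "ball y s \<subseteq> interior T'"
    by (rule interior_maximal[OF assms(4) open_ball], rule interior_maximal[OF assms(5) open_ball])
  with ne have "T \<inter> T' \<inter> interior T \<noteq> {}" "T \<inter> T' \<inter> interior T' \<noteq> {}"
    using interior_subset by blast+
  then have "T \<inter> T' = T" "T \<inter> T' = T'"
    using face_of_disjoint_interior assms by blast+
  with assms show False by auto
qed

section \<open>The boundary of a Lipschitz domain\<close>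

text \<open>
Coordinates along and across the direction \<open>e\<close> for the graph in \<open>lipschitz_domain\<close>.
\<close>

lemma lipschitz_graph_coordinates:
  fixes e :: "'a::euclidean_space" and \<zeta> :: "'a \<Rightarrow> real"
  assumes e: "norm e = 1" and \<zeta>: "L-lipschitz_on {y. y \<bullet> e = 0} \<zeta>"
  defines "pr \<equiv> \<lambda>y. y - (y \<bullet> e) *\<^sub>R e"
  shows "pr (y + t *\<^sub>R e) = pr y" and "(y + t *\<^sub>R e) \<bullet> e = y \<bullet> e + t"
    and "\<bar>\<zeta> (pr x) - \<zeta> (pr y)\<bar> \<le> L * dist x y"
    and "continuous_on UNIV (\<lambda>y. \<zeta> (pr y))"
proof -
  have ee: "e \<bullet> e = 1" using e by (simp add: norm_eq_1)
  show "pr (y + t *\<^sub>R e) = pr y" "(y + t *\<^sub>R e) \<bullet> e = y \<bullet> e + t" for y t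
    unfolding pr_def by (simp_all add: inner_add_left ee algebra_simps)
  have mem: "pr y \<in> {y. y \<bullet> e = 0}" for y
    unfolding pr_def by (simp add: inner_diff_left ee)
  have prd: "dist (pr x) (pr y) \<le> dist x y" for x y
  proof -
    let ?d = "x - y"
    have "pr x - pr y = ?d - (?d \<bullet> e) *\<^sub>R e"
      unfolding pr_def by (simp add: inner_diff_left algebra_simps)
    moreover have "(norm (?d - (?d \<bullet> e) *\<^sub>R e))\<^sup>2 = (norm ?d)\<^sup>2 - (?d \<bullet> e)\<^sup>2"
      unfolding power2_norm_eq_inner
      by (simp add: inner_diff_left[of "x - y"] inner_diff_right[of _ "x - y"] ee
          inner_commute[of e "x - y"] power2_eq_square)
    ultimately have "(norm (pr x - pr y))\<^sup>2 \<le> (norm ?d)\<^sup>2" by simp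
    then show ?thesis unfolding dist_norm by (rule power2_le_imp_le) simp
  qed
  have L: "0 \<le> L" using \<zeta> by (rule lipschitz_on_nonneg)
  show lip: "\<bar>\<zeta> (pr x) - \<zeta> (pr y)\<bar> \<le> L * dist x y" for x y
  proof -
    have "\<bar>\<zeta> (pr x) - \<zeta> (pr y)\<bar> \<le> L * dist (pr x) (pr y)"
      using lipschitz_onD[OF \<zeta> mem mem, of x y] by (simp add: dist_real_def)
    also have "\<dots> \<le> L * dist x y" by (rule mult_left_mono[OF prd L])
    finally show ?thesis .
  qed
  have "L-lipschitz_on UNIV (\<lambda>y. \<zeta> (pr y))"
    by (rule lipschitz_onI) (use lip L in \<open>auto simp: dist_real_def\<close>)
  then show "continuous_on UNIV (\<lambda>y. \<zeta> (pr y))"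
    by (rule lipschitz_on_continuous_on)
qed

text \<open>
The graph passes through the boundary point, and points strictly below it are exterior; \<open>f\<close> is the graph function
extended constantly in the direction \<open>e\<close>.
\<close>

lemma lipschitz_domain_boundary_graph:
  fixes \<Omega> :: "'a::euclidean_space set"
  assumes dom: "lipschitz_domain \<Omega>" and x0: "x0 \<in> frontier \<Omega>"
  obtains e r L and f :: "'a \<Rightarrow> real" where "norm e = 1" "0 < r" "0 \<le> L"
    "\<And>x y. \<bar>f x - f y\<bar> \<le> L * dist x y" "\<And>y t. f (y + t *\<^sub>R e) = f y"
    "\<And>y t. (y + t *\<^sub>R e) \<bullet> e = y \<bullet> e + t"
    "continuous_on UNIV f" "\<And>x. x \<in> ball x0 r \<Longrightarrow> x \<in> \<Omega> \<longleftrightarrow> f x < x \<bullet> e" "f x0 = x0 \<bullet> e"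
    "\<And>x. x \<in> ball x0 r \<Longrightarrow> x \<bullet> e < f x \<Longrightarrow> x \<notin> closure \<Omega>"
proof -
  obtain e r L \<zeta> where e: "norm e = 1" and r: "0 < r" and \<zeta>: "L-lipschitz_on {y. y \<bullet> e = 0} \<zeta>"
    and eq: "\<And>x. x \<in> ball x0 r \<Longrightarrow> x \<in> \<Omega> \<longleftrightarrow> \<zeta> (x - (x \<bullet> e) *\<^sub>R e) < x \<bullet> e"
    using dom x0 unfolding lipschitz_domain_def by blast
  define f where "f = (\<lambda>y. \<zeta> (y - (y \<bullet> e) *\<^sub>R e))"
  note gc = lipschitz_graph_coordinates[OF e \<zeta>, folded f_def]
  have below: "x \<notin> closure \<Omega>" if "x \<in> ball x0 r" "x \<bullet> e < f x" for x
  proof -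
    let ?V = "ball x0 r \<inter> {y. y \<bullet> e < f y}"
    have "open ?V"
      using gc(4) by (intro open_Int open_ball open_Collect_less continuous_intros) (simp add: f_def)
    moreover have "?V \<inter> \<Omega> = {}" using eq by (force simp: f_def)
    ultimately have "?V \<inter> closure \<Omega> = {}" by (simp add: open_Int_closure_eq_empty)
    then show ?thesis using that by auto
  qed
  have op: "open \<Omega>" using dom by (simp add: lipschitz_domain_def)
  have "x0 \<notin> \<Omega>" "x0 \<in> closure \<Omega>"
    using x0 op by (auto simp: frontier_def interior_open)
  then have "f x0 = x0 \<bullet> e"
    using eq[of x0] below[of x0] r by (force simp: f_def)
  moreover have "f (y + t *\<^sub>R e) = f y" for y t
    unfolding f_def gc(1) ..
  moreover have "\<bar>f x - f y\<bar> \<le> L * dist x y" for x y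
    unfolding f_def by (rule gc(3))
  moreover have "continuous_on UNIV f"
    using gc(4) by (simp add: f_def)
  moreover have "x \<in> \<Omega> \<longleftrightarrow> f x < x \<bullet> e" if "x \<in> ball x0 r" for x
    unfolding f_def by (rule eq[OF that])
  ultimately show ?thesis
    using that[OF e r lipschitz_on_nonneg[OF \<zeta>], of f] gc(2) below by blast
qed

text \<open>
A Lipschitz domain lies on one side of its boundary: arbitrarily close to a boundary point there are exterior points,
directly below the graph. Consequently the interior of every element of a mesh lies in the domain.
\<close>

lemma interior_closure_lipschitz_domain:
  fixes \<Omega> :: "'a::euclidean_space set"
  assumes dom: "lipschitz_domain \<Omega>"
  shows "interior (closure \<Omega>) = \<Omega>"
proof
  have op: "open \<Omega>" using dom by (simp add: lipschitz_domain_def)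
  show "\<Omega> \<subseteq> interior (closure \<Omega>)"
    by (rule interior_maximal[OF closure_subset op])
  show "interior (closure \<Omega>) \<subseteq> \<Omega>"
  proof
    fix x0 assume x0: "x0 \<in> interior (closure \<Omega>)"
    show "x0 \<in> \<Omega>"
    proof (rule ccontr)
      assume "x0 \<notin> \<Omega>"
      then have "x0 \<in> frontier \<Omega>"
        using x0 interior_subset op by (auto simp: frontier_def interior_open)
      then obtain e r L and f :: "'a \<Rightarrow> real" where e: "norm e = 1" and r: "0 < r"
        and f: "\<And>y t. f (y + t *\<^sub>R e) = f y" "\<And>y t. (y + t *\<^sub>R e) \<bullet> e = y \<bullet> e + t"
        and fx: "f x0 = x0 \<bullet> e"
        and below: "\<And>x. x \<in> ball x0 r \<Longrightarrow> x \<bullet> e < f x \<Longrightarrow> x \<notin> closure \<Omega>"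
        using lipschitz_domain_boundary_graph[OF dom] by metis
      obtain s where s: "s > 0" "ball x0 s \<subseteq> closure \<Omega>"
        using x0 mem_interior by blast
      define \<tau> where "\<tau> = min r s / 2"
      have \<tau>: "0 < \<tau>" "\<tau> < r" "\<tau> < s" using r s by (auto simp: \<tau>_def)
      let ?y = "x0 + (-\<tau>) *\<^sub>R e"
      have d: "dist x0 ?y = \<tau>" using e \<tau> by (simp add: dist_norm)
      have "?y \<bullet> e < f ?y" unfolding f fx using \<tau> by simp
      moreover have "?y \<in> ball x0 r" unfolding mem_ball d by (rule \<tau>)
      ultimately have "?y \<notin> closure \<Omega>" using below by blast
      moreover have "?y \<in> closure \<Omega>" using s d \<tau> by (metis mem_ball subsetD)
      ultimately show False by blast
    qed
  qed
qed

text \<open>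
Around an interior point one takes a punctured ball. At a boundary point, every nearby point of the domain is joined
to one common point above the graph, first by a vertical segment and then by a segment at that height; neither meets
the graph, and \<open>x0\<close> itself is not in the domain.
\<close>

lemma lipschitz_domain_locally_connected_punctured:
  fixes \<Omega> :: "'a::euclidean_space set"
  assumes dom: "lipschitz_domain \<Omega>" and dim: "2 \<le> DIM('a)" and x0: "x0 \<in> closure \<Omega>" and \<epsilon>: "0 < \<epsilon>"
  obtains \<eta> U where "0 < \<eta>" "connected U" "\<Omega> \<inter> ball x0 \<eta> - {x0} \<subseteq> U" "U \<subseteq> \<Omega> \<inter> ball x0 \<epsilon> - {x0}"
proof (cases "x0 \<in> \<Omega>")
  case True
  have "open \<Omega>" using dom by (simp add: lipschitz_domain_def)
  then obtain r where r: "r > 0" "ball x0 r \<subseteq> \<Omega>" using True openE by blast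
  show ?thesis
  proof (rule that[of "min r \<epsilon>" "ball x0 (min r \<epsilon>) - {x0}"])
    show "connected (ball x0 (min r \<epsilon>) - {x0})" by (rule connected_punctured_ball[OF dim])
  qed (use r \<epsilon> in auto)
next
  case False
  have "open \<Omega>" using dom by (simp add: lipschitz_domain_def)
  with False x0 have "x0 \<in> frontier \<Omega>" by (simp add: frontier_def interior_open)
  then obtain e r L and f :: "'a \<Rightarrow> real" where e: "norm e = 1" and r: "0 < r" and L: "0 \<le> L"
    and lip: "\<And>x y. \<bar>f x - f y\<bar> \<le> L * dist x y"
    and f: "\<And>y t. f (y + t *\<^sub>R e) = f y" "\<And>y t. (y + t *\<^sub>R e) \<bullet> e = y \<bullet> e + t"
    and mem: "\<And>x. x \<in> ball x0 r \<Longrightarrow> x \<in> \<Omega> \<longleftrightarrow> f x < x \<bullet> e" and fx: "f x0 = x0 \<bullet> e"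
    using lipschitz_domain_boundary_graph[OF dom] by metis
  \<comment> \<open>Going up by \<open>K * \<eta>\<close> clears the graph over the ball of radius \<open>\<eta>\<close>, where it rises by at most \<open>L * \<eta>\<close>.\<close>
  define K where "K = 2 + L"
  define \<eta> where "\<eta> = min r \<epsilon> / (K + 2)"
  have K: "K \<ge> 2" using L by (simp add: K_def)
  have \<eta>0: "0 < \<eta>" using r \<epsilon> K by (simp add: \<eta>_def)
  have \<eta>: "(K + 1) * \<eta> < r" "(K + 1) * \<eta> < \<epsilon>"
  proof -
    have "(K + 2) * \<eta> = min r \<epsilon>" using K by (simp add: \<eta>_def)
    moreover have "(K + 1) * \<eta> < (K + 2) * \<eta>" using \<eta>0 by simp
    ultimately show "(K + 1) * \<eta> < r" "(K + 1) * \<eta> < \<epsilon>" by auto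
  qed
  define s where "s = K * \<eta>"
  have s: "0 < s" using K \<eta>0 by (simp add: s_def)
  let ?top = "x0 + s *\<^sub>R e"
  define path where "path x = closed_segment x (x + s *\<^sub>R e) \<union> closed_segment (x + s *\<^sub>R e) ?top" for x
  define U where "U = (\<Union>x\<in>\<Omega> \<inter> ball x0 \<eta>. path x)"
  have path: "path x \<subseteq> \<Omega> \<inter> ball x0 \<epsilon> - {x0}" if x: "x \<in> \<Omega>" "dist x0 x < \<eta>" for x
  proof
    fix y assume "y \<in> path x"
    then consider t where "0 \<le> t" "t \<le> 1" "y = x + (t * s) *\<^sub>R e"
      | t where "0 \<le> t" "t \<le> 1" "y = (x0 + t *\<^sub>R (x - x0)) + s *\<^sub>R e"
      unfolding path_def closed_segment_def
    proof (elim UnE CollectE exE conjE, goal_cases)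
      case (1 u) then show ?thesis by (intro 1(1)[of u]) (auto simp: algebra_simps)
    next
      case (2 u) then show ?thesis by (intro 2(2)[of "1 - u"]) (auto simp: algebra_simps)
    qed
    then have "dist x0 y < (K + 1) * \<eta> \<and> f y < y \<bullet> e"
    proof cases
      case 1
      have "dist x0 y \<le> dist x0 x + dist x y" by (rule dist_triangle)
      also have "dist x y = t * s" using 1 e s by (simp add: dist_norm)
      also have "t * s \<le> s" using 1 s by (simp add: mult_left_le_one_le)
      finally have d: "dist x0 y < (K + 1) * \<eta>" using x by (simp add: s_def algebra_simps)
      have "dist x0 x < r"
        using x \<eta> K \<eta>0 by (smt (verit) mult_le_cancel_right1)
      then have "f x < x \<bullet> e" using mem[of x] x by simp
      moreover have "0 \<le> t * s" using 1 s by simp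
      ultimately have "f y < y \<bullet> e" unfolding 1(3) f by simp
      with d show ?thesis by simp
    next
      case 2
      let ?w = "x0 + t *\<^sub>R (x - x0)"
      have dw: "dist x0 ?w < \<eta>"
      proof -
        have "dist x0 ?w = t * dist x0 x" using 2 by (simp add: dist_norm norm_minus_commute)
        also have "\<dots> \<le> dist x0 x" using 2 by (simp add: mult_left_le_one_le)
        finally show ?thesis using x by simp
      qed
      have "dist x0 y \<le> dist x0 ?w + dist ?w y" by (rule dist_triangle)
      also have "dist ?w y = s" using 2 e s by (simp add: dist_norm)
      finally have d: "dist x0 y < (K + 1) * \<eta>" using dw by (simp add: s_def algebra_simps)
      have "f ?w \<le> f x0 + L * dist x0 ?w"
        using lip[of x0 ?w] by linarith
      moreover have "L * dist x0 ?w \<le> L * \<eta>" using dw L by (simp add: mult_left_mono)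
      moreover have "x0 \<bullet> e - ?w \<bullet> e \<le> dist x0 ?w"
        using norm_cauchy_schwarz[of "x0 - ?w" e]
        unfolding inner_diff_left e dist_norm mult_1_right .
      ultimately have "f ?w < ?w \<bullet> e + s"
        using fx dw \<eta>0 by (simp add: s_def K_def algebra_simps)
      then have "f y < y \<bullet> e" unfolding 2(3) f .
      with d show ?thesis by simp
    qed
    then have "y \<in> \<Omega>" "dist x0 y < \<epsilon>" using mem[of y] \<eta> by auto
    then show "y \<in> \<Omega> \<inter> ball x0 \<epsilon> - {x0}" using False by auto
  qed
  have conn: "connected (path x)" for x
    unfolding path_def by (intro connected_Un) auto
  show ?thesis
  proof (rule that[OF \<eta>0])
    show "connected U"
      unfolding U_def
      by (rule connected_Union) (use conn in \<open>auto simp: path_def\<close>)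
    show "\<Omega> \<inter> ball x0 \<eta> - {x0} \<subseteq> U"
      unfolding U_def path_def by auto
    show "U \<subseteq> \<Omega> \<inter> ball x0 \<epsilon> - {x0}"
      unfolding U_def using path by fastforce
  qed
qed

section \<open>Patches of shape regular meshes\<close>

text \<open>
The condition \<open>1 \<le> W\<close> is satisfied by any bound that comes from an actual mesh; it keeps powers of \<open>W\<close> monotone.
\<close>

definition shape_regular :: "'a::euclidean_space set set \<Rightarrow> real \<Rightarrow> bool" where
  "shape_regular \<T> W \<longleftrightarrow> 1 \<le> W \<and> (\<forall>T\<in>\<T>. diameter T / inball_diameter T \<le> W)"

text \<open>
Bound for the number of elements that contain a given point, see \<open>card_star_le\<close>.
\<close>

definition star_size :: "'a::euclidean_space itself \<Rightarrow> real \<Rightarrow> nat" where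
  "star_size _ W = nat \<lfloor>(4 * W) ^ DIM('a)\<rfloor>"

text \<open>
Bound for the ratio of the diameters of two elements that meet, see \<open>patch_element_diameter_le\<close>.
\<close>

definition size_ratio :: "'a::euclidean_space itself \<Rightarrow> real \<Rightarrow> real" where
  "size_ratio d W = W ^ star_size d W"

lemma size_ratio_ge_1: "1 \<le> W \<Longrightarrow> 1 \<le> size_ratio d W"
  by (simp add: size_ratio_def)

lemma conforming_mesh_simplex:
  assumes "conforming_mesh (\<Omega> :: 'a::euclidean_space set) \<T>" "T \<in> \<T>"
  shows "int DIM('a) simplex T" "convex T" "compact T" "bounded T" "0 < diameter T" "T \<subseteq> closure \<Omega>"
proof -
  show 1: "int DIM('a) simplex T" using assms by (simp add: conforming_mesh_def)
  show "convex T" "compact T" using 1 convex_simplex compact_simplex by blast+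
  then show "bounded T" by (simp add: compact_imp_bounded)
  show "0 < diameter T" using full_simplex_diameter_pos[OF 1] .
  show "T \<subseteq> closure \<Omega>" using assms by (auto simp: conforming_mesh_def)
qed

lemma conforming_mesh_finite: "conforming_mesh \<Omega> \<T> \<Longrightarrow> finite \<T>"
  by (simp add: conforming_mesh_def triangulation_def)

lemma conforming_mesh_face:
  assumes "conforming_mesh \<Omega> \<T>" "T \<in> \<T>" "T' \<in> \<T>"
  shows "T \<inter> T' face_of T" "T \<inter> T' face_of T'"
  using assms unfolding conforming_mesh_def triangulation_def by (blast, metis Int_commute)

lemma mesh_inscribed_ball:
  assumes "conforming_mesh (\<Omega> :: 'a::euclidean_space set) \<T>" "shape_regular \<T> W" "T \<in> \<T>"
  obtains x where "ball x (diameter T / (4 * W)) \<subseteq> T" "x \<in> T"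
  using shape_regular_inscribed_ball[of T W] conforming_mesh_simplex[OF assms(1,3)] assms
  unfolding shape_regular_def by blast

text \<open>
The diameters of the elements around \<open>x\<close> are not yet known to be comparable. Shrinking each of them towards \<open>x\<close>
to the smallest diameter \<open>R\<close> keeps it inside the original by convexity; the shrunk inscribed balls are then disjoint,
of radius \<open>R / (4 W)\<close>, and contained in the ball of radius \<open>R\<close> around \<open>x\<close>.
\<close>

lemma card_star_le:
  fixes \<Omega> :: "'a::euclidean_space set"
  assumes mesh: "conforming_mesh \<Omega> \<T>" and W: "shape_regular \<T> W"
  shows "real (card {T \<in> \<T>. x \<in> T}) \<le> (4 * W) ^ DIM('a)"
proof (cases "{T \<in> \<T>. x \<in> T} = {}")
  case True
  then show ?thesis using W by (simp add: shape_regular_def del: Collect_empty_eq)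
next
  case False
  let ?I = "{T \<in> \<T>. x \<in> T}"
  have W1: "1 \<le> W" using W by (simp add: shape_regular_def)
  have fin: "finite ?I" using conforming_mesh_finite[OF mesh] by simp
  define R where "R = Min (diameter ` ?I)"
  have Rle: "R \<le> diameter T" if "T \<in> ?I" for T
    unfolding R_def using fin that by (intro Min_le) auto
  have R0: "0 < R"
  proof -
    have "R \<in> diameter ` ?I" unfolding R_def by (rule Min_in) (use fin False in auto)
    then show ?thesis using conforming_mesh_simplex(5)[OF mesh] by auto
  qed
  have "\<exists>y. ball y (diameter T / (4 * W)) \<subseteq> T" if "T \<in> ?I" for T
    using mesh_inscribed_ball[OF mesh W] that by blast
  then obtain y where y: "\<And>T. T \<in> ?I \<Longrightarrow> ball (y T) (diameter T / (4 * W)) \<subseteq> T"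
    by metis
  define \<kappa> where "\<kappa> T = R / diameter T" for T :: "'a set"
  define c where "c T = x + \<kappa> T *\<^sub>R (y T - x)" for T
  let ?r = "R / (4 * W)"
  have key: "z \<in> T \<and> dist x z \<le> R" if T: "T \<in> ?I" and z: "z \<in> ball (c T) ?r" for T z
  proof -
    have dT: "0 < diameter T" using conforming_mesh_simplex(5)[OF mesh] T by auto
    have \<kappa>: "0 < \<kappa> T" "\<kappa> T \<le> 1" "\<kappa> T * diameter T = R"
      using R0 dT Rle[OF T] by (auto simp: \<kappa>_def)
    define z' where "z' = x + (1 / \<kappa> T) *\<^sub>R (z - x)"
    have zz: "z - x = \<kappa> T *\<^sub>R (z' - x)" using \<kappa> by (simp add: z'_def)
    have "c T - z = \<kappa> T *\<^sub>R (y T - z')"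
    proof -
      have "c T - z = \<kappa> T *\<^sub>R (y T - x) - (z - x)" by (simp add: c_def)
      then show ?thesis unfolding zz by (simp add: algebra_simps)
    qed
    then have "dist (c T) z = \<kappa> T * dist (y T) z'" using \<kappa> by (simp add: dist_norm)
    then have "\<kappa> T * dist (y T) z' < \<kappa> T * (diameter T / (4 * W))"
      using z \<kappa> by (metis mem_ball times_divide_eq_right)
    then have "dist (y T) z' < diameter T / (4 * W)"
      using \<kappa>(1) mult_less_cancel_left_pos by blast
    then have z'T: "z' \<in> T" using y[OF T] by (auto simp: subset_iff)
    have "z = (1 - \<kappa> T) *\<^sub>R x + \<kappa> T *\<^sub>R z'"
      using zz by (simp add: algebra_simps)
    then have "z \<in> T"
      using convexD_alt[OF conforming_mesh_simplex(2)[OF mesh], of T x z' "\<kappa> T"] T z'T \<kappa> by auto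
    moreover have "dist x z' \<le> diameter T"
      using diameter_bounded_bound[OF conforming_mesh_simplex(4)[OF mesh]] T z'T by auto
    then have "\<kappa> T * dist x z' \<le> R" using \<kappa> by (metis mult_left_mono less_imp_le)
    moreover have "dist x z = \<kappa> T * dist x z'"
      using zz \<kappa> by (simp add: dist_norm norm_minus_commute[of x])
    ultimately show ?thesis by simp
  qed
  have "real (card ?I) \<le> (R / ?r) ^ DIM('a)"
  proof (rule card_disjoint_balls_le[OF fin, where c = c and x = x])
    show "disjoint_family_on (\<lambda>T. ball (c T) ?r) ?I"
      unfolding disjoint_family_on_def
    proof (intro ballI impI)
      fix T T' assume T: "T \<in> ?I" "T' \<in> ?I" "T \<noteq> T'"
      have "ball (c T) ?r \<subseteq> T" "ball (c T') ?r \<subseteq> T'" using key T(1,2) by blast+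
      moreover have "T \<in> \<T>" "T' \<in> \<T>" using T by auto
      ultimately show "ball (c T) ?r \<inter> ball (c T') ?r = {}"
        using simplices_disjoint_balls[OF conforming_mesh_face[OF mesh] T(3)] by blast
    qed
    show "ball (c T) ?r \<subseteq> cball x R" if "T \<in> ?I" for T
      using key[OF that] by fastforce
  qed (use R0 W1 in auto)
  also have "R / ?r = 4 * W" using R0 W1 by simp
  finally show ?thesis .
qed

text \<open>
Otherwise the unions of the two classes would be closed sets that meet at most in \<open>x\<close> near \<open>x\<close>. They would separate
the connected set that fills a punctured neighbourhood of \<open>x\<close> in the domain.
\<close>

lemma star_edge_connected:
  fixes \<Omega> :: "'a::euclidean_space set"
  assumes dom: "lipschitz_domain \<Omega>" and dim: "2 \<le> DIM('a)" and mesh: "conforming_mesh \<Omega> \<T>"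
    and S: "S \<subseteq> {T \<in> \<T>. x \<in> T}" "S \<noteq> {}" "S \<noteq> {T \<in> \<T>. x \<in> T}"
  obtains T T' y where "T \<in> S" "T' \<in> {T \<in> \<T>. x \<in> T} - S" "y \<in> T \<inter> T'" "y \<noteq> x"
proof (rule ccontr)
  assume "\<not> thesis"
  with that have no: "\<And>T T' y. T \<in> S \<Longrightarrow> T' \<in> {T \<in> \<T>. x \<in> T} - S \<Longrightarrow> y \<in> T \<inter> T' \<Longrightarrow> y = x"
    by blast
  let ?I = "{T \<in> \<T>. x \<in> T}"
  let ?B = "?I - S"
  have fin: "finite \<T>" by (rule conforming_mesh_finite[OF mesh])
  have cl: "closed (\<Union>X)" if "X \<subseteq> \<T>" for X
    using that fin finite_subset compact_imp_closed[OF conforming_mesh_simplex(3)[OF mesh]]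
    by (intro closed_Union) auto
  have B: "?B \<noteq> {}" "?B \<subseteq> ?I" using S by auto
  have "x \<notin> \<Union>(\<T> - ?I)" by auto
  then have "x \<in> - \<Union>(\<T> - ?I)" by blast
  moreover have "open (- \<Union>(\<T> - ?I))" using cl[of "\<T> - ?I"] by (simp add: open_Compl)
  ultimately obtain \<epsilon> where \<epsilon>: "0 < \<epsilon>" "ball x \<epsilon> \<subseteq> - \<Union>(\<T> - ?I)"
    using openE by blast
  have x: "x \<in> closure \<Omega>" using S conforming_mesh_simplex(6)[OF mesh] by blast
  obtain \<eta> U where U: "0 < \<eta>" "connected U" "\<Omega> \<inter> ball x \<eta> - {x} \<subseteq> U" "U \<subseteq> \<Omega> \<inter> ball x \<epsilon> - {x}"
    using lipschitz_domain_locally_connected_punctured[OF dom dim x \<epsilon>(1)] .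
  have cover: "U \<subseteq> \<Union>S \<union> \<Union>?B"
  proof
    fix y assume y: "y \<in> U"
    then have "y \<in> closure \<Omega>" using U(4) closure_subset by blast
    then obtain T where T: "T \<in> \<T>" "y \<in> T" using mesh by (auto simp: conforming_mesh_def)
    then have "T \<in> ?I" using \<epsilon>(2) U(4) y by blast
    then show "y \<in> \<Union>S \<union> \<Union>?B" using T by blast
  qed
  have meets: "\<Union>X \<inter> U \<noteq> {}" if X: "X \<subseteq> ?I" "X \<noteq> {}" for X
  proof -
    obtain T where T: "T \<in> X" "T \<in> \<T>" "x \<in> T" using X by blast
    note sT = conforming_mesh_simplex[OF mesh T(2)]
    have "x \<in> closure (interior T)"
      using convex_closure_interior[OF sT(2) full_simplex_interior_nonempty[OF sT(1)]]
        T(3) closure_subset by blast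
    then have "interior T \<inter> ball x \<eta> \<noteq> {}"
      using U(1) open_Int_closure_eq_empty[of "ball x \<eta>" "interior T"]
      by (metis IntI centre_in_ball empty_iff inf_commute open_ball)
    moreover have "open (interior T \<inter> ball x \<eta>)" by (intro open_Int open_interior open_ball)
    ultimately have "\<not> interior T \<inter> ball x \<eta> \<subseteq> {x}"
      using not_open_singleton[of x] by (metis subset_singletonD)
    then obtain y where y: "y \<in> interior T" "y \<in> ball x \<eta>" "y \<noteq> x"
      by blast
    have "interior T \<subseteq> \<Omega>"
      using interior_mono[OF sT(6)] interior_closure_lipschitz_domain[OF dom] by simp
    then have "y \<in> U" using U(3) y by blast
    then show ?thesis using y T interior_subset by blast
  qed
  have "\<Union>S \<inter> \<Union>?B \<inter> U = {}" using no U(4) by blast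
  moreover have "closed (\<Union>S)" "closed (\<Union>?B)" using S(1) by (intro cl; blast)+
  ultimately show False
    using U(2) cover meets[OF S(1,2)] meets[OF B(2,1)] unfolding connected_closed by blast
qed

text \<open>
A set of \<open>k + 1\<close> elements that contains \<open>T0\<close> and whose diameters are at most \<open>W\<^sup>k\<close> times that of \<open>T0\<close> is enlarged
one element at a time, always across a shared edge, until it exhausts the star.
\<close>

lemma star_diameter_le:
  fixes \<Omega> :: "'a::euclidean_space set"
  assumes dom: "lipschitz_domain \<Omega>" and dim: "2 \<le> DIM('a)" and mesh: "conforming_mesh \<Omega> \<T>"
    and W: "shape_regular \<T> W" and T: "T0 \<in> \<T>" "T \<in> \<T>" "x \<in> T0" "x \<in> T"
  shows "diameter T \<le> size_ratio TYPE('a) W * diameter T0"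
proof -
  let ?I = "{T \<in> \<T>. x \<in> T}"
  have W1: "1 \<le> W" using W by (simp add: shape_regular_def)
  have fin: "finite ?I" using conforming_mesh_finite[OF mesh] by simp
  have d0: "0 < diameter T0" by (rule conforming_mesh_simplex(5)[OF mesh T(1)])
  have grow: "Suc k \<le> card ?I \<Longrightarrow>
      \<exists>S. S \<subseteq> ?I \<and> T0 \<in> S \<and> card S = Suc k \<and> (\<forall>T\<in>S. diameter T \<le> W ^ k * diameter T0)" for k
  proof (induction k)
    case 0
    show ?case by (rule exI[of _ "{T0}"]) (use T in auto)
  next
    case (Suc k)
    then obtain S where S: "S \<subseteq> ?I" "T0 \<in> S" "card S = Suc k"
      "\<And>T. T \<in> S \<Longrightarrow> diameter T \<le> W ^ k * diameter T0" by auto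
    then have "S \<noteq> {}" "S \<noteq> ?I" using Suc.prems by auto
    then obtain T1 T2 y where T12: "T1 \<in> S" "T2 \<in> ?I - S" "y \<in> T1 \<inter> T2" "y \<noteq> x"
      using star_edge_connected[OF dom dim mesh S(1)] by blast
    then have in\<T>: "T1 \<in> \<T>" "T2 \<in> \<T>" "x \<in> T2 \<inter> T1" "y \<in> T2 \<inter> T1" "x \<noteq> y" using S(1) by auto
    have "diameter T2 \<le> W * diameter T1"
      using shape_regular_meets_in_edge[OF conforming_mesh_simplex(1)[OF mesh in\<T>(2)] _
          conforming_mesh_face(1)[OF mesh in\<T>(2,1)] in\<T>(3-5) conforming_mesh_simplex(4)[OF mesh in\<T>(1)]]
        W in\<T> unfolding shape_regular_def by blast
    also have "\<dots> \<le> W * (W ^ k * diameter T0)"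
      using S(4)[OF T12(1)] W1 by (simp add: mult_left_mono)
    finally have T2: "diameter T2 \<le> W ^ Suc k * diameter T0" by simp
    have "finite S" using S(1) fin finite_subset by blast
    moreover have "diameter T \<le> W ^ Suc k * diameter T0" if "T \<in> S" for T
    proof -
      have "W ^ k * diameter T0 \<le> W ^ Suc k * diameter T0"
        using W1 d0 by (simp add: mult_le_cancel_right1)
      then show ?thesis using S(4)[OF that] by simp
    qed
    ultimately show ?case
      using S T12 T2 by (intro exI[of _ "insert T2 S"]) auto
  qed
  have I0: "0 < card ?I" using fin T card_gt_0_iff by blast
  then obtain k where k: "card ?I = Suc k" using gr0_implies_Suc by blast
  obtain S where S: "S \<subseteq> ?I" "card S = Suc k" "\<And>T. T \<in> S \<Longrightarrow> diameter T \<le> W ^ k * diameter T0"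
    using grow[of k] k by auto
  then have "S = ?I" using k fin card_subset_eq by metis
  then have "diameter T \<le> W ^ k * diameter T0" using S(3)[of T] T by blast
  also have "\<dots> \<le> W ^ star_size TYPE('a) W * diameter T0"
  proof -
    have "k \<le> star_size TYPE('a) W"
      using card_star_le[OF mesh W, of x] k by (simp add: star_size_def le_nat_floor)
    then show ?thesis using W1 d0 by (intro mult_right_mono power_increasing) auto
  qed
  finally show ?thesis by (simp add: size_ratio_def)
qed

lemma patch_element_diameter_le:
  fixes \<Omega> :: "'a::euclidean_space set"
  assumes "lipschitz_domain \<Omega>" "2 \<le> DIM('a)" "conforming_mesh \<Omega> \<T>" "shape_regular \<T> W"
    and "T \<in> \<T>" "T' \<in> \<T>" "T' \<inter> T \<noteq> {}"
  shows "diameter T' \<le> size_ratio TYPE('a) W * diameter T"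
proof -
  obtain x where "x \<in> T" "x \<in> T'" using assms(7) by blast
  then show ?thesis by (rule star_diameter_le[OF assms(1-6)])
qed

lemma patch_dist_le:
  fixes \<Omega> :: "'a::euclidean_space set"
  assumes asm: "lipschitz_domain \<Omega>" "2 \<le> DIM('a)" "conforming_mesh \<Omega> \<T>" "shape_regular \<T> W"
    and T: "T \<in> \<T>" and xy: "x \<in> patch \<T> T" "y \<in> patch \<T> T"
  shows "dist x y \<le> 3 * size_ratio TYPE('a) W * diameter T"
proof -
  let ?\<Lambda> = "size_ratio TYPE('a) W"
  have near: "\<exists>v\<in>T. dist u v \<le> ?\<Lambda> * diameter T" if u: "u \<in> patch \<T> T" for u
  proof -
    obtain T' v where T': "T' \<in> \<T>" "u \<in> T'" "v \<in> T'" "v \<in> T" using u unfolding patch_def by blast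
    then have "dist u v \<le> diameter T'"
      by (intro diameter_bounded_bound[OF conforming_mesh_simplex(4)[OF asm(3)]])
    also have "\<dots> \<le> ?\<Lambda> * diameter T"
      using patch_element_diameter_le[OF asm T T'(1)] T' by blast
    finally show ?thesis using T' by blast
  qed
  obtain v w where vw: "v \<in> T" "w \<in> T" "dist x v \<le> ?\<Lambda> * diameter T" "dist y w \<le> ?\<Lambda> * diameter T"
    using near xy by metis
  have "dist v w \<le> diameter T"
    by (rule diameter_bounded_bound[OF conforming_mesh_simplex(4)[OF asm(3) T] vw(1,2)])
  moreover have "diameter T \<le> ?\<Lambda> * diameter T"
    using size_ratio_ge_1[of W "TYPE('a)"] asm(4) conforming_mesh_simplex(5)[OF asm(3) T]
    by (simp add: shape_regular_def mult_le_cancel_right1)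
  moreover have "dist x y \<le> dist x v + dist v w + dist w y"
    by (meson add_right_mono dist_triangle dist_triangle_le order_trans)
  ultimately show ?thesis using vw by (simp add: dist_commute)
qed

text \<open>
Bound for the number of elements in a patch, see \<open>card_patch_le\<close>.
\<close>

definition patch_size :: "'a::euclidean_space itself \<Rightarrow> real \<Rightarrow> real" where
  "patch_size d W = (8 * W * (size_ratio d W)\<^sup>2) ^ DIM('a)"

lemma card_patch_le:
  fixes \<Omega> :: "'a::euclidean_space set"
  assumes asm: "lipschitz_domain \<Omega>" "2 \<le> DIM('a)" "conforming_mesh \<Omega> \<T>" "shape_regular \<T> W"
    and T: "T \<in> \<T>"
  shows "real (card {T' \<in> \<T>. T' \<inter> T \<noteq> {}}) \<le> patch_size TYPE('a) W"
proof -
  let ?\<Lambda> = "size_ratio TYPE('a) W" and ?I = "{T' \<in> \<T>. T' \<inter> T \<noteq> {}}"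
  have W1: "1 \<le> W" using asm(4) by (simp add: shape_regular_def)
  then have \<Lambda>1: "1 \<le> ?\<Lambda>" by (rule size_ratio_ge_1)
  have d0: "0 < diameter T" by (rule conforming_mesh_simplex(5)[OF asm(3) T])
  have fin: "finite ?I" using conforming_mesh_finite[OF asm(3)] by simp
  obtain x where x: "x \<in> T" using T mesh_inscribed_ball[OF asm(3,4)] by blast
  have "\<exists>y. ball y (diameter T' / (4 * W)) \<subseteq> T'" if "T' \<in> ?I" for T'
    using mesh_inscribed_ball[OF asm(3,4)] that by blast
  then obtain y where y: "\<And>T'. T' \<in> ?I \<Longrightarrow> ball (y T') (diameter T' / (4 * W)) \<subseteq> T'"
    by metis
  \<comment> \<open>A common lower bound for the radii of balls inscribed in the elements of the patch.\<close>
  define \<rho> where "\<rho> = diameter T / (4 * W * ?\<Lambda>)"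
  have "\<rho> > 0" using d0 W1 \<Lambda>1 by (simp add: \<rho>_def)
  have sub: "ball (y T') \<rho> \<subseteq> T'" if T': "T' \<in> ?I" for T'
  proof -
    have "diameter T \<le> ?\<Lambda> * diameter T'"
      by (rule patch_element_diameter_le[OF asm]) (use T T' in auto)
    then have "\<rho> \<le> diameter T' / (4 * W)"
      using W1 \<Lambda>1 by (simp add: \<rho>_def field_simps)
    then show ?thesis using y[OF T'] subset_ball by blast
  qed
  have "real (card ?I) \<le> (2 * ?\<Lambda> * diameter T / \<rho>) ^ DIM('a)"
  proof (rule card_disjoint_balls_le[OF fin, where c = y and x = x])
    show "disjoint_family_on (\<lambda>T. ball (y T) \<rho>) ?I"
      unfolding disjoint_family_on_def
    proof (intro ballI impI)
      fix T1 T2 assume T12: "T1 \<in> ?I" "T2 \<in> ?I" "T1 \<noteq> T2"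
      then have "T1 \<in> \<T>" "T2 \<in> \<T>" by auto
      then show "ball (y T1) \<rho> \<inter> ball (y T2) \<rho> = {}"
        using simplices_disjoint_balls[OF conforming_mesh_face[OF asm(3)] T12(3)] sub T12(1,2) by blast
    qed
    show "ball (y T') \<rho> \<subseteq> cball x (2 * ?\<Lambda> * diameter T)" if T': "T' \<in> ?I" for T'
    proof
      fix u assume "u \<in> ball (y T') \<rho>"
      then have u: "u \<in> T'" using sub[OF T'] by blast
      obtain v where v: "v \<in> T'" "v \<in> T" using T' by blast
      have "dist x v \<le> diameter T" "dist v u \<le> diameter T'"
        using T' v x u T
        by (auto intro!: diameter_bounded_bound conforming_mesh_simplex(4)[OF asm(3)])
      moreover have "diameter T' \<le> ?\<Lambda> * diameter T"
        by (rule patch_element_diameter_le[OF asm T]) (use T' in auto)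
      moreover have "diameter T \<le> ?\<Lambda> * diameter T" using \<Lambda>1 d0 by (simp add: mult_le_cancel_right1)
      moreover have "dist x u \<le> dist x v + dist v u" by (rule dist_triangle)
      ultimately show "u \<in> cball x (2 * ?\<Lambda> * diameter T)" by simp
    qed
  qed (use \<open>\<rho> > 0\<close> d0 \<Lambda>1 in auto)
  also have "2 * ?\<Lambda> * diameter T / \<rho> = 8 * W * ?\<Lambda>\<^sup>2"
    using d0 W1 \<Lambda>1 by (simp add: \<rho>_def field_simps power2_eq_square)
  finally show ?thesis by (simp add: patch_size_def)
qed

lemma patch_overlap:
  fixes \<Omega> :: "'a::euclidean_space set"
  assumes asm: "lipschitz_domain \<Omega>" "2 \<le> DIM('a)" "conforming_mesh \<Omega> \<T>" "shape_regular \<T> W"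
  shows "real (card {T \<in> \<T>. x \<in> patch \<T> T}) \<le> (4 * W) ^ DIM('a) * patch_size TYPE('a) W"
proof -
  let ?I = "{T \<in> \<T>. x \<in> T}"
  have fin: "finite \<T>" by (rule conforming_mesh_finite[OF asm(3)])
  have W1: "1 \<le> W" using asm(4) by (simp add: shape_regular_def)
  have "{T \<in> \<T>. x \<in> patch \<T> T} \<subseteq> (\<Union>T'\<in>?I. {T \<in> \<T>. T \<inter> T' \<noteq> {}})"
    unfolding patch_def by blast
  then have "card {T \<in> \<T>. x \<in> patch \<T> T} \<le> card (\<Union>T'\<in>?I. {T \<in> \<T>. T \<inter> T' \<noteq> {}})"
    using fin by (intro card_mono) auto
  also have "\<dots> \<le> (\<Sum>T'\<in>?I. card {T \<in> \<T>. T \<inter> T' \<noteq> {}})"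
    using fin by (intro card_UN_le) auto
  finally have "real (card {T \<in> \<T>. x \<in> patch \<T> T}) \<le> (\<Sum>T'\<in>?I. real (card {T \<in> \<T>. T \<inter> T' \<noteq> {}}))"
    unfolding of_nat_sum[symmetric] of_nat_le_iff .
  also have "\<dots> \<le> (\<Sum>T'\<in>?I. patch_size TYPE('a) W)"
    using card_patch_le[OF asm] by (intro sum_mono) auto
  also have "\<dots> = real (card ?I) * patch_size TYPE('a) W" by simp
  also have "\<dots> \<le> (4 * W) ^ DIM('a) * patch_size TYPE('a) W"
    using card_star_le[OF asm(3,4)] W1 size_ratio_ge_1[of W "TYPE('a)"]
    by (intro mult_right_mono) (auto simp: patch_size_def)
  finally show ?thesis .
qed

lemma mesh_element_volume:
  fixes \<Omega> :: "'a::euclidean_space set"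
  assumes mesh: "conforming_mesh \<Omega> \<T>" and W: "shape_regular \<T> W" and T: "T \<in> \<T>"
  shows "unit_ball_vol (DIM('a)) * (diameter T / (4 * W)) ^ DIM('a) \<le> measure lebesgue T"
    and "measure lebesgue T \<le> unit_ball_vol (DIM('a)) * diameter T ^ DIM('a)"
proof -
  have W1: "1 \<le> W" using W by (simp add: shape_regular_def)
  have d0: "0 < diameter T" by (rule conforming_mesh_simplex(5)[OF mesh T])
  have Tm: "T \<in> lmeasurable" using conforming_mesh_simplex(3)[OF mesh T] by (rule lmeasurable_compact)
  obtain x where x: "ball x (diameter T / (4 * W)) \<subseteq> T" "x \<in> T" using mesh_inscribed_ball[OF mesh W T] .
  have "measure lebesgue (ball x (diameter T / (4 * W))) \<le> measure lebesgue T"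
    by (rule measure_mono_fmeasurable[OF x(1) _ Tm]) simp
  then show "unit_ball_vol (DIM('a)) * (diameter T / (4 * W)) ^ DIM('a) \<le> measure lebesgue T"
    using d0 W1 by (simp add: content_ball)
  have "T \<subseteq> cball x (diameter T)"
    using diameter_bounded_bound[OF conforming_mesh_simplex(4)[OF mesh T] x(2)] by auto
  then have "measure lebesgue T \<le> measure lebesgue (cball x (diameter T))"
    by (rule measure_mono_fmeasurable) (use Tm in auto)
  then show "measure lebesgue T \<le> unit_ball_vol (DIM('a)) * diameter T ^ DIM('a)"
    using d0 by (simp add: content_cball)
qed

text \<open>
A boundary point of the domain is not interior to any element, so it lies on the boundary of a convex set.
\<close>

lemma negligible_frontier_meshed_domain:
  fixes \<Omega> :: "'a::euclidean_space set"
  assumes dom: "lipschitz_domain \<Omega>" and mesh: "conforming_mesh \<Omega> \<T>"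
  shows "negligible (closure \<Omega> - \<Omega>)"
proof (rule negligible_subset)
  show "negligible (\<Union>T\<in>\<T>. frontier T)"
    using conforming_mesh_finite[OF mesh] conforming_mesh_simplex(2)[OF mesh]
    by (intro negligible_Union) (auto simp: negligible_convex_frontier)
  show "closure \<Omega> - \<Omega> \<subseteq> (\<Union>T\<in>\<T>. frontier T)"
  proof
    fix x assume x: "x \<in> closure \<Omega> - \<Omega>"
    then obtain T where T: "T \<in> \<T>" "x \<in> T" using mesh unfolding conforming_mesh_def by blast
    have "interior T \<subseteq> \<Omega>"
      using interior_mono[OF conforming_mesh_simplex(6)[OF mesh T(1)]]
        interior_closure_lipschitz_domain[OF dom] by simp
    then have "x \<in> frontier T" using x T closure_subset by (auto simp: frontier_def)
    then show "x \<in> (\<Union>T\<in>\<T>. frontier T)" using T by blast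
  qed
qed

section \<open>Variable Lebesgue spaces and Hajlasz gradients\<close>

lemma AE_lebesgue_not_in_negligible: "negligible N \<Longrightarrow> AE x in lebesgue. x \<notin> N"
  by (simp add: AE_not_in negligible_iff_null_sets)

lemma nn_integral_lebesgue_on_negligible_diff:
  assumes "D \<in> sets lebesgue" "M \<in> sets lebesgue" "D \<subseteq> M" "negligible (M - D)"
  shows "(\<integral>\<^sup>+x. f x \<partial>lebesgue_on M) = (\<integral>\<^sup>+x. f x \<partial>lebesgue_on D)"
proof -
  have "AE x in lebesgue. f x * indicator M x = f x * indicator D x"
    using AE_lebesgue_not_in_negligible[OF assms(4)]
    by eventually_elim (use assms(3) in \<open>auto split: split_indicator\<close>)
  then show ?thesis
    using assms by (simp add: nn_integral_restrict_space nn_integral_cong_AE)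
qed


lemma borel_measurable_lebesgue_on_negligible_diff:
  fixes f :: "'a::euclidean_space \<Rightarrow> 'b::euclidean_space"
  assumes "D \<in> sets lebesgue" "M \<in> sets lebesgue" "D \<subseteq> M" "negligible (M - D)"
  shows "f \<in> borel_measurable (lebesgue_on M) \<longleftrightarrow> f \<in> borel_measurable (lebesgue_on D)"
proof -
  have "M - D \<in> null_sets (lebesgue_on M)"
    using assms by (auto simp: null_sets_restrict_space negligible_iff_null_sets)
  from borel_measurable_diff_null[OF this assms(2), of f]
  show ?thesis using assms(3) by (simp add: double_diff)
qed

lemma integral_lebesgue_on_negligible_diff:
  fixes f :: "'a::euclidean_space \<Rightarrow> 'b::euclidean_space"
  assumes M: "D \<in> sets lebesgue" "M \<in> sets lebesgue" "D \<subseteq> M" "negligible (M - D)"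
    and f: "f \<in> borel_measurable (lebesgue_on D)"
  shows "integral\<^sup>L (lebesgue_on M) f = integral\<^sup>L (lebesgue_on D) f"
proof -
  have fM: "f \<in> borel_measurable (lebesgue_on M)"
    using borel_measurable_lebesgue_on_negligible_diff[OF M] f by blast
  have "AE x in lebesgue. indicator M x *\<^sub>R f x = indicator D x *\<^sub>R f x"
    using AE_lebesgue_not_in_negligible[OF M(4)]
    by eventually_elim (use M(3) in \<open>auto split: split_indicator\<close>)
  then have "(LINT x|lebesgue. indicator M x *\<^sub>R f x) = (LINT x|lebesgue. indicator D x *\<^sub>R f x)"
    using f fM M by (intro integral_cong_AE) (simp_all add: borel_measurable_restrict_space_iff)
  then show ?thesis using M by (simp add: integral_restrict_space)
qed

lemma mean_on_eq:
  fixes f :: "'a::euclidean_space \<Rightarrow> 'b::euclidean_space"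
  assumes "M \<in> sets lebesgue"
  shows "mean_on M f = (1 / measure lebesgue M) *\<^sub>R integral\<^sup>L (lebesgue_on M) f"
  using assms by (simp add: mean_on_def set_lebesgue_integral_def integral_restrict_space)

lemma holder_on_imp_continuous_on:
  assumes "holder_on \<alpha> S p" "0 < \<alpha>"
  shows "continuous_on S p"
  unfolding continuous_on_def
proof
  obtain K where K: "\<And>x y. x \<in> S \<Longrightarrow> y \<in> S \<Longrightarrow> \<bar>p x - p y\<bar> \<le> K * dist x y powr \<alpha>"
    using assms unfolding holder_on_def by blast
  fix x assume x: "x \<in> S"
  have "((\<lambda>y. dist y x) \<longlongrightarrow> dist x x) (at x within S)"
    by (intro tendsto_intros)
  then have "((\<lambda>y. K * dist y x powr \<alpha>) \<longlongrightarrow> K * 0) (at x within S)"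
    using assms(2) by (intro tendsto_mult tendsto_const tendsto_zero_powrI[where b = \<alpha>]) auto
  then have lim: "((\<lambda>y. K * dist y x powr \<alpha>) \<longlongrightarrow> 0) (at x within S)" by simp
  have "\<forall>\<^sub>F y in at x within S. norm (p y - p x) \<le> K * dist y x powr \<alpha>"
    unfolding eventually_at_filter using K x by (intro always_eventually) simp
  then have "((\<lambda>y. p y - p x) \<longlongrightarrow> 0) (at x within S)"
    by (rule Lim_null_comparison[OF _ lim])
  then show "(p \<longlongrightarrow> p x) (at x within S)" by (simp add: LIM_zero_iff)
qed

lemma holder_seminorm_bound:
  assumes h: "holder_on \<alpha> (closure S) p" and xy: "x \<in> S" "y \<in> S"
  shows "\<bar>p x - p y\<bar> \<le> \<bar>holder_seminorm \<alpha> S p\<bar> * dist x y powr \<alpha>"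
proof (cases "x = y")
  case False
  let ?Q = "{\<bar>p x - p y\<bar> / dist x y powr \<alpha> |x y. x \<in> S \<and> y \<in> S \<and> x \<noteq> y}"
  obtain K where K: "\<And>x y. x \<in> closure S \<Longrightarrow> y \<in> closure S \<Longrightarrow> \<bar>p x - p y\<bar> \<le> K * dist x y powr \<alpha>"
    using h unfolding holder_on_def by blast
  have "bdd_above ?Q"
  proof (rule bdd_aboveI[of _ K])
    fix r assume "r \<in> ?Q"
    then obtain a b where r: "r = \<bar>p a - p b\<bar> / dist a b powr \<alpha>" "a \<in> S" "b \<in> S" "a \<noteq> b" by blast
    then have "\<bar>p a - p b\<bar> \<le> K * dist a b powr \<alpha>" using K closure_subset by blast
    then show "r \<le> K" using r by (simp add: divide_le_eq)
  qed
  then have "\<bar>p x - p y\<bar> / dist x y powr \<alpha> \<le> holder_seminorm \<alpha> S p"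
    unfolding holder_seminorm_def using xy False by (intro cSup_upper) auto
  then have "\<bar>p x - p y\<bar> \<le> holder_seminorm \<alpha> S p * dist x y powr \<alpha>"
    using False by (simp add: divide_le_eq)
  also have "\<dots> \<le> \<bar>holder_seminorm \<alpha> S p\<bar> * dist x y powr \<alpha>" by (intro mult_right_mono) auto
  finally show ?thesis .
qed simp

text \<open>
The set where the bound fails is open, and a nonempty open set is not negligible.
\<close>

lemma AE_open_imp_all:
  fixes \<Omega> :: "'a::euclidean_space set" and f :: "'a \<Rightarrow> real"
  assumes \<Omega>: "open \<Omega>" and f: "continuous_on \<Omega> f" and ae: "AE x in lebesgue_on \<Omega>. f x \<le> c" and x: "x \<in> \<Omega>"
  shows "f x \<le> c"
proof (rule ccontr)
  assume "\<not> f x \<le> c"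
  let ?U = "{y \<in> \<Omega>. c < f y}"
  have "?U = \<Omega> \<inter> f -` {c<..}" by auto
  then have "open ?U" using continuous_on_open_vimage[OF \<Omega>] f by (metis open_greaterThan inf_commute)
  moreover have "x \<in> ?U" using x \<open>\<not> f x \<le> c\<close> by auto
  ultimately have "\<not> negligible ?U" using open_not_negligible by blast
  moreover have "AE y in lebesgue. y \<notin> ?U"
    using ae \<Omega> by (simp add: AE_restrict_space_iff lmeasurable_open not_less)
  then have "negligible ?U"
    using \<open>open ?U\<close> by (simp add: negligible_iff_null_sets AE_iff_null_sets)
  ultimately show False by blast
qed

lemma essinf_esssup_bounds:
  fixes \<Omega> :: "'a::euclidean_space set" and p :: "'a \<Rightarrow> real"
  assumes \<Omega>: "open \<Omega>" and p: "continuous_on \<Omega> p"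
    and inf: "essinf (lebesgue_on \<Omega>) (\<lambda>x. ereal (p x)) = ereal a"
    and sup: "esssup (lebesgue_on \<Omega>) (\<lambda>x. ereal (p x)) = ereal b" and x: "x \<in> \<Omega>"
  shows "a \<le> p x" "p x \<le> b"
proof -
  have "AE x in lebesgue_on \<Omega>. ereal (p x) \<le> ereal b"
    unfolding sup[symmetric] by (rule esssup_AE)
  then show "p x \<le> b" using AE_open_imp_all[OF \<Omega> p _ x] by simp
  have "esssup (lebesgue_on \<Omega>) (\<lambda>x. - ereal (p x)) = ereal (- a)"
    using inf by (simp add: essinf_def ereal_uminus_eq_reorder)
  then have "AE x in lebesgue_on \<Omega>. - ereal (p x) \<le> ereal (- a)"
    by (metis esssup_AE)
  then have "AE x in lebesgue_on \<Omega>. - p x \<le> - a" by simp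
  then have "- p x \<le> - a"
    by (rule AE_open_imp_all[OF \<Omega> continuous_on_minus[OF p] _ x])
  then show "a \<le> p x" by simp
qed

text \<open>
Without this the infimum in \<open>Lvar_norm\<close> could be that of the empty set. A finite modular drops below \<open>1\<close> when the
scale is increased, because the exponent is at least \<open>1\<close>.
\<close>

lemma Lvar_modular_le_1:
  fixes v :: "'a::euclidean_space \<Rightarrow> 'b::real_normed_vector"
  assumes \<Omega>: "\<Omega> \<in> sets lebesgue" and p: "\<And>x. x \<in> \<Omega> \<Longrightarrow> 1 \<le> p x"
    and pm [measurable]: "p \<in> borel_measurable (lebesgue_on \<Omega>)" and v: "v \<in> Lvar p \<Omega>"
  shows "{s. 0 < s \<and> exp_modular p \<Omega> (\<lambda>x. v x /\<^sub>R s) \<le> 1} \<noteq> {}"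
proof -
  obtain s where s: "0 < s" "exp_modular p \<Omega> (\<lambda>x. v x /\<^sub>R s) < \<infinity>"
    and [measurable]: "v \<in> borel_measurable (lebesgue_on \<Omega>)"
    using v unfolding Lvar_def by blast
  define F where "F = enn2real (exp_modular p \<Omega> (\<lambda>x. v x /\<^sub>R s))"
  have F: "exp_modular p \<Omega> (\<lambda>x. v x /\<^sub>R s) = ennreal F" "0 \<le> F"
    using s(2) by (auto simp: F_def less_top)
  define \<mu> where "\<mu> = max 1 F"
  have \<mu>: "1 \<le> \<mu>" "F \<le> \<mu>" by (auto simp: \<mu>_def)
  have "exp_modular p \<Omega> (\<lambda>x. v x /\<^sub>R (s * \<mu>)) \<le> (\<integral>\<^sup>+x. ennreal (1 / \<mu>) * ennreal (norm (v x /\<^sub>R s) powr p x) \<partial>lebesgue_on \<Omega>)"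
    unfolding exp_modular_def
  proof (rule nn_integral_mono)
    fix x assume "x \<in> space (lebesgue_on \<Omega>)"
    then have px: "1 \<le> p x" using p \<Omega> by simp
    have "norm (v x /\<^sub>R (s * \<mu>)) = 1 / \<mu> * norm (v x /\<^sub>R s)"
      using s(1) \<mu>(1) by (simp add: abs_mult field_simps)
    then have "norm (v x /\<^sub>R (s * \<mu>)) powr p x = (1 / \<mu>) powr p x * norm (v x /\<^sub>R s) powr p x"
      using \<mu>(1) by (simp only: powr_mult)
    also have "\<dots> \<le> (1 / \<mu>) powr 1 * norm (v x /\<^sub>R s) powr p x"
      using px \<mu>(1) by (intro mult_right_mono powr_mono') auto
    finally have "ennreal (norm (v x /\<^sub>R (s * \<mu>)) powr p x) \<le> ennreal ((1 / \<mu>) * norm (v x /\<^sub>R s) powr p x)"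
      using \<mu>(1) by (intro ennreal_leI) simp
    moreover have "ennreal ((1 / \<mu>) * norm (v x /\<^sub>R s) powr p x) = ennreal (1 / \<mu>) * ennreal (norm (v x /\<^sub>R s) powr p x)"
      by (rule ennreal_mult) (use \<mu>(1) in simp_all)
    ultimately show "ennreal (norm (v x /\<^sub>R (s * \<mu>)) powr p x) \<le> ennreal (1 / \<mu>) * ennreal (norm (v x /\<^sub>R s) powr p x)"
      by (simp only:)
  qed
  also have "\<dots> = ennreal (1 / \<mu>) * ennreal F"
    unfolding F(1)[symmetric] exp_modular_def by (rule nn_integral_cmult) measurable
  also have "\<dots> = ennreal (F / \<mu>)"
    using \<mu>(1) F(2) by (simp add: ennreal_mult[symmetric])
  also have "\<dots> \<le> ennreal 1" using \<mu> F(2) by (intro ennreal_leI) (simp add: divide_le_eq)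
  finally have "exp_modular p \<Omega> (\<lambda>x. v x /\<^sub>R (s * \<mu>)) \<le> 1" by simp
  moreover have "0 < s * \<mu>" using s(1) \<mu>(1) by simp
  ultimately show ?thesis by blast
qed

lemma Lvar_norm_nonneg:
  assumes "{s. 0 < s \<and> exp_modular p \<Omega> (\<lambda>x. v x /\<^sub>R s) \<le> 1} \<noteq> {}"
  shows "0 \<le> Lvar_norm p \<Omega> v"
  unfolding Lvar_norm_def by (rule cInf_greatest[OF assms]) auto

lemma le_one_plus_powr:
  fixes y P :: real
  assumes "0 \<le> y" "1 \<le> P"
  shows "y \<le> 1 + y powr P"
proof (cases "y \<le> 1")
  case False
  then have "y powr 1 \<le> y powr P" using assms by (intro powr_mono) auto
  then show ?thesis using False by simp
qed (use assms in \<open>simp add: add_increasing2\<close>)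

text \<open>
Integrates \<open>y \<le> 1 + y\<^sup>p\<close> for \<open>y = |v| / s\<close>, with a scale \<open>s\<close> slightly above the norm. The bound involves the
volume of \<open>D\<close> but not that of \<open>\<Omega>\<close>.
\<close>

lemma Lvar_nn_integral_le:
  fixes v :: "'a::euclidean_space \<Rightarrow> 'b::real_normed_vector"
  assumes \<Omega>: "\<Omega> \<in> sets lebesgue" and p: "\<And>x. x \<in> \<Omega> \<Longrightarrow> 1 \<le> p x"
    and pm [measurable]: "p \<in> borel_measurable (lebesgue_on \<Omega>)" and v: "v \<in> Lvar p \<Omega>"
    and D: "D \<in> lmeasurable" "D \<subseteq> \<Omega>"
  shows "(\<integral>\<^sup>+x. ennreal (norm (v x)) \<partial>lebesgue_on D) \<le> ennreal ((Lvar_norm p \<Omega> v + 1) * (measure lebesgue D + 1))"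
proof -
  let ?S = "{s. 0 < s \<and> exp_modular p \<Omega> (\<lambda>x. v x /\<^sub>R s) \<le> 1}"
  have ne: "?S \<noteq> {}" by (rule Lvar_modular_le_1[OF \<Omega> p pm v])
  have n0: "0 \<le> Lvar_norm p \<Omega> v" by (rule Lvar_norm_nonneg[OF ne])
  have "Inf ?S < Lvar_norm p \<Omega> v + 1" by (simp add: Lvar_norm_def)
  then obtain s where s: "0 < s" "exp_modular p \<Omega> (\<lambda>x. v x /\<^sub>R s) \<le> 1" "s < Lvar_norm p \<Omega> v + 1"
    using cInf_lessD[OF ne] by blast
  have [measurable]: "v \<in> borel_measurable (lebesgue_on \<Omega>)" using v unfolding Lvar_def by blast
  have Dm: "D \<in> sets lebesgue" using D by (simp add: fmeasurableD)
  have vD [measurable]: "v \<in> borel_measurable (lebesgue_on D)" "p \<in> borel_measurable (lebesgue_on D)"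
    using D by (auto intro: measurable_restrict_mono[OF _ D(2)])
  have "(\<integral>\<^sup>+x. ennreal (norm (v x)) \<partial>lebesgue_on D)
    \<le> (\<integral>\<^sup>+x. ennreal s * (1 + ennreal (norm (v x /\<^sub>R s) powr p x)) \<partial>lebesgue_on D)"
  proof (rule nn_integral_mono)
    fix x assume "x \<in> space (lebesgue_on D)"
    then have px: "1 \<le> p x" using p D Dm by auto
    have "norm (v x) = s * norm (v x /\<^sub>R s)" using s(1) by simp
    also have "\<dots> \<le> s * (1 + norm (v x /\<^sub>R s) powr p x)"
      using s(1) px by (intro mult_left_mono le_one_plus_powr) auto
    finally have "ennreal (norm (v x)) \<le> ennreal (s * (1 + norm (v x /\<^sub>R s) powr p x))" by (rule ennreal_leI)
    also have "\<dots> = ennreal s * (1 + ennreal (norm (v x /\<^sub>R s) powr p x))"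
      using s(1) by (simp add: ennreal_mult ennreal_plus)
    finally show "ennreal (norm (v x)) \<le> ennreal s * (1 + ennreal (norm (v x /\<^sub>R s) powr p x))" .
  qed
  also have "\<dots> = ennreal s * (emeasure (lebesgue_on D) D + (\<integral>\<^sup>+x. ennreal (norm (v x /\<^sub>R s) powr p x) \<partial>lebesgue_on D))"
    using Dm by (simp add: nn_integral_cmult nn_integral_add)
  also have "\<dots> \<le> ennreal s * (ennreal (measure lebesgue D) + 1)"
  proof (intro mult_left_mono add_mono)
    show "emeasure (lebesgue_on D) D \<le> ennreal (measure lebesgue D)"
      using Dm emeasure_eq_measure2[OF D(1)] by (simp add: emeasure_restrict_space)
    show "(\<integral>\<^sup>+x. ennreal (norm (v x /\<^sub>R s) powr p x) \<partial>lebesgue_on D) \<le> 1"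
      using order_trans[OF nn_integral_lebesgue_on_mono_set[OF Dm \<Omega> D(2)] s(2)[unfolded exp_modular_def]] .
  qed simp
  also have "\<dots> = ennreal (s * (measure lebesgue D + 1))"
    using s(1) by (simp add: ennreal_mult ennreal_plus)
  also have "\<dots> \<le> ennreal ((Lvar_norm p \<Omega> v + 1) * (measure lebesgue D + 1))"
    using s by (intro ennreal_leI mult_right_mono) auto
  finally show ?thesis .
qed

lemma Lvar_integrable:
  fixes v :: "'a::euclidean_space \<Rightarrow> 'b::euclidean_space"
  assumes \<Omega>: "\<Omega> \<in> sets lebesgue" and p: "\<And>x. x \<in> \<Omega> \<Longrightarrow> 1 \<le> p x"
    and pm: "p \<in> borel_measurable (lebesgue_on \<Omega>)" and v: "v \<in> Lvar p \<Omega>"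
    and D: "D \<in> lmeasurable" "D \<subseteq> \<Omega>"
  shows "integrable (lebesgue_on D) v"
    and "integral\<^sup>L (lebesgue_on D) (\<lambda>x. norm (v x)) \<le> (Lvar_norm p \<Omega> v + 1) * (measure lebesgue D + 1)"
proof -
  have "v \<in> borel_measurable (lebesgue_on \<Omega>)" using v unfolding Lvar_def by blast
  then have m: "v \<in> borel_measurable (lebesgue_on D)" by (rule measurable_restrict_mono[OF _ D(2)])
  note le = Lvar_nn_integral_le[OF \<Omega> p pm v D]
  show int: "integrable (lebesgue_on D) v"
    by (rule integrableI_bounded[OF m]) (use le in \<open>auto intro: order.strict_trans1\<close>)
  have "ennreal (integral\<^sup>L (lebesgue_on D) (\<lambda>x. norm (v x))) \<le> ennreal ((Lvar_norm p \<Omega> v + 1) * (measure lebesgue D + 1))"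
    using le int by (subst nn_integral_eq_integral[symmetric]) auto
  moreover have "0 \<le> (Lvar_norm p \<Omega> v + 1) * (measure lebesgue D + 1)"
    using Lvar_norm_nonneg[OF Lvar_modular_le_1[OF \<Omega> p pm v]] by simp
  ultimately show "integral\<^sup>L (lebesgue_on D) (\<lambda>x. norm (v x)) \<le> (Lvar_norm p \<Omega> v + 1) * (measure lebesgue D + 1)"
    by (subst (asm) ennreal_le_iff) auto
qed

lemma Lvar_add_const:
  fixes z :: "'a::euclidean_space \<Rightarrow> real"
  assumes \<Omega>: "\<Omega> \<in> lmeasurable" and p: "\<And>x. x \<in> \<Omega> \<Longrightarrow> 1 \<le> p x \<and> p x \<le> b"
    and pm [measurable]: "p \<in> borel_measurable (lebesgue_on \<Omega>)" and z: "z \<in> Lvar p \<Omega>"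
  shows "(\<lambda>x. z x + c) \<in> Lvar p \<Omega>"
proof -
  obtain s where s: "0 < s" "exp_modular p \<Omega> (\<lambda>x. z x /\<^sub>R s) < \<infinity>"
    and [measurable]: "z \<in> borel_measurable (lebesgue_on \<Omega>)"
    using z unfolding Lvar_def by blast
  define L where "L = \<bar>c\<bar> / s"
  have \<Omega>m: "\<Omega> \<in> sets lebesgue" using \<Omega> by (simp add: fmeasurableD)
  have pt: "norm ((z x + c) /\<^sub>R s) powr p x \<le> 2 powr b * (norm (z x /\<^sub>R s) powr p x + (L + 1) powr b)"
    if x: "x \<in> \<Omega>" for x
  proof -
    let ?y = "norm (z x /\<^sub>R s)"
    have L: "0 \<le> L" using s by (simp add: L_def)
    have "norm ((z x + c) /\<^sub>R s) \<le> ?y + norm (c /\<^sub>R s)"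
      using norm_triangle_ineq[of "z x /\<^sub>R s" "c /\<^sub>R s"] by (simp add: distrib_left)
    also have "norm (c /\<^sub>R s) = L" using s by (simp add: L_def divide_inverse abs_mult mult.commute)
    finally have 1: "norm ((z x + c) /\<^sub>R s) \<le> 2 * max ?y L" by simp
    have "norm ((z x + c) /\<^sub>R s) powr p x \<le> (2 * max ?y L) powr p x"
      using 1 p[OF x] by (intro powr_mono2) auto
    also have "\<dots> = 2 powr p x * max ?y L powr p x" using L by (simp add: powr_mult)
    also have "\<dots> \<le> 2 powr b * (?y powr p x + (L + 1) powr b)"
    proof (intro mult_mono powr_mono)
      have "L powr p x \<le> (L + 1) powr p x" using L p[OF x] by (intro powr_mono2) auto
      also have "\<dots> \<le> (L + 1) powr b" using L p[OF x] by (intro powr_mono) auto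
      finally show "max ?y L powr p x \<le> ?y powr p x + (L + 1) powr b"
        by (auto simp: max_def add_increasing add_increasing2)
    qed (use p[OF x] in auto)
    finally show ?thesis .
  qed
  have "exp_modular p \<Omega> (\<lambda>x. (z x + c) /\<^sub>R s)
    \<le> (\<integral>\<^sup>+x. ennreal (2 powr b) * (ennreal (norm (z x /\<^sub>R s) powr p x) + ennreal ((L + 1) powr b)) \<partial>lebesgue_on \<Omega>)"
    unfolding exp_modular_def
  proof (rule nn_integral_mono)
    fix x assume "x \<in> space (lebesgue_on \<Omega>)"
    then have "x \<in> \<Omega>" using \<Omega>m by simp
    from ennreal_leI[OF pt[OF this]]
    show "ennreal (norm ((z x + c) /\<^sub>R s) powr p x)
      \<le> ennreal (2 powr b) * (ennreal (norm (z x /\<^sub>R s) powr p x) + ennreal ((L + 1) powr b))"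
      by (simp add: ennreal_mult ennreal_plus)
  qed
  also have "\<dots> = ennreal (2 powr b) * (exp_modular p \<Omega> (\<lambda>x. z x /\<^sub>R s) + ennreal ((L + 1) powr b) * emeasure lebesgue \<Omega>)"
    using \<Omega>m by (simp add: exp_modular_def nn_integral_cmult nn_integral_add emeasure_restrict_space)
  also have "\<dots> < \<infinity>"
    using s(2) \<Omega>
    by (simp add: less_top[symmetric] emeasure_eq_measure2 ennreal_mult_eq_top_iff)
  finally have fin: "exp_modular p \<Omega> (\<lambda>x. (z x + c) /\<^sub>R s) < \<infinity>" .
  have "(\<lambda>x. z x + c) \<in> borel_measurable (lebesgue_on \<Omega>)" by measurable
  with fin s(1) show ?thesis unfolding Lvar_def by blast
qed

lemma Lvar_const:
  fixes c :: real
  assumes "\<Omega> \<in> lmeasurable" "\<And>x. x \<in> \<Omega> \<Longrightarrow> 1 \<le> p x \<and> p x \<le> b" "p \<in> borel_measurable (lebesgue_on \<Omega>)"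
  shows "(\<lambda>x :: 'a::euclidean_space. c) \<in> Lvar p \<Omega>"
proof -
  have "(\<lambda>x :: 'a. 0 :: real) \<in> Lvar p \<Omega>"
    unfolding Lvar_def exp_modular_def by (auto intro!: exI[of _ 1])
  from Lvar_add_const[OF assms this, of c] show ?thesis by simp
qed

lemma minimal_hajlasz_gradient_norm_le:
  assumes "is_minimal_hajlasz_gradient \<gamma> q \<Omega> z g" "0 \<le> Lvar_norm q \<Omega> z"
  shows "g \<in> hajlasz_gradients \<gamma> q \<Omega> z" "Lvar_norm q \<Omega> g \<le> hajlasz_norm \<gamma> q \<Omega> z"
proof -
  have g: "g \<in> hajlasz_gradients \<gamma> q \<Omega> z"
    "\<And>g'. g' \<in> hajlasz_gradients \<gamma> q \<Omega> z \<Longrightarrow> Lvar_norm q \<Omega> g \<le> Lvar_norm q \<Omega> g'"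
    using assms(1) unfolding is_minimal_hajlasz_gradient_def is_arg_min_linorder by auto
  then show "g \<in> hajlasz_gradients \<gamma> q \<Omega> z" by blast
  have "Lvar_norm q \<Omega> g \<le> (INF g\<in>hajlasz_gradients \<gamma> q \<Omega> z. Lvar_norm q \<Omega> g)"
    using g by (intro cINF_greatest) auto
  then show "Lvar_norm q \<Omega> g \<le> hajlasz_norm \<gamma> q \<Omega> z"
    using assms(2) by (simp add: hajlasz_norm_def)
qed

section \<open>The projection error\<close>

text \<open>
Averaging the inequality for the Hajlasz gradient in one variable gives the first claim, averaging the result in the
other variable the second; no Poincare inequality is involved.
\<close>

lemma hajlasz_mean_oscillation:
  fixes z g :: "'a::euclidean_space \<Rightarrow> real"
  assumes D: "D \<in> lmeasurable" "0 < measure lebesgue D"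
    and z: "integrable (lebesgue_on D) z" and g: "integrable (lebesgue_on D) g" and R: "0 \<le> R"
    and haj: "AE x in lebesgue_on D. AE y in lebesgue_on D. \<bar>z x - z y\<bar> \<le> (g x + g y) * R"
  defines "zm \<equiv> integral\<^sup>L (lebesgue_on D) z / measure lebesgue D"
    and "gm \<equiv> integral\<^sup>L (lebesgue_on D) g / measure lebesgue D"
  shows "AE x in lebesgue_on D. \<bar>z x - zm\<bar> \<le> R * (g x + gm)"
    and "integral\<^sup>L (lebesgue_on D) (\<lambda>x. \<bar>z x - zm\<bar>) / measure lebesgue D \<le> 2 * R * gm"
proof -
  interpret finite_measure "lebesgue_on D" by (rule finite_measure_lebesgue_on[OF D(1)])
  let ?\<mu> = "lebesgue_on D"
  have sp: "space ?\<mu> = D" using D by (simp add: fmeasurableD)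
  have mD: "measure ?\<mu> D = measure lebesgue D"
    using D(1) by (simp add: measure_restrict_space fmeasurableD)
  show osc: "AE x in ?\<mu>. \<bar>z x - zm\<bar> \<le> R * (g x + gm)"
    using haj
  proof eventually_elim
    fix x assume x: "AE y in ?\<mu>. \<bar>z x - z y\<bar> \<le> (g x + g y) * R"
    have "\<bar>integral\<^sup>L ?\<mu> (\<lambda>y. z x - z y)\<bar> \<le> integral\<^sup>L ?\<mu> (\<lambda>y. \<bar>z x - z y\<bar>)"
      by (rule integral_abs_bound)
    also have "\<dots> \<le> integral\<^sup>L ?\<mu> (\<lambda>y. (g x + g y) * R)"
      using z g by (intro integral_mono_AE x) auto
    finally have "\<bar>z x * measure lebesgue D - integral\<^sup>L ?\<mu> z\<bar> \<le> (g x * measure lebesgue D + integral\<^sup>L ?\<mu> g) * R"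
      using z g by (simp add: sp mD mult.commute)
    then have "\<bar>z x * measure lebesgue D - integral\<^sup>L ?\<mu> z\<bar> / measure lebesgue D
        \<le> (g x * measure lebesgue D + integral\<^sup>L ?\<mu> g) * R / measure lebesgue D"
      using D(2) by (intro divide_right_mono) auto
    moreover have "\<bar>z x * measure lebesgue D - integral\<^sup>L ?\<mu> z\<bar> / measure lebesgue D = \<bar>z x - zm\<bar>"
    proof -
      have "z x - zm = (z x * measure lebesgue D - integral\<^sup>L ?\<mu> z) / measure lebesgue D"
        using D(2) by (simp add: zm_def diff_divide_distrib)
      then show ?thesis using D(2) by (simp add: abs_divide)
    qed
    moreover have "(g x * measure lebesgue D + integral\<^sup>L ?\<mu> g) * R / measure lebesgue D = R * (g x + gm)"
      using D(2) by (simp add: gm_def field_simps)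
    ultimately show "\<bar>z x - zm\<bar> \<le> R * (g x + gm)" by simp
  qed
  have "integral\<^sup>L ?\<mu> (\<lambda>x. \<bar>z x - zm\<bar>) \<le> integral\<^sup>L ?\<mu> (\<lambda>x. R * (g x + gm))"
    using z g by (intro integral_mono_AE osc) auto
  also have "\<dots> = R * (integral\<^sup>L ?\<mu> g + gm * measure lebesgue D)"
    using g by (simp add: sp mD mult.commute)
  also have "\<dots> = 2 * R * gm * measure lebesgue D"
    using D(2) by (simp add: gm_def)
  finally show "integral\<^sup>L ?\<mu> (\<lambda>x. \<bar>z x - zm\<bar>) / measure lebesgue D \<le> 2 * R * gm"
    using D(2) by (simp add: divide_le_eq)
qed

text \<open>
Completeness of the Lebesgue measure; needed because discrete functions are polynomials only almost everywhere.
\<close>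

lemma borel_measurable_lebesgue_on_AE_eq:
  fixes f g :: "'a::euclidean_space \<Rightarrow> 'b::euclidean_space"
  assumes S: "S \<in> sets lebesgue" and ae: "AE x in lebesgue_on S. f x = g x"
    and g: "g \<in> borel_measurable (lebesgue_on S)"
  shows "f \<in> borel_measurable (lebesgue_on S)"
proof -
  obtain N where N: "N \<in> null_sets (lebesgue_on S)" "{x \<in> space (lebesgue_on S). f x \<noteq> g x} \<subseteq> N"
    using ae unfolding eventually_ae_filter by blast
  have "g \<in> borel_measurable (lebesgue_on (S - N))"
    by (rule measurable_restrict_mono[OF g]) auto
  moreover have "f x = g x" if "x \<in> space (lebesgue_on (S - N))" for x
    using that N(2) S by auto
  ultimately have "f \<in> borel_measurable (lebesgue_on (S - N))"
    using measurable_cong by blast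
  then show ?thesis using borel_measurable_diff_null[OF N(1) S] by blast
qed

text \<open>
Elements and patches are closed, whereas functions are given on the open domain. The difference is contained in the
boundary of the domain and negligible.
\<close>

lemma patch_domain_facts:
  fixes \<Omega> :: "'a::euclidean_space set"
  assumes dom: "lipschitz_domain \<Omega>" and mesh: "conforming_mesh \<Omega> \<T>" and T: "T \<in> \<T>"
  shows "patch \<T> T \<in> sets lebesgue" "T \<in> sets lebesgue" "T \<subseteq> patch \<T> T" "patch \<T> T \<subseteq> closure \<Omega>"
    "patch \<T> T \<inter> \<Omega> \<in> lmeasurable" "T \<inter> \<Omega> \<in> sets lebesgue"
    "negligible (patch \<T> T - patch \<T> T \<inter> \<Omega>)" "negligible (T - T \<inter> \<Omega>)"
    "measure lebesgue (patch \<T> T \<inter> \<Omega>) = measure lebesgue (patch \<T> T)"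
    "measure lebesgue (T \<inter> \<Omega>) = measure lebesgue T"
    "measure lebesgue T \<le> measure lebesgue (patch \<T> T)" "0 < measure lebesgue T"
proof -
  let ?M = "patch \<T> T"
  have \<Omega>: "\<Omega> \<in> sets lebesgue" using dom by (simp add: lipschitz_domain_def)
  have "compact ?M"
    unfolding patch_def using conforming_mesh_finite[OF mesh] conforming_mesh_simplex(3)[OF mesh]
    by (intro compact_Union) auto
  then have M: "?M \<in> lmeasurable" by (rule lmeasurable_compact)
  then show Ms: "?M \<in> sets lebesgue" by (simp add: fmeasurableD)
  have Tm: "T \<in> lmeasurable" using conforming_mesh_simplex(3)[OF mesh T] by (rule lmeasurable_compact)
  then show Ts: "T \<in> sets lebesgue" by (simp add: fmeasurableD)
  have "T \<noteq> {}" using conforming_mesh_simplex(5)[OF mesh T] by auto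
  then show TM: "T \<subseteq> ?M" unfolding patch_def using T by blast
  show Mc: "?M \<subseteq> closure \<Omega>" unfolding patch_def using conforming_mesh_simplex(6)[OF mesh] by blast
  show "?M \<inter> \<Omega> \<in> lmeasurable" "T \<inter> \<Omega> \<in> sets lebesgue"
    using M \<Omega> Ts by (auto intro: fmeasurable_Int_fmeasurable)
  have neg: "negligible (closure \<Omega> - \<Omega>)" by (rule negligible_frontier_meshed_domain[OF dom mesh])
  show n1: "negligible (?M - ?M \<inter> \<Omega>)" by (rule negligible_subset[OF neg]) (use Mc in auto)
  show n2: "negligible (T - T \<inter> \<Omega>)" by (rule negligible_subset[OF neg]) (use TM Mc in auto)
  have eq: "measure lebesgue (S \<inter> \<Omega>) = measure lebesgue S" if "S \<in> lmeasurable" "negligible (S - S \<inter> \<Omega>)" for S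
  proof (rule measure_negligible_symdiff)
    show "negligible (sym_diff S (S \<inter> \<Omega>))" using that(2) by (rule negligible_subset) auto
  qed (use that in auto)
  show "measure lebesgue (?M \<inter> \<Omega>) = measure lebesgue ?M" "measure lebesgue (T \<inter> \<Omega>) = measure lebesgue T"
    using eq M Tm n1 n2 by auto
  show "measure lebesgue T \<le> measure lebesgue ?M" by (rule measure_mono_fmeasurable[OF TM Ts M])
  have "interior T \<noteq> {}" by (rule full_simplex_interior_nonempty[OF conforming_mesh_simplex(1)[OF mesh T]])
  then have "\<not> negligible T"
    using open_not_negligible[OF open_interior] negligible_subset[OF _ interior_subset] by blast
  then show "0 < measure lebesgue T"
    using negligible_iff_measure0[OF Tm] measure_nonneg[of lebesgue T] by linarith
qed

text \<open>
\<open>R\<close> bounds the diameter of the patch in units of \<open>h\<close>; the factor \<open>2 * (2 ^ Suc l * real (Suc l) ^ d * stab)\<close> is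
the product of the constants in \<open>hajlasz_mean_oscillation\<close>, \<open>poly_sup_le_integral\<close> and in the local stability.
\<close>

definition projection_constant :: "nat \<Rightarrow> real \<Rightarrow> real \<Rightarrow> nat \<Rightarrow> real" where
  "projection_constant l R stab d = R * (1 + 2 * (2 ^ Suc l * real (Suc l) ^ d * stab))"

text \<open>
With \<open>c\<close> the mean of \<open>z\<close> over the patch, \<open>z - P z = (z - c) - P (z - c)\<close>. The first term is controlled by the
oscillation; the second is a polynomial on \<open>T\<close>, so it is bounded pointwise by its mean, then by local stability, and
again by the oscillation.
\<close>

lemma projection_error_le:
  fixes \<Omega> :: "(real^'n) set" and z g :: "real^'n \<Rightarrow> real"
  assumes dom: "lipschitz_domain \<Omega>" and dim: "2 \<le> CARD('n)" and mesh: "conforming_mesh \<Omega> \<T>"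
    and W: "shape_regular \<T> W" and T: "T \<in> \<T>"
    and \<Omega>m: "\<Omega> \<in> lmeasurable"
    and q: "\<And>x. x \<in> \<Omega> \<Longrightarrow> 1 \<le> q x \<and> q x \<le> b" and qm: "q \<in> borel_measurable (lebesgue_on \<Omega>)"
    and V: "fe_space l \<T> V" and P: "linear_projection \<Omega> (Lvar q \<Omega>) V P"
    and stab: "locally_L1_stable stab \<T> (Lvar q \<Omega>) P" "0 < stab"
    and \<gamma>: "0 < \<gamma>" "\<gamma> \<le> 1" and z: "z \<in> Lvar q \<Omega>" and g: "g \<in> hajlasz_gradients \<gamma> q \<Omega> z"
  defines "D \<equiv> patch \<T> T \<inter> \<Omega>" and "h \<equiv> diameter T"
  defines "gm \<equiv> integral\<^sup>L (lebesgue_on D) g / measure lebesgue D"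
  shows "AE x in lebesgue_on (T \<inter> \<Omega>). \<bar>z x - P z x\<bar>
    \<le> projection_constant l (3 * size_ratio TYPE(real^'n) W) stab CARD('n) * (h powr \<gamma> * g x + h powr \<gamma> * gm)"
proof -
  let ?\<Lambda> = "size_ratio TYPE(real^'n) W"
  let ?C = "2 ^ Suc l * real (Suc l) ^ CARD('n)"
  let ?M = "patch \<T> T"
  define R where "R = (3 * ?\<Lambda> * h) powr \<gamma>"
  note pf = patch_domain_facts[OF dom mesh T]
  have dim': "2 \<le> DIM(real^'n)" using dim by simp
  have \<Lambda>: "1 \<le> ?\<Lambda>" using W by (auto simp: shape_regular_def intro: size_ratio_ge_1)
  have h0: "0 < h" unfolding h_def by (rule conforming_mesh_simplex(5)[OF mesh T])
  have Dl: "D \<in> lmeasurable" "D \<in> sets lebesgue" "D \<subseteq> \<Omega>" "D \<subseteq> ?M" "negligible (?M - D)"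
    using pf by (auto simp: D_def fmeasurableD)
  have D0: "0 < measure lebesgue D" "measure lebesgue D = measure lebesgue ?M" using pf by (auto simp: D_def)
  have \<Omega>s: "\<Omega> \<in> sets lebesgue" using \<Omega>m by (simp add: fmeasurableD)
  have q1: "\<And>x. x \<in> \<Omega> \<Longrightarrow> 1 \<le> q x" using q by blast
  have gL: "g \<in> Lvar q \<Omega>" and g0: "\<And>x. x \<in> \<Omega> \<Longrightarrow> 0 \<le> g x"
    and haj: "AE x in lebesgue_on \<Omega>. AE y in lebesgue_on \<Omega>. \<bar>z x - z y\<bar> \<le> (g x + g y) * dist x y powr \<gamma>"
    using g unfolding hajlasz_gradients_def by auto
  have zint: "integrable (lebesgue_on D) z" by (rule Lvar_integrable(1)[OF \<Omega>s q1 qm z Dl(1,3)])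
  have gint: "integrable (lebesgue_on D) g" by (rule Lvar_integrable(1)[OF \<Omega>s q1 qm gL Dl(1,3)])
  have R0: "0 \<le> R" by (simp add: R_def)
  have hajD: "AE x in lebesgue_on D. AE y in lebesgue_on D. \<bar>z x - z y\<bar> \<le> (g x + g y) * R"
  proof -
    have sub: "AE x in lebesgue_on D. Q x" if "AE x in lebesgue_on \<Omega>. Q x" for Q
      using that \<Omega>s Dl by (auto simp: AE_restrict_space_iff elim!: eventually_mono)
    have inD: "AE x in lebesgue_on D. x \<in> D" using AE_space[of "lebesgue_on D"] Dl by simp
    have "AE x in lebesgue_on D. AE y in lebesgue_on D. \<bar>z x - z y\<bar> \<le> (g x + g y) * dist x y powr \<gamma>"
      using sub[OF haj] by eventually_elim (rule sub)
    then show ?thesis using inD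
    proof eventually_elim
      fix x assume ae: "AE y in lebesgue_on D. \<bar>z x - z y\<bar> \<le> (g x + g y) * dist x y powr \<gamma>" and x: "x \<in> D"
      show "AE y in lebesgue_on D. \<bar>z x - z y\<bar> \<le> (g x + g y) * R"
        using ae inD
      proof eventually_elim
        fix y assume xy: "\<bar>z x - z y\<bar> \<le> (g x + g y) * dist x y powr \<gamma>" and y: "y \<in> D"
        have "dist x y \<le> 3 * ?\<Lambda> * h"
          unfolding h_def using x y Dl by (intro patch_dist_le[OF dom dim' mesh W T]) auto
        then have "dist x y powr \<gamma> \<le> R" unfolding R_def using \<gamma> by (intro powr_mono2) auto
        moreover have "0 \<le> g x + g y" using g0 x y Dl by (simp add: subset_iff)
        ultimately have "(g x + g y) * dist x y powr \<gamma> \<le> (g x + g y) * R" by (rule mult_left_mono)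
        then show "\<bar>z x - z y\<bar> \<le> (g x + g y) * R" using xy by linarith
      qed
    qed
  qed
  define zm where "zm = integral\<^sup>L (lebesgue_on D) z / measure lebesgue D"
  note osc = hajlasz_mean_oscillation[OF Dl(1) D0(1) zint gint R0 hajD, folded zm_def gm_def]
  define z' where "z' = (\<lambda>x. z x + (- zm))"
  have z'L: "z' \<in> Lvar q \<Omega>" unfolding z'_def by (rule Lvar_add_const[OF \<Omega>m q qm z])
  have oneL: "(\<lambda>x :: real^'n. 1 :: real) \<in> Lvar q \<Omega>" by (rule Lvar_const[OF \<Omega>m q qm])
  have oneV: "(\<lambda>x :: real^'n. 1 :: real) \<in> V" using V unfolding fe_space_def by blast
  have P1: "AE x in lebesgue_on \<Omega>. P (\<lambda>x. 1) x = 1"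
    using P oneV unfolding linear_projection_def by fastforce
  have lin: "\<forall>z\<in>Lvar q \<Omega>. \<forall>w\<in>Lvar q \<Omega>. \<forall>a b.
      AE x in lebesgue_on \<Omega>. P (\<lambda>y. a * z y + b * w y) x = a * P z x + b * P w x"
    using P unfolding linear_projection_def by blast
  have "AE x in lebesgue_on \<Omega>. P (\<lambda>y. 1 * z y + (- zm) * 1) x = 1 * P z x + (- zm) * P (\<lambda>x. 1) x"
    using lin[rule_format, OF z oneL, of 1 "- zm"] .
  then have Pz': "AE x in lebesgue_on \<Omega>. P z' x = P z x - zm"
    using P1 by eventually_elim (simp add: z'_def)
  have "P z' \<in> V" using P z'L unfolding linear_projection_def by blast
  then obtain Q where Q: "poly_of_degree_le l Q" "AE x in lebesgue_on T. P z' x = Q x"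
    using V T unfolding fe_space_def piecewise_poly_def by blast
  have Qm: "Q \<in> borel_measurable (lebesgue_on T)"
    by (rule continuous_imp_measurable_on_sets_lebesgue[OF continuous_on_poly_of_degree_le[OF Q(1)] pf(2)])
  have Pm: "P z' \<in> borel_measurable (lebesgue_on T)"
    by (rule borel_measurable_lebesgue_on_AE_eq[OF pf(2) Q(2) Qm])
  have "mean_on T (\<lambda>x. \<bar>P z' x\<bar>) = integral\<^sup>L (lebesgue_on T) (\<lambda>x. \<bar>P z' x\<bar>) / measure lebesgue T"
    by (simp add: mean_on_eq[OF pf(2)])
  also have "integral\<^sup>L (lebesgue_on T) (\<lambda>x. \<bar>P z' x\<bar>) = integral\<^sup>L (lebesgue_on T) (\<lambda>x. \<bar>Q x\<bar>)"
    using Pm Qm Q(2) by (intro integral_cong_AE) auto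
  also have "\<dots> = (LINT x:T|lebesgue. \<bar>Q x\<bar>)"
    using pf(2) by (simp add: set_lebesgue_integral_def integral_restrict_space)
  finally have meanT: "mean_on T (\<lambda>x. \<bar>P z' x\<bar>) = (LINT x:T|lebesgue. \<bar>Q x\<bar>) / measure lebesgue T" .
  have z'm: "(\<lambda>x. \<bar>z' x\<bar>) \<in> borel_measurable (lebesgue_on D)"
    unfolding z'_def using borel_measurable_integrable[OF zint] by measurable
  have "mean_on ?M (\<lambda>x. \<bar>z' x\<bar>) = integral\<^sup>L (lebesgue_on D) (\<lambda>x. \<bar>z' x\<bar>) / measure lebesgue D"
    by (simp add: mean_on_eq[OF pf(1)] D0(2)
        integral_lebesgue_on_negligible_diff[OF Dl(2) pf(1) Dl(4,5) z'm])
  also have "\<dots> \<le> 2 * R * gm" using osc(2) by (simp add: z'_def)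
  finally have meanM: "mean_on ?M (\<lambda>x. \<bar>z' x\<bar>) \<le> 2 * R * gm" .
  have "mean_on T (\<lambda>x. \<bar>P z' x\<bar>) \<le> stab * mean_on ?M (\<lambda>x. \<bar>z' x\<bar>)"
    using stab(1) z'L T unfolding locally_L1_stable_def by blast
  also have "\<dots> \<le> stab * (2 * R * gm)" using meanM stab(2) by (intro mult_left_mono) auto
  finally have stabT: "(LINT x:T|lebesgue. \<bar>Q x\<bar>) / measure lebesgue T \<le> stab * (2 * R * gm)"
    unfolding meanT .
  have Qbound: "\<bar>Q x\<bar> \<le> ?C * (stab * (2 * R * gm))" if x: "x \<in> T" for x
  proof -
    have "\<bar>Q x\<bar> * measure lebesgue T \<le> ?C * (LINT y:T|lebesgue. \<bar>Q y\<bar>)"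
      by (rule poly_sup_le_integral[OF Q(1) conforming_mesh_simplex(2,3)[OF mesh T] x])
    then have "\<bar>Q x\<bar> \<le> ?C * (LINT y:T|lebesgue. \<bar>Q y\<bar>) / measure lebesgue T"
      using pf(12) by (simp only: pos_le_divide_eq)
    also have "\<dots> = ?C * ((LINT y:T|lebesgue. \<bar>Q y\<bar>) / measure lebesgue T)" by simp
    also have "\<dots> \<le> ?C * (stab * (2 * R * gm))" using stabT by (intro mult_left_mono) auto
    finally show ?thesis .
  qed
  have gm0: "0 \<le> gm"
  proof -
    have "0 \<le> integral\<^sup>L (lebesgue_on D) g"
      by (rule integral_nonneg_AE) (use g0 Dl in \<open>auto intro!: AE_I2\<close>)
    then show ?thesis using D0 by (simp add: gm_def)
  qed
  have RL: "R \<le> 3 * ?\<Lambda> * h powr \<gamma>"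
  proof -
    have "R = (3 * ?\<Lambda>) powr \<gamma> * h powr \<gamma>" unfolding R_def using \<Lambda> h0 by (intro powr_mult)
    also have "\<dots> \<le> (3 * ?\<Lambda>) powr 1 * h powr \<gamma>"
      using \<Lambda> \<gamma> by (intro mult_right_mono powr_mono) auto
    finally show ?thesis using \<Lambda> by simp
  qed
  let ?D0 = "T \<inter> \<Omega>"
  have sub: "AE x in lebesgue_on ?D0. S x" if "AE x in lebesgue_on B. S x" "?D0 \<subseteq> B" "B \<in> sets lebesgue" for S B
    using that pf(6) by (auto simp: AE_restrict_space_iff elim!: eventually_mono)
  have "AE x in lebesgue_on ?D0. x \<in> ?D0" using AE_space[of "lebesgue_on ?D0"] pf(6) by simp
  moreover have "AE x in lebesgue_on ?D0. \<bar>z x - zm\<bar> \<le> R * (g x + gm)"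
    by (rule sub[OF osc(1)]) (use pf Dl in \<open>auto simp: D_def\<close>)
  moreover have "AE x in lebesgue_on ?D0. P z' x = P z x - zm" by (rule sub[OF Pz' _ \<Omega>s]) auto
  moreover have "AE x in lebesgue_on ?D0. P z' x = Q x" by (rule sub[OF Q(2) _ pf(2)]) auto
  ultimately show ?thesis
  proof eventually_elim
    fix x assume x: "x \<in> ?D0" and a: "\<bar>z x - zm\<bar> \<le> R * (g x + gm)" and b: "P z' x = P z x - zm" and c: "P z' x = Q x"
    have gx: "0 \<le> g x" using g0 x by auto
    have "\<bar>z x - P z x\<bar> \<le> \<bar>z x - zm\<bar> + \<bar>Q x\<bar>" using b c by linarith
    also have "\<dots> \<le> R * (g x + gm) + ?C * (stab * (2 * R * gm))"
      using a Qbound[of x] x by (intro add_mono) auto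
    also have "\<dots> \<le> R * (g x + gm) + ?C * (stab * (2 * R * (g x + gm)))"
      using gx R0 stab(2) by (intro add_left_mono mult_left_mono) auto
    also have "\<dots> = R * ((1 + 2 * (?C * stab)) * (g x + gm))" by (simp add: algebra_simps)
    also have "\<dots> \<le> (3 * ?\<Lambda> * h powr \<gamma>) * ((1 + 2 * (?C * stab)) * (g x + gm))"
      using RL gx gm0 stab(2) by (intro mult_right_mono) auto
    also have "\<dots> = projection_constant l (3 * ?\<Lambda>) stab CARD('n) * (h powr \<gamma> * g x + h powr \<gamma> * gm)"
      by (simp add: projection_constant_def algebra_simps)
    finally show "\<bar>z x - P z x\<bar> \<le> projection_constant l (3 * ?\<Lambda>) stab CARD('n) * (h powr \<gamma> * g x + h powr \<gamma> * gm)" .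
  qed
qed

lemma norm_sym_part_le:
  fixes A :: "real^'n^'n"
  shows "norm (sym_part A) \<le> norm A"
proof -
  have "(norm (transpose A))\<^sup>2 = (norm A)\<^sup>2"
    unfolding power2_norm_eq_inner inner_vec_def transpose_def
    by (simp add: sum.swap[of "\<lambda>i j. A $ j $ i * A $ j $ i"])
  then have "norm (transpose A) = norm A" by simp
  then have "norm (A + transpose A) \<le> 2 * norm A" using norm_triangle_ineq[of A "transpose A"] by simp
  then show ?thesis by (simp add: sym_part_def)
qed

lemma continuous_on_sym_part: "continuous_on S (sym_part :: real^'n^'n \<Rightarrow> real^'n^'n)"
proof -
  have "linear (transpose :: real^'n^'n \<Rightarrow> real^'n^'n)"
    by (rule linearI) (simp_all add: transpose_def vec_eq_iff)
  then have "continuous_on S (transpose :: real^'n^'n \<Rightarrow> real^'n^'n)" by (intro linear_continuous_on linear_linear[THEN iffD2])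
  then show ?thesis unfolding sym_part_def by (intro continuous_intros)
qed

text \<open>
Supplies the hypotheses of \<open>conj_modular_local_estimate\<close>: the means of \<open>g\<close> and \<open>A\<close> are at most of order
\<open>h\<^sup>-\<^sup>d\<close> since \<open>D\<close> has volume at least of order \<open>h\<^sup>d\<close>, and the oscillation of \<open>p\<close> on the patch is of order
\<open>h\<^sup>\<alpha>\<close> since its diameter is of order \<open>h\<close>. The factor \<open>measure lebesgue T\<close> is kept for the summation over the
mesh.
\<close>

lemma projection_error_modular_local:
  fixes l :: nat and m pm pp \<alpha> ph \<delta> W nA nz stab :: real
  assumes dim: "2 \<le> CARD('n::finite)" and pm: "1 < pm" and \<alpha>: "0 < \<alpha>" and ph: "0 \<le> ph" and \<delta>: "0 \<le> \<delta>"
    and stab: "0 < stab" and W1: "1 \<le> W"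
  obtains C where "1 \<le> C"
    "\<And>(\<Omega> :: (real^'n) set) \<T> V P p \<gamma> z g (A :: real^'n \<Rightarrow> real^'n^'n) T.
       lipschitz_domain \<Omega> \<Longrightarrow> bounded \<Omega> \<Longrightarrow> conforming_mesh \<Omega> \<T> \<Longrightarrow> shape_regular \<T> W \<Longrightarrow> T \<in> \<T> \<Longrightarrow> diameter T \<le> 1 \<Longrightarrow>
       (\<And>x. x \<in> \<Omega> \<Longrightarrow> pm \<le> p x \<and> p x \<le> pp) \<Longrightarrow>
       (\<And>x y. x \<in> \<Omega> \<Longrightarrow> y \<in> \<Omega> \<Longrightarrow> \<bar>p x - p y\<bar> \<le> ph * dist x y powr \<alpha>) \<Longrightarrow>
       p \<in> borel_measurable (lebesgue_on \<Omega>) \<Longrightarrow>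
       fe_space l \<T> V \<Longrightarrow> linear_projection \<Omega> (Lvar (dual_exponent p) \<Omega>) V P \<Longrightarrow>
       locally_L1_stable stab \<T> (Lvar (dual_exponent p) \<Omega>) P \<Longrightarrow>
       0 < \<gamma> \<Longrightarrow> \<gamma> \<le> 1 \<Longrightarrow> z \<in> Lvar (dual_exponent p) \<Omega> \<Longrightarrow>
       g \<in> hajlasz_gradients \<gamma> (dual_exponent p) \<Omega> z \<Longrightarrow> Lvar_norm (dual_exponent p) \<Omega> g \<le> nz \<Longrightarrow>
       A \<in> Lvar p \<Omega> \<Longrightarrow> Lvar_norm p \<Omega> A \<le> nA \<Longrightarrow>
       conj_modular \<delta> p (\<lambda>x. norm (sym_part (A x))) T (\<lambda>x. z x - P z x) \<le> ennreal C *
         (ennreal (diameter T powr m * measure lebesgue T)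
          + conj_modular \<delta> p (\<lambda>x. norm (sym_part (A x))) (patch \<T> T) (\<lambda>x. diameter T powr \<gamma> * g x)
          + L2_norm_squared (patch \<T> T) (\<lambda>x. F_map \<delta> p x (A x) - F_map \<delta> p x (mean_on (patch \<T> T) A)))"
proof -
  let ?\<Lambda> = "size_ratio TYPE(real^'n) W"
  have \<Lambda>: "1 \<le> ?\<Lambda>" using W1 by (rule size_ratio_ge_1)
  define d where "d = real CARD('n)"
  define K where "K = ph * (3 * ?\<Lambda>) powr \<alpha>"
  define v where "v = unit_ball_vol (real CARD('n))"
  define \<kappa> where "\<kappa> = (4 * W) ^ CARD('n) / v"
  define B where "B = 1 + \<delta> + (\<bar>nz\<bar> + \<bar>nA\<bar> + 1) * (1 + \<kappa>)"
  define C0 where "C0 = projection_constant l (3 * ?\<Lambda>) stab CARD('n)"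
  have v: "0 < v" by (simp add: v_def)
  have \<kappa>: "0 < \<kappa>" using v W1 by (simp add: \<kappa>_def)
  have K: "0 \<le> K" using ph by (simp add: K_def)
  have d: "0 \<le> d" by (simp add: d_def)
  have B: "1 \<le> B" using \<delta> \<kappa> by (simp add: B_def)
  have C0: "1 \<le> C0"
  proof -
    have "1 * 1 \<le> 3 * ?\<Lambda> * (1 + 2 * (2 ^ Suc l * real (Suc l) ^ CARD('n) * stab))"
      using \<Lambda> stab by (intro mult_mono) auto
    then show ?thesis by (simp add: C0_def projection_constant_def)
  qed
  obtain C where C: "1 \<le> C"
    "\<And>\<delta> p (X :: real^'n \<Rightarrow> real^'n^'n) Y t u r h D T. 0 \<le> \<delta> \<Longrightarrow> 0 < h \<Longrightarrow> h \<le> 1 \<Longrightarrow>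
      D \<in> lmeasurable \<Longrightarrow> 0 < measure lebesgue D \<Longrightarrow> T \<in> sets lebesgue \<Longrightarrow> T \<subseteq> D \<Longrightarrow>
      p \<in> borel_measurable (lebesgue_on D) \<Longrightarrow> X \<in> borel_measurable (lebesgue_on D) \<Longrightarrow>
      integrable (lebesgue_on D) t \<Longrightarrow>
      (\<And>x. x \<in> D \<Longrightarrow> pm \<le> p x \<and> p x \<le> pp) \<Longrightarrow>
      (\<And>x y. x \<in> D \<Longrightarrow> y \<in> D \<Longrightarrow> \<bar>p x - p y\<bar> \<le> K * h powr \<alpha>) \<Longrightarrow>
      (\<And>x. x \<in> D \<Longrightarrow> 0 \<le> t x) \<Longrightarrow>
      measure lebesgue D * u = integral\<^sup>L (lebesgue_on D) t \<Longrightarrow>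
      u \<le> B * h powr (- d) \<Longrightarrow> \<delta> + norm Y \<le> B * h powr (- d) \<Longrightarrow>
      (AE x in lebesgue_on T. \<bar>r x\<bar> \<le> C0 * (t x + u)) \<Longrightarrow>
      conj_modular \<delta> p (\<lambda>x. norm (X x)) T r \<le> ennreal C *
        (ennreal (h powr m * measure lebesgue T) + conj_modular \<delta> p (\<lambda>x. norm (X x)) D t
         + L2_norm_squared D (\<lambda>x. weighted \<delta> (p x) (X x) - weighted \<delta> (p x) Y))"
    by (rule conj_modular_local_estimate[OF pm \<alpha> K d B C0, of pp m]) blast
  show ?thesis
  proof (rule that[OF C(1)])
    fix \<Omega> :: "(real^'n) set" and \<T> V P p \<gamma> z g and A :: "real^'n \<Rightarrow> real^'n^'n" and T
    assume dom: "lipschitz_domain \<Omega>" and bd: "bounded \<Omega>" and mesh: "conforming_mesh \<Omega> \<T>"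
      and W: "shape_regular \<T> W" and T: "T \<in> \<T>" and h1: "diameter T \<le> 1"
      and p: "\<And>x. x \<in> \<Omega> \<Longrightarrow> pm \<le> p x \<and> p x \<le> pp"
      and pH: "\<And>x y. x \<in> \<Omega> \<Longrightarrow> y \<in> \<Omega> \<Longrightarrow> \<bar>p x - p y\<bar> \<le> ph * dist x y powr \<alpha>"
      and pmeas [measurable]: "p \<in> borel_measurable (lebesgue_on \<Omega>)"
      and V: "fe_space l \<T> V" and P: "linear_projection \<Omega> (Lvar (dual_exponent p) \<Omega>) V P"
      and st: "locally_L1_stable stab \<T> (Lvar (dual_exponent p) \<Omega>) P"
      and \<gamma>: "0 < \<gamma>" "\<gamma> \<le> 1" and z: "z \<in> Lvar (dual_exponent p) \<Omega>"
      and g: "g \<in> hajlasz_gradients \<gamma> (dual_exponent p) \<Omega> z" and gn: "Lvar_norm (dual_exponent p) \<Omega> g \<le> nz"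
      and A: "A \<in> Lvar p \<Omega>" and An: "Lvar_norm p \<Omega> A \<le> nA"
    let ?M = "patch \<T> T" and ?q = "dual_exponent p"
    define D where "D = ?M \<inter> \<Omega>"
    define h where "h = diameter T"
    define gm where "gm = integral\<^sup>L (lebesgue_on D) g / measure lebesgue D"
    define Y where "Y = sym_part (mean_on ?M A)"
    note pf = patch_domain_facts[OF dom mesh T]
    have \<Omega>l: "\<Omega> \<in> lmeasurable" using dom bd by (simp add: lipschitz_domain_def lmeasurable_open)
    have \<Omega>s: "\<Omega> \<in> sets lebesgue" using \<Omega>l by (simp add: fmeasurableD)
    have Dl: "D \<in> lmeasurable" "D \<in> sets lebesgue" "D \<subseteq> \<Omega>" "D \<subseteq> ?M" "negligible (?M - D)" "T \<inter> \<Omega> \<subseteq> D"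
      using pf by (auto simp: D_def fmeasurableD)
    have D0: "0 < measure lebesgue D" "measure lebesgue D = measure lebesgue ?M" using pf by (auto simp: D_def)
    have h0: "0 < h" "h \<le> 1" using conforming_mesh_simplex(5)[OF mesh T] h1 by (auto simp: h_def)
    have q: "1 \<le> ?q x \<and> ?q x \<le> pm / (pm - 1)" if "x \<in> \<Omega>" for x
      using conj_exponent_bounds[OF pm, of "p x"] p[OF that] by (simp add: dual_exponent_def)
    have q1: "\<And>x. x \<in> \<Omega> \<Longrightarrow> 1 \<le> ?q x" using q by blast
    have p1: "\<And>x. x \<in> \<Omega> \<Longrightarrow> 1 \<le> p x" using p pm by force
    have qmeas: "?q \<in> borel_measurable (lebesgue_on \<Omega>)" unfolding dual_exponent_def[abs_def] by measurable
    have hd: "1 \<le> h powr (- d)"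
      using h0 d powr_mono'[of "- d" 0 h] by simp
    have meanbound: "N / measure lebesgue D \<le> (n + 1) * (1 + \<kappa>) * h powr (- d)"
      if N: "N \<le> (n + 1) * (measure lebesgue D + 1)" and n: "0 \<le> n" for N n
    proof -
      have "v * (h / (4 * W)) ^ CARD('n) \<le> measure lebesgue D"
        using mesh_element_volume(1)[OF mesh W T] pf(11) D0 by (simp add: v_def h_def)
      moreover have "v * (h / (4 * W)) ^ CARD('n) = h ^ CARD('n) / \<kappa>"
        using v W1 by (simp add: \<kappa>_def power_divide)
      ultimately have hD: "h ^ CARD('n) / \<kappa> \<le> measure lebesgue D" by simp
      have "0 < h ^ CARD('n) / \<kappa>" using h0 \<kappa> by simp
      then have "1 / measure lebesgue D \<le> 1 / (h ^ CARD('n) / \<kappa>)"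
        using hD D0(1) by (intro divide_left_mono mult_pos_pos) auto
      also have "\<dots> = \<kappa> * h powr (- d)"
        using h0 by (simp add: d_def powr_minus powr_realpow divide_inverse)
      finally have inv: "1 / measure lebesgue D \<le> \<kappa> * h powr (- d)" .
      have "N / measure lebesgue D \<le> (n + 1) * (measure lebesgue D + 1) / measure lebesgue D"
        using N D0 by (intro divide_right_mono) auto
      also have "\<dots> = (n + 1) * (1 + 1 / measure lebesgue D)" using D0(1) by (simp add: field_simps)
      also have "\<dots> \<le> (n + 1) * (h powr (- d) + \<kappa> * h powr (- d))"
        using inv hd n by (intro mult_left_mono add_mono) auto
      finally show ?thesis by (simp add: algebra_simps)
    qed
    have gL: "g \<in> Lvar ?q \<Omega>" and g0: "\<And>x. x \<in> \<Omega> \<Longrightarrow> 0 \<le> g x"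
      using g unfolding hajlasz_gradients_def by auto
    note gi = Lvar_integrable[OF \<Omega>s q1 qmeas gL Dl(1,3)]
    note Ai = Lvar_integrable[OF \<Omega>s p1 pmeas A Dl(1,3)]
    have g_nonneg: "0 \<le> Lvar_norm ?q \<Omega> g" by (rule Lvar_norm_nonneg[OF Lvar_modular_le_1[OF \<Omega>s q1 qmeas gL]])
    have A_nonneg: "0 \<le> Lvar_norm p \<Omega> A" by (rule Lvar_norm_nonneg[OF Lvar_modular_le_1[OF \<Omega>s p1 pmeas A]])
    have nzA: "0 \<le> nz" "0 \<le> nA" using g_nonneg A_nonneg gn An by auto
    have gm_le: "gm \<le> (nz + 1) * (1 + \<kappa>) * h powr (- d)"
      unfolding gm_def
    proof (rule meanbound[OF _ nzA(1)])
      have "integral\<^sup>L (lebesgue_on D) g \<le> integral\<^sup>L (lebesgue_on D) (\<lambda>x. norm (g x))"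
        using gi(1) by (intro integral_mono) auto
      also have "\<dots> \<le> (Lvar_norm ?q \<Omega> g + 1) * (measure lebesgue D + 1)" by (rule gi(2))
      also have "\<dots> \<le> (nz + 1) * (measure lebesgue D + 1)" using gn by (intro mult_right_mono) auto
      finally show "integral\<^sup>L (lebesgue_on D) g \<le> (nz + 1) * (measure lebesgue D + 1)" .
    qed
    have Am: "A \<in> borel_measurable (lebesgue_on D)" using Ai(1) by (rule borel_measurable_integrable)
    have Y_le: "norm Y \<le> (nA + 1) * (1 + \<kappa>) * h powr (- d)"
    proof -
      have "norm Y \<le> norm (mean_on ?M A)" unfolding Y_def by (rule norm_sym_part_le)
      also have "mean_on ?M A = (1 / measure lebesgue D) *\<^sub>R integral\<^sup>L (lebesgue_on D) A"
        by (simp add: mean_on_eq[OF pf(1)] D0(2) integral_lebesgue_on_negligible_diff[OF Dl(2) pf(1) Dl(4,5) Am])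
      also have "norm \<dots> = norm (integral\<^sup>L (lebesgue_on D) A) / measure lebesgue D" using D0(1) by simp
      also have "\<dots> \<le> (nA + 1) * (1 + \<kappa>) * h powr (- d)"
      proof (rule meanbound[OF _ nzA(2)])
        have "norm (integral\<^sup>L (lebesgue_on D) A) \<le> integral\<^sup>L (lebesgue_on D) (\<lambda>x. norm (A x))"
          by (rule integral_norm_bound)
        also have "\<dots> \<le> (Lvar_norm p \<Omega> A + 1) * (measure lebesgue D + 1)" by (rule Ai(2))
        also have "\<dots> \<le> (nA + 1) * (measure lebesgue D + 1)" using An by (intro mult_right_mono) auto
        finally show "norm (integral\<^sup>L (lebesgue_on D) A) \<le> (nA + 1) * (measure lebesgue D + 1)" .
      qed
      finally show ?thesis .
    qed
    have gm0: "0 \<le> gm"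
    proof -
      have "0 \<le> integral\<^sup>L (lebesgue_on D) g"
        by (rule integral_nonneg_AE) (use g0 Dl in \<open>auto intro!: AE_I2\<close>)
      then show ?thesis using D0 by (simp add: gm_def)
    qed
    have h\<gamma>: "h powr \<gamma> \<le> 1" using h0 \<gamma> by (simp add: powr_le1)
    have u_le: "h powr \<gamma> * gm \<le> B * h powr (- d)"
    proof -
      have "h powr \<gamma> * gm \<le> 1 * gm" using h\<gamma> gm0 by (intro mult_right_mono)
      also have "\<dots> \<le> (nz + 1) * (1 + \<kappa>) * h powr (- d)" using gm_le by simp
      also have "\<dots> \<le> B * h powr (- d)"
      proof (rule mult_right_mono)
        have "(nz + 1) * (1 + \<kappa>) \<le> (\<bar>nz\<bar> + \<bar>nA\<bar> + 1) * (1 + \<kappa>)" using \<kappa> by (intro mult_right_mono) auto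
        then show "(nz + 1) * (1 + \<kappa>) \<le> B" using \<delta> by (simp add: B_def)
      qed simp
      finally show ?thesis .
    qed
    have b_le: "\<delta> + norm Y \<le> B * h powr (- d)"
    proof -
      have "\<delta> + norm Y \<le> \<delta> * h powr (- d) + (nA + 1) * (1 + \<kappa>) * h powr (- d)"
        using Y_le hd \<delta> by (intro add_mono) (auto simp: mult_le_cancel_left1)
      also have "\<dots> = (\<delta> + (nA + 1) * (1 + \<kappa>)) * h powr (- d)" by (simp add: algebra_simps)
      also have "\<dots> \<le> B * h powr (- d)"
      proof (rule mult_right_mono)
        have "(nA + 1) * (1 + \<kappa>) \<le> (\<bar>nz\<bar> + \<bar>nA\<bar> + 1) * (1 + \<kappa>)" using \<kappa> by (intro mult_right_mono) auto
        then show "\<delta> + (nA + 1) * (1 + \<kappa>) \<le> B" by (simp add: B_def)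
      qed simp
      finally show ?thesis .
    qed
    have main: "conj_modular \<delta> p (\<lambda>x. norm (sym_part (A x))) (T \<inter> \<Omega>) (\<lambda>x. z x - P z x) \<le> ennreal C *
        (ennreal (h powr m * measure lebesgue (T \<inter> \<Omega>)) + conj_modular \<delta> p (\<lambda>x. norm (sym_part (A x))) D (\<lambda>x. h powr \<gamma> * g x)
         + L2_norm_squared D (\<lambda>x. weighted \<delta> (p x) (sym_part (A x)) - weighted \<delta> (p x) Y))"
    proof (rule C(2)[OF \<delta> h0 Dl(1) D0(1) pf(6) Dl(6) _ _ _ _ _ _ _ u_le b_le])
      show "p \<in> borel_measurable (lebesgue_on D)" by (rule measurable_restrict_mono[OF pmeas Dl(3)])
      show "(\<lambda>x. sym_part (A x)) \<in> borel_measurable (lebesgue_on D)"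
        by (rule measurable_compose[OF Am borel_measurable_continuous_onI[OF continuous_on_sym_part]])
      show "integrable (lebesgue_on D) (\<lambda>x. h powr \<gamma> * g x)" using gi(1) by simp
      show "pm \<le> p x \<and> p x \<le> pp" if "x \<in> D" for x using p that Dl by blast
      show "\<bar>p x - p y\<bar> \<le> K * h powr \<alpha>" if "x \<in> D" "y \<in> D" for x y
      proof -
        have "dist x y \<le> 3 * ?\<Lambda> * h"
          unfolding h_def using that Dl dim by (intro patch_dist_le[OF dom _ mesh W T]) auto
        then have "dist x y powr \<alpha> \<le> (3 * ?\<Lambda> * h) powr \<alpha>" using \<alpha> by (intro powr_mono2) auto
        also have "\<dots> = (3 * ?\<Lambda>) powr \<alpha> * h powr \<alpha>" using \<Lambda> h0 by (intro powr_mult)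
        finally have "ph * dist x y powr \<alpha> \<le> ph * ((3 * ?\<Lambda>) powr \<alpha> * h powr \<alpha>)" using ph by (rule mult_left_mono)
        moreover have "\<bar>p x - p y\<bar> \<le> ph * dist x y powr \<alpha>" using pH that Dl(3) by blast
        ultimately show ?thesis by (simp add: K_def mult.assoc)
      qed
      show "0 \<le> h powr \<gamma> * g x" if "x \<in> D" for x using g0 that Dl by auto
      show "measure lebesgue D * (h powr \<gamma> * gm) = integral\<^sup>L (lebesgue_on D) (\<lambda>x. h powr \<gamma> * g x)"
        using D0(1) by (simp add: gm_def)
      show "AE x in lebesgue_on (T \<inter> \<Omega>). \<bar>z x - P z x\<bar> \<le> C0 * (h powr \<gamma> * g x + h powr \<gamma> * gm)"
        unfolding C0_def gm_def h_def D_def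
        by (rule projection_error_le[OF dom dim mesh W T \<Omega>l q qmeas V P st stab \<gamma> z g])
    qed
    have T\<Omega>: "conj_modular \<delta> p a T r = conj_modular \<delta> p a (T \<inter> \<Omega>) r" for a r
      unfolding conj_modular_def
      by (rule nn_integral_lebesgue_on_negligible_diff[OF pf(6) pf(2) _ pf(8)]) auto
    have MD: "conj_modular \<delta> p a ?M r = conj_modular \<delta> p a D r" for a r
      unfolding conj_modular_def
      by (rule nn_integral_lebesgue_on_negligible_diff[OF Dl(2) pf(1) Dl(4,5)])
    have MDL: "L2_norm_squared ?M f = L2_norm_squared D f" for f :: "real^'n \<Rightarrow> real^'n^'n"
      unfolding L2_norm_squared_def
      by (rule nn_integral_lebesgue_on_negligible_diff[OF Dl(2) pf(1) Dl(4,5)])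
    show "conj_modular \<delta> p (\<lambda>x. norm (sym_part (A x))) T (\<lambda>x. z x - P z x) \<le> ennreal C *
         (ennreal (diameter T powr m * measure lebesgue T)
          + conj_modular \<delta> p (\<lambda>x. norm (sym_part (A x))) ?M (\<lambda>x. diameter T powr \<gamma> * g x)
          + L2_norm_squared ?M (\<lambda>x. F_map \<delta> p x (A x) - F_map \<delta> p x (mean_on ?M A)))"
      using main unfolding T\<Omega> MD MDL pf(10) F_map_def Y_def h_def .
  qed
qed

section \<open>Summation over the mesh\<close>

lemma sum_nn_integral_overlap_le:
  fixes S :: "'i \<Rightarrow> 'a::euclidean_space set" and f :: "'a \<Rightarrow> ennreal"
  assumes I: "finite I" and S: "\<And>i. i \<in> I \<Longrightarrow> S i \<in> sets lebesgue" and \<Omega>: "\<Omega> \<in> sets lebesgue"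
    and f: "f \<in> borel_measurable (lebesgue_on \<Omega>)" and N: "\<And>x. x \<in> \<Omega> \<Longrightarrow> real (card {i \<in> I. x \<in> S i}) \<le> N"
  shows "(\<Sum>i\<in>I. \<integral>\<^sup>+x. f x \<partial>lebesgue_on (S i \<inter> \<Omega>)) \<le> ennreal N * (\<integral>\<^sup>+x. f x \<partial>lebesgue_on \<Omega>)"
proof -
  have fS: "(\<lambda>x. f x * indicator (S i) x) \<in> borel_measurable (lebesgue_on \<Omega>)" if "i \<in> I" for i
  proof -
    have "S i \<inter> \<Omega> \<in> sets (lebesgue_on \<Omega>)" using S[OF that] \<Omega> by (auto simp: sets_restrict_space)
    then have "(\<lambda>x. f x * indicator (S i \<inter> \<Omega>) x) \<in> borel_measurable (lebesgue_on \<Omega>)"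
      using f by measurable
    then show ?thesis
      by (rule measurable_cong[THEN iffD1, rotated]) (use \<Omega> in \<open>auto split: split_indicator\<close>)
  qed
  have "(\<Sum>i\<in>I. \<integral>\<^sup>+x. f x \<partial>lebesgue_on (S i \<inter> \<Omega>)) = (\<Sum>i\<in>I. \<integral>\<^sup>+x. f x * indicator (S i) x \<partial>lebesgue_on \<Omega>)"
  proof (rule sum.cong)
    fix i assume i: "i \<in> I"
    show "(\<integral>\<^sup>+x. f x \<partial>lebesgue_on (S i \<inter> \<Omega>)) = (\<integral>\<^sup>+x. f x * indicator (S i) x \<partial>lebesgue_on \<Omega>)"
      using S[OF i] \<Omega> by (simp add: nn_integral_restrict_space indicator_inter_arith mult.assoc)
  qed simp
  also have "\<dots> = (\<integral>\<^sup>+x. (\<Sum>i\<in>I. f x * indicator (S i) x) \<partial>lebesgue_on \<Omega>)"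
    by (rule nn_integral_sum[symmetric]) (rule fS)
  also have "\<dots> \<le> (\<integral>\<^sup>+x. ennreal N * f x \<partial>lebesgue_on \<Omega>)"
  proof (rule nn_integral_mono)
    fix x assume "x \<in> space (lebesgue_on \<Omega>)"
    then have x: "x \<in> \<Omega>" using \<Omega> by simp
    have "(\<Sum>i\<in>I. f x * indicator (S i) x) = f x * (\<Sum>i\<in>I. indicator (S i) x)"
      by (rule sum_distrib_left[symmetric])
    also have "(\<Sum>i\<in>I. indicator (S i) x :: ennreal) = of_nat (card {i \<in> I. x \<in> S i})"
      using I by (simp add: indicator_def sum.If_cases Int_def)
    also have "\<dots> = ennreal (real (card {i \<in> I. x \<in> S i}))" by (simp add: ennreal_of_nat_eq_real_of_nat)
    also have "f x * \<dots> \<le> f x * ennreal N" by (intro mult_left_mono ennreal_leI N x) simp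
    finally show "(\<Sum>i\<in>I. f x * indicator (S i) x) \<le> ennreal N * f x" by (simp add: mult.commute)
  qed
  also have "\<dots> = ennreal N * (\<integral>\<^sup>+x. f x \<partial>lebesgue_on \<Omega>)" by (rule nn_integral_cmult[OF f])
  finally show ?thesis .
qed

text \<open>
For a nonmeasurable \<open>f\<close> additivity of the integral may fail, but the integral is the supremum over the simple functions
below \<open>f\<close>, and for these it holds. This serves the conjugate, which is a supremum over an uncountable set.
\<close>

lemma nn_integral_le_sum_cover:
  fixes S :: "'i \<Rightarrow> 'a::euclidean_space set" and f :: "'a \<Rightarrow> ennreal"
  assumes I: "finite I" and S: "\<And>i. i \<in> I \<Longrightarrow> S i \<in> sets lebesgue" and \<Omega>: "\<Omega> \<in> sets lebesgue"
    and cover: "\<Omega> \<subseteq> (\<Union>i\<in>I. S i)"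
  shows "(\<integral>\<^sup>+x. f x \<partial>lebesgue_on \<Omega>) \<le> (\<Sum>i\<in>I. \<integral>\<^sup>+x. f x \<partial>lebesgue_on (S i \<inter> \<Omega>))"
  unfolding nn_integral_def[of "lebesgue_on \<Omega>"]
proof (rule SUP_least)
  fix s assume "s \<in> {g. simple_function (lebesgue_on \<Omega>) g \<and> g \<le> f}"
  then have s: "simple_function (lebesgue_on \<Omega>) s" "s \<le> f" by auto
  have sm: "s \<in> borel_measurable (lebesgue_on \<Omega>)" by (rule borel_measurable_simple_function[OF s(1)])
  have sS: "(\<lambda>x. s x * indicator (S i) x) \<in> borel_measurable (lebesgue_on \<Omega>)" if "i \<in> I" for i
  proof -
    have "S i \<inter> \<Omega> \<in> sets (lebesgue_on \<Omega>)" using S[OF that] \<Omega> by (auto simp: sets_restrict_space)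
    then have "(\<lambda>x. s x * indicator (S i \<inter> \<Omega>) x) \<in> borel_measurable (lebesgue_on \<Omega>)"
      using sm by measurable
    then show ?thesis
      by (rule measurable_cong[THEN iffD1, rotated]) (use \<Omega> in \<open>auto split: split_indicator\<close>)
  qed
  have "integral\<^sup>S (lebesgue_on \<Omega>) s = (\<integral>\<^sup>+x. s x \<partial>lebesgue_on \<Omega>)"
    by (rule nn_integral_eq_simple_integral[OF s(1), symmetric])
  also have "\<dots> \<le> (\<integral>\<^sup>+x. (\<Sum>i\<in>I. s x * indicator (S i) x) \<partial>lebesgue_on \<Omega>)"
  proof (rule nn_integral_mono)
    fix x assume "x \<in> space (lebesgue_on \<Omega>)"
    then obtain i where i: "i \<in> I" "x \<in> S i" using \<Omega> cover by auto
    then have "s x = s x * indicator (S i) x" by simp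
    also have "\<dots> \<le> (\<Sum>i\<in>I. s x * indicator (S i) x)" using i I by (intro member_le_sum) auto
    finally show "s x \<le> (\<Sum>i\<in>I. s x * indicator (S i) x)" .
  qed
  also have "\<dots> = (\<Sum>i\<in>I. \<integral>\<^sup>+x. s x * indicator (S i) x \<partial>lebesgue_on \<Omega>)"
    by (rule nn_integral_sum) (rule sS)
  also have "\<dots> \<le> (\<Sum>i\<in>I. \<integral>\<^sup>+x. f x \<partial>lebesgue_on (S i \<inter> \<Omega>))"
  proof (rule sum_mono)
    fix i assume i: "i \<in> I"
    have "(\<integral>\<^sup>+x. s x * indicator (S i) x \<partial>lebesgue_on \<Omega>) = (\<integral>\<^sup>+x. s x \<partial>lebesgue_on (S i \<inter> \<Omega>))"
      using S[OF i] \<Omega> by (simp add: nn_integral_restrict_space indicator_inter_arith mult.assoc)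
    also have "\<dots> \<le> (\<integral>\<^sup>+x. f x \<partial>lebesgue_on (S i \<inter> \<Omega>))"
      using s(2) by (intro nn_integral_mono) (simp add: le_fun_def)
    finally show "(\<integral>\<^sup>+x. s x * indicator (S i) x \<partial>lebesgue_on \<Omega>) \<le> (\<integral>\<^sup>+x. f x \<partial>lebesgue_on (S i \<inter> \<Omega>))" .
  qed
  finally show "integral\<^sup>S (lebesgue_on \<Omega>) s \<le> (\<Sum>i\<in>I. \<integral>\<^sup>+x. f x \<partial>lebesgue_on (S i \<inter> \<Omega>))" .
qed

text \<open>
Passing to \<open>shifted_power\<close> makes the integrand measurable, so that the overlap of the patches can be counted under the
integral.
\<close>

lemma sum_conj_modular_patches_le:
  fixes pm pp W :: real
  assumes pm: "1 < pm" and dim: "2 \<le> CARD('n::finite)"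
  obtains C where "1 \<le> C"
    "\<And>\<delta> (p :: real^'n \<Rightarrow> real) a g \<Omega> \<T> h \<gamma>. 0 \<le> \<delta> \<Longrightarrow> lipschitz_domain \<Omega> \<Longrightarrow> conforming_mesh \<Omega> \<T> \<Longrightarrow> shape_regular \<T> W \<Longrightarrow>
       (\<And>x. x \<in> \<Omega> \<Longrightarrow> pm \<le> p x \<and> p x \<le> pp) \<Longrightarrow>
       p \<in> borel_measurable (lebesgue_on \<Omega>) \<Longrightarrow> a \<in> borel_measurable (lebesgue_on \<Omega>) \<Longrightarrow>
       g \<in> borel_measurable (lebesgue_on \<Omega>) \<Longrightarrow> (\<And>x. 0 \<le> a x) \<Longrightarrow> (\<And>x. x \<in> \<Omega> \<Longrightarrow> 0 \<le> g x) \<Longrightarrow>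
       (\<And>T. T \<in> \<T> \<Longrightarrow> diameter T \<le> h) \<Longrightarrow> 0 < \<gamma> \<Longrightarrow>
       (\<Sum>T\<in>\<T>. conj_modular \<delta> p a (patch \<T> T) (\<lambda>x. diameter T powr \<gamma> * g x))
       \<le> ennreal C * conj_modular \<delta> p a \<Omega> (\<lambda>x. h powr \<gamma> * g x)"
proof -
  obtain Ce where Ce: "1 \<le> Ce"
    "\<And>\<delta> (p :: real^'n \<Rightarrow> real) a x t. 0 \<le> \<delta> \<Longrightarrow> 0 \<le> a \<Longrightarrow> 0 \<le> t \<Longrightarrow> pm \<le> p x \<Longrightarrow> p x \<le> pp \<Longrightarrow>
       phi_shift_conj \<delta> p a x t \<le> Ce * shifted_power (dual_exponent p x) ((\<delta> + a) powr (p x - 1)) t \<and>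
       shifted_power (dual_exponent p x) ((\<delta> + a) powr (p x - 1)) t \<le> Ce * phi_shift_conj \<delta> p a x t"
    using phi_shift_conj_equiv[OF pm] by metis
  define N where "N = \<bar>(4 * W) ^ CARD('n) * patch_size TYPE(real^'n) W\<bar> + 1"
  have N: "1 \<le> N" by (simp add: N_def)
  define C where "C = Ce * N * Ce"
  have "1 * 1 * 1 \<le> C" unfolding C_def using Ce(1) N by (intro mult_mono) auto
  then have C1: "1 \<le> C" by simp
  show ?thesis
  proof (rule that[OF C1])
    fix \<delta> h \<gamma> :: real and p a g :: "real^'n \<Rightarrow> real" and \<Omega> \<T>
    assume \<delta>: "0 \<le> \<delta>" and dom: "lipschitz_domain \<Omega>" and mesh: "conforming_mesh \<Omega> \<T>" and W: "shape_regular \<T> W"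
      and p: "\<And>x. x \<in> \<Omega> \<Longrightarrow> pm \<le> p x \<and> p x \<le> pp"
      and meas [measurable]: "p \<in> borel_measurable (lebesgue_on \<Omega>)" "a \<in> borel_measurable (lebesgue_on \<Omega>)"
        "g \<in> borel_measurable (lebesgue_on \<Omega>)"
      and a0: "\<And>x. 0 \<le> a x" and g0: "\<And>x. x \<in> \<Omega> \<Longrightarrow> 0 \<le> g x"
      and h: "\<And>T. T \<in> \<T> \<Longrightarrow> diameter T \<le> h" and \<gamma>: "0 < \<gamma>"
    have \<Omega>s: "\<Omega> \<in> sets lebesgue" using dom by (simp add: lipschitz_domain_def)
    define E where "E x = shifted_power (dual_exponent p x) ((\<delta> + a x) powr (p x - 1)) (h powr \<gamma> * g x)" for x
    have "dual_exponent p \<in> borel_measurable (lebesgue_on \<Omega>)" unfolding dual_exponent_def[abs_def] by measurable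
    then have Em [measurable]: "E \<in> borel_measurable (lebesgue_on \<Omega>)" unfolding E_def by measurable
    have E0: "0 \<le> E x" for x by (simp add: E_def)
    have pt: "phi_shift_conj \<delta> p (a x) x \<bar>diameter T powr \<gamma> * g x\<bar> \<le> Ce * E x" if "T \<in> \<T>" "x \<in> \<Omega>" for T x
    proof -
      have dT: "0 \<le> diameter T" using conforming_mesh_simplex(5)[OF mesh that(1)] by simp
      have t0: "0 \<le> diameter T powr \<gamma> * g x" using g0[OF that(2)] by simp
      have "phi_shift_conj \<delta> p (a x) x (diameter T powr \<gamma> * g x)
        \<le> Ce * shifted_power (dual_exponent p x) ((\<delta> + a x) powr (p x - 1)) (diameter T powr \<gamma> * g x)"
        using Ce(2)[of \<delta> "a x" "diameter T powr \<gamma> * g x" p x] \<delta> a0 t0 p[OF that(2)] by blast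
      also have "\<dots> \<le> Ce * E x"
        unfolding E_def
      proof (intro mult_left_mono shifted_power_mono mult_right_mono)
        show "0 \<le> dual_exponent p x" using p[OF that(2)] pm by (simp add: dual_exponent_def)
        show "diameter T powr \<gamma> \<le> h powr \<gamma>" using h[OF that(1)] dT \<gamma> by (intro powr_mono2) auto
      qed (use t0 g0[OF that(2)] Ce(1) in auto)
      finally show ?thesis using t0 by simp
    qed
    have "(\<Sum>T\<in>\<T>. conj_modular \<delta> p a (patch \<T> T) (\<lambda>x. diameter T powr \<gamma> * g x))
      \<le> (\<Sum>T\<in>\<T>. \<integral>\<^sup>+x. ennreal (Ce * E x) \<partial>lebesgue_on (patch \<T> T \<inter> \<Omega>))"
    proof (rule sum_mono)
      fix T assume T: "T \<in> \<T>"
      note pf = patch_domain_facts[OF dom mesh T]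
      have Ds: "patch \<T> T \<inter> \<Omega> \<in> sets lebesgue" using pf(5) by (simp add: fmeasurableD)
      have "conj_modular \<delta> p a (patch \<T> T) (\<lambda>x. diameter T powr \<gamma> * g x)
        = (\<integral>\<^sup>+x. ennreal (phi_shift_conj \<delta> p (a x) x \<bar>diameter T powr \<gamma> * g x\<bar>) \<partial>lebesgue_on (patch \<T> T \<inter> \<Omega>))"
        unfolding conj_modular_def
        by (rule nn_integral_lebesgue_on_negligible_diff[OF Ds pf(1) _ pf(7)]) auto
      also have "\<dots> \<le> (\<integral>\<^sup>+x. ennreal (Ce * E x) \<partial>lebesgue_on (patch \<T> T \<inter> \<Omega>))"
        using pt[OF T] Ds by (intro nn_integral_mono ennreal_leI) auto
      finally show "conj_modular \<delta> p a (patch \<T> T) (\<lambda>x. diameter T powr \<gamma> * g x)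
        \<le> (\<integral>\<^sup>+x. ennreal (Ce * E x) \<partial>lebesgue_on (patch \<T> T \<inter> \<Omega>))" .
    qed
    also have "\<dots> \<le> ennreal N * (\<integral>\<^sup>+x. ennreal (Ce * E x) \<partial>lebesgue_on \<Omega>)"
    proof (rule sum_nn_integral_overlap_le[OF conforming_mesh_finite[OF mesh] _ \<Omega>s])
      show "patch \<T> T \<in> sets lebesgue" if "T \<in> \<T>" for T by (rule patch_domain_facts(1)[OF dom mesh that])
      show "(\<lambda>x. ennreal (Ce * E x)) \<in> borel_measurable (lebesgue_on \<Omega>)" by measurable
      show "real (card {T \<in> \<T>. x \<in> patch \<T> T}) \<le> N" for x
        using patch_overlap[OF dom _ mesh W, of x] dim by (simp add: N_def)
    qed
    also have "(\<integral>\<^sup>+x. ennreal (Ce * E x) \<partial>lebesgue_on \<Omega>) = (\<integral>\<^sup>+x. ennreal (Ce * Ce) * ennreal (E x / Ce) \<partial>lebesgue_on \<Omega>)"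
      using Ce(1) E0 by (intro nn_integral_cong) (simp add: ennreal_mult[symmetric])
    also have "\<dots> = ennreal (Ce * Ce) * (\<integral>\<^sup>+x. ennreal (E x / Ce) \<partial>lebesgue_on \<Omega>)"
      by (rule nn_integral_cmult) measurable
    also have "ennreal N * \<dots> \<le> ennreal N * (ennreal (Ce * Ce) * conj_modular \<delta> p a \<Omega> (\<lambda>x. h powr \<gamma> * g x))"
      unfolding conj_modular_def
    proof (intro mult_left_mono nn_integral_mono ennreal_leI)
      fix x assume "x \<in> space (lebesgue_on \<Omega>)"
      then have x: "x \<in> \<Omega>" using \<Omega>s by simp
      have "E x \<le> Ce * phi_shift_conj \<delta> p (a x) x \<bar>h powr \<gamma> * g x\<bar>"
        using Ce(2)[of \<delta> "a x" "h powr \<gamma> * g x" p x] \<delta> a0 g0[OF x] p[OF x] by (simp add: E_def)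
      then show "E x / Ce \<le> phi_shift_conj \<delta> p (a x) x \<bar>h powr \<gamma> * g x\<bar>"
        using Ce(1) by (simp add: divide_le_eq mult.commute)
    qed auto
    also have "\<dots> = ennreal C * conj_modular \<delta> p a \<Omega> (\<lambda>x. h powr \<gamma> * g x)"
      using Ce(1) N by (simp add: C_def ennreal_mult mult_ac)
    finally show "(\<Sum>T\<in>\<T>. conj_modular \<delta> p a (patch \<T> T) (\<lambda>x. diameter T powr \<gamma> * g x))
       \<le> ennreal C * conj_modular \<delta> p a \<Omega> (\<lambda>x. h powr \<gamma> * g x)" .
  qed
qed

theorem lemma5p18:
  fixes l :: nat
    and m p_minus p_plus \<alpha> p_holder \<delta> \<omega>0 norm_A norm_z stab :: real
  assumes "CARD('n::finite) \<in> {2, 3}"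
    and "0 < m" and "1 < p_minus" and "0 < \<alpha>" and "\<alpha> \<le> 1" and "0 \<le> \<delta>" and "0 < stab"
  shows "\<exists>c>0. \<exists>c\<^sub>\<Omega> :: real \<Rightarrow> real. (\<forall>V. 0 < c\<^sub>\<Omega> V) \<and>
    (\<forall>(\<Omega> :: (real^'n) set) H \<T> Q\<^sub>h P\<^sub>h p \<gamma> z g (A :: real^'n \<Rightarrow> real^'n^'n).
       simplicial_lipschitz_domain \<Omega> \<longrightarrow>
       mesh_family \<Omega> H \<T> \<longrightarrow>
       is_chunkiness H \<T> \<omega>0 \<longrightarrow>
       holder_on \<alpha> (closure \<Omega>) p \<longrightarrow>
       holder_seminorm \<alpha> \<Omega> p = p_holder \<longrightarrow>
       essinf (lebesgue_on \<Omega>) (\<lambda>x. ereal (p x)) = ereal p_minus \<longrightarrow>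
       esssup (lebesgue_on \<Omega>) (\<lambda>x. ereal (p x)) = ereal p_plus \<longrightarrow>
       (\<forall>h\<in>H. fe_space l (\<T> h) (Q\<^sub>h h) \<and>
          linear_projection \<Omega> (Lvar (dual_exponent p) \<Omega>) (Q\<^sub>h h) (P\<^sub>h h) \<and>
          locally_L1_stable stab (\<T> h) (Lvar (dual_exponent p) \<Omega>) (P\<^sub>h h)) \<longrightarrow>
       0 < \<gamma> \<longrightarrow> \<gamma> \<le> 1 \<longrightarrow>
       z \<in> hajlasz_space \<gamma> (dual_exponent p) \<Omega> \<longrightarrow>
       hajlasz_norm \<gamma> (dual_exponent p) \<Omega> z = norm_z \<longrightarrow>
       is_minimal_hajlasz_gradient \<gamma> (dual_exponent p) \<Omega> z g \<longrightarrow>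
       A \<in> Lvar p \<Omega> \<longrightarrow>
       Lvar_norm p \<Omega> A = norm_A \<longrightarrow>
       (\<forall>h\<in>H.
          (\<forall>T\<in>\<T> h.
             conj_modular \<delta> p (\<lambda>x. norm (sym_part (A x))) T (\<lambda>x. z x - P\<^sub>h h z x)
             \<le> ennreal c * (ennreal (diameter T powr m) +
                  conj_modular \<delta> p (\<lambda>x. norm (sym_part (A x))) (patch (\<T> h) T)
                    (\<lambda>x. diameter T powr \<gamma> * g x))
               + ennreal c * L2_norm_squared (patch (\<T> h) T)
                   (\<lambda>x. F_map \<delta> p x (A x) - F_map \<delta> p x (mean_on (patch (\<T> h) T) A))) \<and>
          conj_modular \<delta> p (\<lambda>x. norm (sym_part (A x))) \<Omega> (\<lambda>x. z x - P\<^sub>h h z x)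
          \<le> ennreal (c\<^sub>\<Omega> (measure lebesgue \<Omega>)) * (ennreal (h powr m) +
               conj_modular \<delta> p (\<lambda>x. norm (sym_part (A x))) \<Omega> (\<lambda>x. h powr \<gamma> * g x))
            + ennreal (c\<^sub>\<Omega> (measure lebesgue \<Omega>)) * (\<Sum>T\<in>\<T> h. L2_norm_squared (patch (\<T> h) T)
                (\<lambda>x. F_map \<delta> p x (A x) - F_map \<delta> p x (mean_on (patch (\<T> h) T) A)))))"
proof -
  have dim: "2 \<le> CARD('n)" using assms(1) by auto
  define W where "W = max 1 \<omega>0"
  define v where "v = unit_ball_vol (real CARD('n))"
  have v: "0 < v" by (simp add: v_def)
  have W1: "1 \<le> W" by (simp add: W_def)
  have pm: "1 < p_minus" and \<alpha>: "0 < \<alpha>" and \<delta>: "0 \<le> \<delta>" and stab: "0 < stab" using assms by auto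
  obtain C where C: "1 \<le> C"
    "\<And>(\<Omega> :: (real^'n) set) \<T> V P p \<gamma> z g (A :: real^'n \<Rightarrow> real^'n^'n) T.
       lipschitz_domain \<Omega> \<Longrightarrow> bounded \<Omega> \<Longrightarrow> conforming_mesh \<Omega> \<T> \<Longrightarrow> shape_regular \<T> W \<Longrightarrow> T \<in> \<T> \<Longrightarrow> diameter T \<le> 1 \<Longrightarrow>
       (\<And>x. x \<in> \<Omega> \<Longrightarrow> p_minus \<le> p x \<and> p x \<le> p_plus) \<Longrightarrow>
       (\<And>x y. x \<in> \<Omega> \<Longrightarrow> y \<in> \<Omega> \<Longrightarrow> \<bar>p x - p y\<bar> \<le> \<bar>p_holder\<bar> * dist x y powr \<alpha>) \<Longrightarrow>
       p \<in> borel_measurable (lebesgue_on \<Omega>) \<Longrightarrow>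
       fe_space l \<T> V \<Longrightarrow> linear_projection \<Omega> (Lvar (dual_exponent p) \<Omega>) V P \<Longrightarrow>
       locally_L1_stable stab \<T> (Lvar (dual_exponent p) \<Omega>) P \<Longrightarrow>
       0 < \<gamma> \<Longrightarrow> \<gamma> \<le> 1 \<Longrightarrow> z \<in> Lvar (dual_exponent p) \<Omega> \<Longrightarrow>
       g \<in> hajlasz_gradients \<gamma> (dual_exponent p) \<Omega> z \<Longrightarrow> Lvar_norm (dual_exponent p) \<Omega> g \<le> norm_z \<Longrightarrow>
       A \<in> Lvar p \<Omega> \<Longrightarrow> Lvar_norm p \<Omega> A \<le> norm_A \<Longrightarrow>
       conj_modular \<delta> p (\<lambda>x. norm (sym_part (A x))) T (\<lambda>x. z x - P z x) \<le> ennreal C *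
         (ennreal (diameter T powr m * measure lebesgue T)
          + conj_modular \<delta> p (\<lambda>x. norm (sym_part (A x))) (patch \<T> T) (\<lambda>x. diameter T powr \<gamma> * g x)
          + L2_norm_squared (patch \<T> T) (\<lambda>x. F_map \<delta> p x (A x) - F_map \<delta> p x (mean_on (patch \<T> T) A)))"
    by (rule projection_error_modular_local[OF dim pm \<alpha> abs_ge_zero \<delta> stab W1, of p_plus p_holder l norm_z norm_A m]) blast
  obtain Cg where Cg: "1 \<le> Cg"
    "\<And>\<delta> (p :: real^'n \<Rightarrow> real) a g \<Omega> \<T> h \<gamma>. 0 \<le> \<delta> \<Longrightarrow> lipschitz_domain \<Omega> \<Longrightarrow> conforming_mesh \<Omega> \<T> \<Longrightarrow> shape_regular \<T> W \<Longrightarrow>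
       (\<And>x. x \<in> \<Omega> \<Longrightarrow> p_minus \<le> p x \<and> p x \<le> p_plus) \<Longrightarrow>
       p \<in> borel_measurable (lebesgue_on \<Omega>) \<Longrightarrow> a \<in> borel_measurable (lebesgue_on \<Omega>) \<Longrightarrow>
       g \<in> borel_measurable (lebesgue_on \<Omega>) \<Longrightarrow> (\<And>x. 0 \<le> a x) \<Longrightarrow> (\<And>x. x \<in> \<Omega> \<Longrightarrow> 0 \<le> g x) \<Longrightarrow>
       (\<And>T. T \<in> \<T> \<Longrightarrow> diameter T \<le> h) \<Longrightarrow> 0 < \<gamma> \<Longrightarrow>
       (\<Sum>T\<in>\<T>. conj_modular \<delta> p a (patch \<T> T) (\<lambda>x. diameter T powr \<gamma> * g x))
       \<le> ennreal Cg * conj_modular \<delta> p a \<Omega> (\<lambda>x. h powr \<gamma> * g x)"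
    by (rule sum_conj_modular_patches_le[OF pm dim, of W p_plus]) blast
  \<comment> \<open>Locally the factor \<open>measure lebesgue T\<close> is bounded by the volume \<open>v\<close> of the unit ball, since \<open>diameter T \<le> 1\<close>.\<close>
  define c where "c = C * (v + 1)"
  define N where "N = (4 * W) ^ CARD('n)"
  have N: "0 \<le> N" using W1 by (simp add: N_def)
  \<comment> \<open>The absolute value makes the constant positive for every real argument.\<close>
  define c\<^sub>\<Omega> where "c\<^sub>\<Omega> V = C * (N * \<bar>V\<bar> + Cg)" for V :: real
  have c0: "0 < c" using C(1) v by (simp add: c_def)
  have c\<Omega>0: "0 < c\<^sub>\<Omega> V" for V
    using C(1) Cg(1) N by (simp add: c\<^sub>\<Omega>_def add_nonneg_pos)
  show ?thesis
  proof (rule exI[of _ c], rule conjI[OF c0], rule exI[of _ c\<^sub>\<Omega>], rule conjI, rule allI, rule c\<Omega>0,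
      intro allI impI ballI, goal_cases)
    case (1 \<Omega> H \<T> Q\<^sub>h P\<^sub>h p \<gamma> z g A h)
    let ?a = "\<lambda>x. norm (sym_part (A x))" and ?q = "dual_exponent p"
    let ?E = "\<lambda>T. conj_modular \<delta> p ?a (patch (\<T> h) T) (\<lambda>x. diameter T powr \<gamma> * g x)"
    let ?L = "\<lambda>T. L2_norm_squared (patch (\<T> h) T) (\<lambda>x. F_map \<delta> p x (A x) - F_map \<delta> p x (mean_on (patch (\<T> h) T) A))"
    let ?r = "\<lambda>x. z x - P\<^sub>h h z x"
    have bd: "bounded \<Omega>" and dom: "lipschitz_domain \<Omega>"
      using 1(1) by (auto simp: simplicial_lipschitz_domain_def)
    have op: "open \<Omega>" using dom by (simp add: lipschitz_domain_def)
    have \<Omega>s: "\<Omega> \<in> sets lebesgue" and \<Omega>l: "\<Omega> \<in> lmeasurable"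
      using op bd by (simp_all add: lmeasurable_open)
    have hH: "0 < h" "h \<le> 1" and mesh: "conforming_mesh \<Omega> (\<T> h)" and hmax: "Max (diameter ` \<T> h) = h"
      using 1(2,16) unfolding mesh_family_def by auto
    have fin: "finite (\<T> h)" by (rule conforming_mesh_finite[OF mesh])
    have hT: "diameter T \<le> h" if "T \<in> \<T> h" for T
      using Max_ge[of "diameter ` \<T> h" "diameter T"] fin that hmax by simp
    \<comment> \<open>The given constant is replaced by \<open>max 1 \<omega>0\<close>, because it is not known in advance to be at least \<open>1\<close>.\<close>
    have W: "shape_regular (\<T> h) W"
      using 1(3,16) unfolding is_chunkiness_def chunkiness_bound_def shape_regular_def W_def by fastforce
    have pc: "continuous_on \<Omega> p"
      using continuous_on_subset[OF holder_on_imp_continuous_on[OF 1(4) \<alpha>] closure_subset] .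
    have p: "p_minus \<le> p x \<and> p x \<le> p_plus" if "x \<in> \<Omega>" for x
      using essinf_esssup_bounds[OF op pc 1(6,7) that] by simp
    have pH: "\<bar>p x - p y\<bar> \<le> \<bar>p_holder\<bar> * dist x y powr \<alpha>" if "x \<in> \<Omega>" "y \<in> \<Omega>" for x y
      using holder_seminorm_bound[OF 1(4) that] 1(5) by simp
    have pmeas [measurable]: "p \<in> borel_measurable (lebesgue_on \<Omega>)"
      by (rule continuous_imp_measurable_on_sets_lebesgue[OF pc \<Omega>s])
    have qmeas: "?q \<in> borel_measurable (lebesgue_on \<Omega>)" unfolding dual_exponent_def[abs_def] by measurable
    have q1: "1 \<le> ?q x" if "x \<in> \<Omega>" for x
      using conj_exponent_bounds[OF pm, of "p x"] p[OF that] by (simp add: dual_exponent_def)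
    have zL: "z \<in> Lvar ?q \<Omega>" using 1(11) by (simp add: hajlasz_space_def)
    have z0: "0 \<le> Lvar_norm ?q \<Omega> z" by (rule Lvar_norm_nonneg[OF Lvar_modular_le_1[OF \<Omega>s q1 qmeas zL]])
    have gG: "g \<in> hajlasz_gradients \<gamma> ?q \<Omega> z" and gn: "Lvar_norm ?q \<Omega> g \<le> norm_z"
      using minimal_hajlasz_gradient_norm_le[OF 1(13) z0] 1(12) by auto
    have AL: "A \<in> Lvar p \<Omega>" and An: "Lvar_norm p \<Omega> A \<le> norm_A" using 1(14,15) by auto
    have loc: "conj_modular \<delta> p ?a T ?r \<le> ennreal C * (ennreal (diameter T powr m * measure lebesgue T) + ?E T + ?L T)"
      if T: "T \<in> \<T> h" for T
      by (rule C(2)[OF dom bd mesh W T _ p pH pmeas _ _ _ 1(9,10) zL gG gn AL An])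
        (use 1(8,16) hT[OF T] hH in auto)
    show ?case
    proof (intro conjI ballI)
      fix T assume T: "T \<in> \<T> h"
      have dT: "0 < diameter T" "diameter T \<le> 1" using conforming_mesh_simplex(5)[OF mesh T] hT[OF T] hH by auto
      have "measure lebesgue T \<le> v * diameter T ^ CARD('n)"
        using mesh_element_volume(2)[OF mesh W T] by (simp add: v_def)
      also have "\<dots> \<le> v * 1" using dT v by (intro mult_left_mono power_le_one) auto
      finally have vT: "measure lebesgue T \<le> v" by simp
      have "C * (diameter T powr m * measure lebesgue T) \<le> c * diameter T powr m"
      proof -
        have "C * (diameter T powr m * measure lebesgue T) \<le> C * (diameter T powr m * (v + 1))"
          using vT C(1) by (intro mult_left_mono) auto
        then show ?thesis by (simp add: c_def mult_ac)
      qed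
      then have 1: "ennreal C * ennreal (diameter T powr m * measure lebesgue T) \<le> ennreal c * ennreal (diameter T powr m)"
        using C(1) c0 by (simp add: ennreal_mult[symmetric] ennreal_leI)
      have Cc: "ennreal C \<le> ennreal c" using C(1) v by (intro ennreal_leI) (simp add: c_def)
      have "conj_modular \<delta> p ?a T ?r \<le> ennreal C * ennreal (diameter T powr m * measure lebesgue T) + ennreal C * ?E T + ennreal C * ?L T"
        using loc[OF T] by (simp add: distrib_left)
      also have "\<dots> \<le> ennreal c * ennreal (diameter T powr m) + ennreal c * ?E T + ennreal c * ?L T"
        using 1 Cc by (intro add_mono mult_right_mono) auto
      finally show "conj_modular \<delta> p ?a T ?r \<le> ennreal c * (ennreal (diameter T powr m) + ?E T) + ennreal c * ?L T"
        by (simp add: distrib_left)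
    next
      let ?EO = "conj_modular \<delta> p ?a \<Omega> (\<lambda>x. h powr \<gamma> * g x)"
      let ?c = "c\<^sub>\<Omega> (measure lebesgue \<Omega>)"
      have Ts: "T \<in> sets lebesgue" if "T \<in> \<T> h" for T by (rule patch_domain_facts(2)[OF dom mesh that])
      have "conj_modular \<delta> p ?a \<Omega> ?r \<le> (\<Sum>T\<in>\<T> h. conj_modular \<delta> p ?a (T \<inter> \<Omega>) ?r)"
        unfolding conj_modular_def
      proof (rule nn_integral_le_sum_cover[OF fin Ts \<Omega>s])
        show "\<Omega> \<subseteq> (\<Union>T\<in>\<T> h. T)" using mesh closure_subset[of \<Omega>] by (auto simp: conforming_mesh_def)
      qed
      also have "\<dots> \<le> (\<Sum>T\<in>\<T> h. ennreal C * (ennreal (diameter T powr m * measure lebesgue T) + ?E T + ?L T))"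
      proof (rule sum_mono)
        fix T assume T: "T \<in> \<T> h"
        have "conj_modular \<delta> p ?a (T \<inter> \<Omega>) ?r \<le> conj_modular \<delta> p ?a T ?r"
          unfolding conj_modular_def
          by (rule nn_integral_lebesgue_on_mono_set[OF patch_domain_facts(6)[OF dom mesh T] Ts[OF T]]) auto
        then show "conj_modular \<delta> p ?a (T \<inter> \<Omega>) ?r \<le> ennreal C * (ennreal (diameter T powr m * measure lebesgue T) + ?E T + ?L T)"
          using loc[OF T] by (rule order_trans)
      qed
      also have "\<dots> = ennreal C * ((\<Sum>T\<in>\<T> h. ennreal (diameter T powr m * measure lebesgue T)) + (\<Sum>T\<in>\<T> h. ?E T) + (\<Sum>T\<in>\<T> h. ?L T))"
        by (simp add: sum_distrib_left[symmetric] sum.distrib)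
      also have "\<dots> \<le> ennreal C * (ennreal (N * measure lebesgue \<Omega>) * ennreal (h powr m) + ennreal Cg * ?EO + (\<Sum>T\<in>\<T> h. ?L T))"
      proof (intro mult_left_mono add_mono order_refl)
        have "(\<Sum>T\<in>\<T> h. ennreal (diameter T powr m * measure lebesgue T))
          \<le> (\<Sum>T\<in>\<T> h. ennreal (h powr m) * (\<integral>\<^sup>+x. 1 \<partial>lebesgue_on (T \<inter> \<Omega>)))"
        proof (rule sum_mono)
          fix T assume T: "T \<in> \<T> h"
          note pf = patch_domain_facts[OF dom mesh T]
          have Tl: "T \<inter> \<Omega> \<in> lmeasurable" using fmeasurable_Int_fmeasurable[OF \<Omega>l Ts[OF T]] by (simp add: Int_commute)
          have "0 < diameter T" by (rule conforming_mesh_simplex(5)[OF mesh T])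
          then have "diameter T powr m \<le> h powr m" using hT[OF T] assms(2) by (intro powr_mono2) auto
          then have "diameter T powr m * measure lebesgue T \<le> h powr m * measure lebesgue (T \<inter> \<Omega>)"
            unfolding pf(10) by (intro mult_right_mono) auto
          then have "ennreal (diameter T powr m * measure lebesgue T) \<le> ennreal (h powr m) * ennreal (measure lebesgue (T \<inter> \<Omega>))"
            by (simp add: ennreal_mult[symmetric] ennreal_leI)
          also have "ennreal (measure lebesgue (T \<inter> \<Omega>)) = (\<integral>\<^sup>+x. 1 \<partial>lebesgue_on (T \<inter> \<Omega>))"
            using emeasure_eq_measure2[OF Tl] pf(6) by (simp add: emeasure_restrict_space)
          finally show "ennreal (diameter T powr m * measure lebesgue T) \<le> ennreal (h powr m) * (\<integral>\<^sup>+x. 1 \<partial>lebesgue_on (T \<inter> \<Omega>))" .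
        qed
        also have "\<dots> = ennreal (h powr m) * (\<Sum>T\<in>\<T> h. \<integral>\<^sup>+x. 1 \<partial>lebesgue_on (T \<inter> \<Omega>))"
          by (rule sum_distrib_left[symmetric])
        also have "\<dots> \<le> ennreal (h powr m) * (ennreal N * (\<integral>\<^sup>+x. 1 \<partial>lebesgue_on \<Omega>))"
        proof (intro mult_left_mono sum_nn_integral_overlap_le[OF fin Ts \<Omega>s])
          show "real (card {T \<in> \<T> h. x \<in> T}) \<le> N" for x
            using card_star_le[OF mesh W, of x] by (simp add: N_def)
        qed auto
        also have "(\<integral>\<^sup>+x. 1 \<partial>lebesgue_on \<Omega>) = ennreal (measure lebesgue \<Omega>)"
          using emeasure_eq_measure2[OF \<Omega>l] \<Omega>s by (simp add: emeasure_restrict_space)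
        finally show "(\<Sum>T\<in>\<T> h. ennreal (diameter T powr m * measure lebesgue T)) \<le> ennreal (N * measure lebesgue \<Omega>) * ennreal (h powr m)"
          using N by (simp add: ennreal_mult mult_ac)
        show "(\<Sum>T\<in>\<T> h. ?E T) \<le> ennreal Cg * ?EO"
        proof (rule Cg(2)[OF \<delta> dom mesh W p pmeas _ _ _ _ hT 1(9)])
          have "A \<in> borel_measurable (lebesgue_on \<Omega>)" using AL by (simp add: Lvar_def)
          then have "(\<lambda>x. sym_part (A x)) \<in> borel_measurable (lebesgue_on \<Omega>)"
            by (rule measurable_compose[OF _ borel_measurable_continuous_onI[OF continuous_on_sym_part]])
          then show "?a \<in> borel_measurable (lebesgue_on \<Omega>)" by measurable
          show "g \<in> borel_measurable (lebesgue_on \<Omega>)" using gG by (simp add: hajlasz_gradients_def Lvar_def)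
          show "0 \<le> g x" if "x \<in> \<Omega>" for x using gG that by (simp add: hajlasz_gradients_def)
        qed auto
      qed simp
      also have "\<dots> = ennreal (C * (N * measure lebesgue \<Omega>)) * ennreal (h powr m) + ennreal (C * Cg) * ?EO + ennreal C * (\<Sum>T\<in>\<T> h. ?L T)"
        using C(1) Cg(1) N by (simp add: distrib_left ennreal_mult mult.assoc)
      also have "\<dots> \<le> ennreal ?c * ennreal (h powr m) + ennreal ?c * ?EO + ennreal ?c * (\<Sum>T\<in>\<T> h. ?L T)"
      proof (intro add_mono mult_right_mono ennreal_leI)
        have NO: "0 \<le> N * \<bar>measure lebesgue \<Omega>\<bar>" using N by simp
        show "C * (N * measure lebesgue \<Omega>) \<le> ?c" "C * Cg \<le> ?c"
          unfolding c\<^sub>\<Omega>_def using C(1) Cg(1) NO by (intro mult_left_mono; simp)+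
        have "C * 1 \<le> ?c" unfolding c\<^sub>\<Omega>_def using C(1) Cg(1) NO by (intro mult_left_mono) auto
        then show "C \<le> ?c" by simp
      qed auto
      finally show "conj_modular \<delta> p ?a \<Omega> ?r \<le> ennreal ?c * (ennreal (h powr m) + ?EO) + ennreal ?c * (\<Sum>T\<in>\<T> h. ?L T)"
        by (simp add: distrib_left)
    qed
  qed
qed

end
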